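(* Let $n\to+\infty$ and $p=p_n\to+\infty$, and for each $n$ let $X^{(1)},\dots,X^{(n)}$ be i.i.d. $\mathcal{N}(\mu,\Sigma)$ in $\mathbb{R}^p$, where $\mu\in\mathbb{R}^p$ and the symmetric positive definite matrix $\Sigma=(\sigma_{ij})$ may depend on $n$. Let $B^*=B(\Sigma)$ be the finest block decomposition of $\Sigma$. Assume: (1) $p/n\to y\in\,]0,1[$; (2) there exist $\lambda_{\inf}>0$ and $\lambda_{\sup}<+\infty$ such that for all $n$ the eigenvalues of $\Sigma$ lie in $[\lambda_{\inf},\lambda_{\sup}]$; (3) there exists $m\in\mathbb{N}^*$ such that for all $n$, $|A|\le m$ for every $A\in B^*$; (4) there exists $a>0$ such that for all $n$ and all partitions $B<B^*$, $\|\Sigma_B-\Sigma\|_{\max}\ge a\,n^{-1/4}$. Fix $\delta\in\,]1/2,1[$ and let $\kappa=\frac{1}{pn^\delta}$. Let $\widehat B$ be any one of the four estimators $\widehat{B}_{tot},\widehat{B}_{\widehat{C}},\widehat{B}_\lambda,\widehat{B}_s$ defined in the context. Then $$\frac1p\|S_{B^*}-\Sigma\|_F^2=O_p(1/n)\qquad\text{and}\qquad \frac1p\|S_{\widehat B}-\Sigma\|_F^2=O_p(1/n).$$ Moreover, $$\frac1p\|S_{B^*}-\Sigma\|_F^2\neq o_p(1/n),$$ i.e. $\frac np\|S_{B^*}-\Sigma\|_F^2$ does not converge to $0$ in probability.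
   Context: $\|\Gamma\|_F^2=\sum_{i,j=1}^p\gamma_{ij}^2$ is the squared Frobenius norm, and $\|M\|_{\max}=\max_{i,j}|m_{ij}|$. Partitions: $[1:p]=\{1,\dots,p\}$ and $\mathcal{P}_p$ is the set of partitions of $[1:p]$. For $B,B'\in\mathcal{P}_p$, $B\le B'$ ($B$ is finer than $B'$) if every element of $B'$ is a disjoint union of elements of $B$; $B<B'$ means $B\le B'$ and $B\ne B'$. Write $(i,j)\in B$ if $i,j$ belong to the same element of $B$. For a symmetric matrix $\Gamma=(\gamma_{ij})$, $\Gamma_B$ is the matrix with entries $\gamma_{ij}$ if $(i,j)\in B$ and $0$ otherwise. $B(\Gamma)$ is the unique finest partition $B$ with $\Gamma=\Gamma_B$. Empirical quantities: $\overline{X}=\frac1n\sum_{l=1}^nX^{(l)}$, $S=(s_{ij})=\frac1n\sum_{l=1}^n(X^{(l)}-\overline X)(X^{(l)}-\overline X)^T$ (for large $n$, $n>p$ and $S$ is almost surely positive definite), $\widehat C_{ij}=s_{ij}/\sqrt{s_{ii}s_{jj}}$. Criterion: for $\Gamma$ symmetric positive definite, $l_\Gamma=\frac1p\left(\log|\Gamma|+\mathrm{Tr}(\Gamma^{-1}S)\right)$, where $|\Gamma|$ is the determinant; $\mathrm{pen}(\Gamma)=\mathrm{pen}(B(\Gamma))=\sum_{k=1}^Kp_k^2$ if $B(\Gamma)=\{B_1,\dots,B_K\}$ with $|B_k|=p_k$; $\Phi(\Gamma)=l_\Gamma+\kappa\,\mathrm{pen}(\Gamma)$; $\Psi(B)=\Phi(S_B)$.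 Thresholded partitions: for $\lambda\in[0,1]$, $B_\lambda=B(\widehat C_\lambda)$ with $\widehat C_\lambda=(\widehat C_{ij}\mathbf 1_{|\widehat C_{ij}|>\lambda})_{i,j\le p}$. Estimators: - $\widehat B_{tot}=\operatorname{argmin}_{B\in\mathcal P_p}\Psi(B)$; - $\widehat B_{\widehat C}=\operatorname{argmin}\{\Psi(B): B=B_\lambda,\ \lambda\in A_{\widehat C}\}$ with $A_{\widehat C}=\{|\widehat C_{ij}|: 1\le i<j\le p\}$; - $\widehat B_\lambda=B_{n^{-1/3}}$; - $\widehat B_s=\operatorname{argmin}\{\Psi(B): B=B_\lambda,\ \lambda\in A_s\}$ with $A_s=\{s/p,(s+1)/p,\dots,(p-1)/p,1\}$, where $s$ is the smallest integer such that all groups of $B_{s/p}$ have cardinality at most $m$ (the $m$ of assumption (3), assumed known). *)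

theory Defs
  imports
    "HOL-Probability.Probability"
    "HOL-Library.Disjoint_Sets"
    "Jordan_Normal_Form.Determinant"
    "Jordan_Normal_Form.Char_Poly"
    "Jordan_Normal_Form.Gauss_Jordan_Elimination"
begin

text \<open>
  The dimension varies with the sample size, so matrices are dimension-carrying matrices of type
  \<^typ>\<open>real Matrix.mat\<close>. Coordinates are numbered from \<open>0\<close>: the index set \<open>[1:p]\<close> is
  \<^term>\<open>{..<p::nat}\<close>.
\<close>

text \<open>The value is meaningful for invertible \<open>A\<close> only.\<close>

definition minv :: "real Matrix.mat \<Rightarrow> real Matrix.mat" where
  "minv A = the (mat_inverse A)"

definition mtrace :: "real Matrix.mat \<Rightarrow> real" where
  "mtrace A = (\<Sum>i<dim_row A. A $$ (i, i))"

definition frob_sq :: "real Matrix.mat \<Rightarrow> real" where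
  "frob_sq A = (\<Sum>i<dim_row A. \<Sum>j<dim_col A. (A $$ (i, j))\<^sup>2)"

definition max_norm :: "real Matrix.mat \<Rightarrow> real" where
  "max_norm A = Max {\<bar>A $$ (i, j)\<bar> | i j. i < dim_row A \<and> j < dim_col A}"

definition sym_pos_def :: "real Matrix.mat \<Rightarrow> bool" where
  "sym_pos_def A \<longleftrightarrow> transpose_mat A = A \<and>
     (\<forall>v \<in> carrier_vec (dim_row A). v \<noteq> 0\<^sub>v (dim_row A) \<longrightarrow> scalar_prod v (A *\<^sub>v v) > 0)"

definition same_block :: "nat set set \<Rightarrow> nat \<Rightarrow> nat \<Rightarrow> bool" where
  "same_block B i j \<longleftrightarrow> (\<exists>A\<in>B. i \<in> A \<and> j \<in> A)"

definition restrict_blocks :: "nat set set \<Rightarrow> real Matrix.mat \<Rightarrow> real Matrix.mat" where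
  "restrict_blocks B G =
     Matrix.mat (dim_row G) (dim_col G) (\<lambda>(i, j). if same_block B i j then G $$ (i, j) else 0)"

definition is_finest_partition :: "real Matrix.mat \<Rightarrow> nat set set \<Rightarrow> bool" where
  "is_finest_partition G B \<longleftrightarrow>
     partition_on {..<dim_row G} B \<and> restrict_blocks B G = G \<and>
     (\<forall>B'. partition_on {..<dim_row G} B' \<and> restrict_blocks B' G = G
            \<longrightarrow> refines {..<dim_row G} B B')"

definition block_partition :: "real Matrix.mat \<Rightarrow> nat set set" where
  "block_partition G = (THE B. is_finest_partition G B)"

lemma refines_iff_unions:
  assumes "partition_on A P" "partition_on A Q"
  shows "refines A P Q \<longleftrightarrow> (\<forall>Y\<in>Q. \<exists>C\<subseteq>P. disjoint C \<and> \<Union>C = Y)"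
proof
  assume r: "refines A P Q"
  show "\<forall>Y\<in>Q. \<exists>C\<subseteq>P. disjoint C \<and> \<Union>C = Y"
  proof
    fix Y assume Y: "Y \<in> Q"
    let ?C = "{X\<in>P. X \<subseteq> Y}"
    have "Y \<subseteq> \<Union>?C"
    proof
      fix x assume x: "x \<in> Y"
      then obtain X where X: "X \<in> P" "x \<in> X"
        using Y assms unfolding partition_on_def by blast
      then obtain Z where Z: "Z \<in> Q" "X \<subseteq> Z" using r unfolding refines_def by blast
      have "Z = Y" using Z X x Y assms(2) unfolding partition_on_def disjoint_def by blast
      then show "x \<in> \<Union>?C" using X Z by blast
    qed
    moreover have "disjoint ?C" using assms(1) unfolding partition_on_def disjoint_def by blast
    ultimately show "\<exists>C\<subseteq>P. disjoint C \<and> \<Union>C = Y" by (intro exI[of _ ?C]) blast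
  qed
next
  assume u: "\<forall>Y\<in>Q. \<exists>C\<subseteq>P. disjoint C \<and> \<Union>C = Y"
  have "\<exists>Y\<in>Q. X \<subseteq> Y" if X: "X \<in> P" for X
  proof -
    from X assms(1) obtain x where x: "x \<in> X" unfolding partition_on_def by fastforce
    then obtain Y where Y: "Y \<in> Q" "x \<in> Y" using X assms unfolding partition_on_def by blast
    obtain C where C: "C \<subseteq> P" "\<Union>C = Y" using bspec[OF u Y(1)] by auto
    obtain Z where Z: "Z \<in> C" "x \<in> Z" using Y(2) C(2) by auto
    have "Z \<in> P" using Z(1) C(1) by auto
    then have "Z = X"
      using X x Z(2) partition_onD2[OF assms(1)] by (meson disjoint_iff disjointD)
    then show ?thesis using C(2) Y(1) Z(1) by auto
  qed
  then show "refines A P Q" using assms unfolding refines_def by blast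
qed

lemma same_block_quotient:
  assumes "equiv A r"
  shows "same_block (A // r) i j \<longleftrightarrow> (i, j) \<in> r"
proof
  assume "same_block (A // r) i j"
  then show "(i, j) \<in> r"
    unfolding same_block_def using assms by (meson quotient_eq_iff)
next
  assume "(i, j) \<in> r"
  moreover from this assms have "i \<in> A" by (metis equiv_class_eq_iff)
  ultimately show "same_block (A // r) i j"
    unfolding same_block_def using assms by (meson Image_singleton_iff equiv_class_self quotientI)
qed

lemma block_partition_well_defined:
  assumes "transpose_mat G = G"
  shows "\<exists>!B. is_finest_partition G B"
proof -
  define n where "n = dim_row G"
  have dc: "dim_col G = n" using assms unfolding n_def by (metis index_transpose_mat(2))
  define E where "E = {(i, j). i < n \<and> j < n \<and> G $$ (i, j) \<noteq> 0}"
  have symE: "sym E"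
  proof (rule symI)
    fix i j assume "(i, j) \<in> E"
    then show "(j, i) \<in> E"
      unfolding E_def using assms dc n_def by (auto) (metis index_transpose_mat(1))
  qed
  define r where "r = E\<^sup>* \<inter> {..<n} \<times> {..<n}"
  have eq: "equiv {..<n} r"
    unfolding r_def equiv_def using sym_rtrancl[OF symE]
    by (auto simp: refl_on_def sym_def trans_def intro: rtrancl_trans)
  let ?P = "{..<n} // r"
  have part: "partition_on {..<n} ?P" using eq by (rule partition_on_quotient)
  have mask: "restrict_blocks ?P G = G"
  proof (rule eq_matI)
    fix i j assume "i < dim_row G" "j < dim_col G"
    then have ij: "i < n" "j < n" using dc n_def by auto
    have "(i, j) \<in> r" if "G $$ (i, j) \<noteq> 0" using that ij unfolding r_def E_def by blast
    then show "restrict_blocks ?P G $$ (i, j) = G $$ (i, j)"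
      using ij dc n_def same_block_quotient[OF eq] by (auto simp: restrict_blocks_def)
  qed (simp_all add: restrict_blocks_def)
  have fin: "refines {..<n} ?P B'"
    if B': "partition_on {..<n} B'" and m: "restrict_blocks B' G = G" for B'
  proof -
    have step: "same_block B' i j" if "(i, j) \<in> E" for i j
    proof -
      from that have ij: "i < n" "j < n" "G $$ (i, j) \<noteq> 0" unfolding E_def by auto
      then have "restrict_blocks B' G $$ (i, j) \<noteq> 0" using m by simp
      then show ?thesis using ij dc n_def by (auto simp: restrict_blocks_def split: if_splits)
    qed
    have tr: "same_block B' i k" if "same_block B' i j" "same_block B' j k" for i j k
      using that B' unfolding same_block_def partition_on_def disjoint_def by blast
    have star: "i < n \<longrightarrow> same_block B' i j" if "(i, j) \<in> E\<^sup>*" for i j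
      using that
    proof (induction rule: rtrancl_induct)
      case base
      show ?case using B' unfolding same_block_def partition_on_def by blast
    next
      case (step j k)
      then show ?case using \<open>\<And>i j. (i, j) \<in> E \<Longrightarrow> same_block B' i j\<close> tr by blast
    qed
    have "\<exists>Y\<in>B'. X \<subseteq> Y" if "X \<in> ?P" for X
    proof -
      from that obtain i where i: "i < n" "X = r `` {i}" by (auto elim: quotientE)
      obtain Y where Y: "Y \<in> B'" "i \<in> Y" using i B' unfolding partition_on_def by blast
      have "X \<subseteq> Y"
      proof
        fix j assume "j \<in> X"
        then have "same_block B' i j" using i star unfolding r_def by blast
        then show "j \<in> Y" using Y B' unfolding same_block_def partition_on_def disjoint_def by blast
      qed
      then show ?thesis using Y by blast
    qed
    then show ?thesis using part B' unfolding refines_def by blast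
  qed
  show ?thesis
  proof (rule ex1I[of _ ?P])
    show "is_finest_partition G ?P"
      unfolding is_finest_partition_def n_def[symmetric] using part mask fin by blast
  next
    fix B assume "is_finest_partition G B"
    then show "B = ?P"
      unfolding is_finest_partition_def n_def[symmetric] using part mask fin refines_asym by blast
  qed
qed

text \<open>
  A random vector of \<open>\<real>\<^sup>p\<close> takes values in the space of \<open>\<Pi>\<^sub>M i\<in>{..<p}. lborel\<close>; the density is
  taken with respect to this product measure.
\<close>

definition mvn_density :: "nat \<Rightarrow> real Matrix.vec \<Rightarrow> real Matrix.mat \<Rightarrow> (nat \<Rightarrow> real) \<Rightarrow> real" where
  "mvn_density p \<mu> Sig x =
     exp (- scalar_prod (Matrix.vec p x - \<mu>) (minv Sig *\<^sub>v (Matrix.vec p x - \<mu>)) / 2)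
     / sqrt ((2 * pi) ^ p * Determinant.det Sig)"

definition iid_mvn :: "'w measure \<Rightarrow> nat \<Rightarrow> nat \<Rightarrow> real Matrix.vec \<Rightarrow> real Matrix.mat
    \<Rightarrow> (nat \<Rightarrow> 'w \<Rightarrow> nat \<Rightarrow> real) \<Rightarrow> bool" where
  "iid_mvn M p n \<mu> Sig X \<longleftrightarrow>
     prob_space.indep_vars M (\<lambda>_. \<Pi>\<^sub>M i\<in>{..<p}. lborel) X {1..n} \<and>
     (\<forall>l\<in>{1..n}. distributed M (\<Pi>\<^sub>M i\<in>{..<p}. lborel) (X l)
                    (\<lambda>x. ennreal (mvn_density p \<mu> Sig x)))"

definition sample_mean :: "nat \<Rightarrow> (nat \<Rightarrow> nat \<Rightarrow> real) \<Rightarrow> nat \<Rightarrow> real" where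
  "sample_mean n x i = (\<Sum>l=1..n. x l i) / real n"

definition sample_cov :: "nat \<Rightarrow> nat \<Rightarrow> (nat \<Rightarrow> nat \<Rightarrow> real) \<Rightarrow> real Matrix.mat" where
  "sample_cov p n x = Matrix.mat p p (\<lambda>(i, j).
     (\<Sum>l=1..n. (x l i - sample_mean n x i) * (x l j - sample_mean n x j)) / real n)"

definition corr_mat :: "real Matrix.mat \<Rightarrow> real Matrix.mat" where
  "corr_mat S = Matrix.mat (dim_row S) (dim_col S)
     (\<lambda>(i, j). S $$ (i, j) / sqrt (S $$ (i, i) * S $$ (j, j)))"

definition loglik :: "real Matrix.mat \<Rightarrow> real Matrix.mat \<Rightarrow> real" where
  "loglik S G = (ln (Determinant.det G) + mtrace (minv G * S)) / real (dim_row S)"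

definition pen :: "real Matrix.mat \<Rightarrow> real" where
  "pen G = (\<Sum>A\<in>block_partition G. (real (card A))\<^sup>2)"

definition Phi :: "real \<Rightarrow> real Matrix.mat \<Rightarrow> real Matrix.mat \<Rightarrow> real" where
  "Phi \<kappa> S G = loglik S G + \<kappa> * pen G"

definition Psi :: "real \<Rightarrow> real Matrix.mat \<Rightarrow> nat set set \<Rightarrow> real" where
  "Psi \<kappa> S B = Phi \<kappa> S (restrict_blocks B S)"

definition threshold :: "real \<Rightarrow> real Matrix.mat \<Rightarrow> real Matrix.mat" where
  "threshold t C = Matrix.mat (dim_row C) (dim_col C)
     (\<lambda>(i, j). if \<bar>C $$ (i, j)\<bar> > t then C $$ (i, j) else 0)"

definition B_thr :: "real Matrix.mat \<Rightarrow> real \<Rightarrow> nat set set" where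
  "B_thr S t = block_partition (threshold t (corr_mat S))"

definition A_corr :: "real Matrix.mat \<Rightarrow> real set" where
  "A_corr S = {\<bar>corr_mat S $$ (i, j)\<bar> | i j. i < j \<and> j < dim_row S}"

definition s_min :: "nat \<Rightarrow> real Matrix.mat \<Rightarrow> nat" where
  "s_min m S = (LEAST s. \<forall>A\<in>B_thr S (real s / real (dim_row S)). card A \<le> m)"

definition A_s :: "nat \<Rightarrow> real Matrix.mat \<Rightarrow> real set" where
  "A_s m S = {real k / real (dim_row S) | k. s_min m S \<le> k \<and> k \<le> dim_row S}"

text \<open>
  A minimiser of \<open>\<Psi>\<close> is not assumed to be unique: the predicates below hold of every minimiser.
\<close>

definition is_B_tot :: "real \<Rightarrow> real Matrix.mat \<Rightarrow> nat set set \<Rightarrow> bool" where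
  "is_B_tot \<kappa> S B \<longleftrightarrow> is_arg_min (Psi \<kappa> S) (\<lambda>B. partition_on {..<dim_row S} B) B"

definition is_B_corr :: "real \<Rightarrow> real Matrix.mat \<Rightarrow> nat set set \<Rightarrow> bool" where
  "is_B_corr \<kappa> S B \<longleftrightarrow> is_arg_min (Psi \<kappa> S) (\<lambda>B. B \<in> B_thr S ` A_corr S) B"

definition is_B_s :: "nat \<Rightarrow> real \<Rightarrow> real Matrix.mat \<Rightarrow> nat set set \<Rightarrow> bool" where
  "is_B_s m \<kappa> S B \<longleftrightarrow> is_arg_min (Psi \<kappa> S) (\<lambda>B. B \<in> B_thr S ` A_s m S) B"

text \<open>The probability space may change with \<open>n\<close>.\<close>

definition bigO_p :: "(nat \<Rightarrow> 'w measure) \<Rightarrow> (nat \<Rightarrow> 'w \<Rightarrow> real) \<Rightarrow> (nat \<Rightarrow> real) \<Rightarrow> bool" where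
  "bigO_p M T r \<longleftrightarrow> (\<forall>\<epsilon>>0. \<exists>K. \<forall>\<^sub>F n in sequentially.
     measure (M n) {\<omega> \<in> space (M n). \<bar>T n \<omega>\<bar> > K * \<bar>r n\<bar>} \<le> \<epsilon>)"

definition smallo_p :: "(nat \<Rightarrow> 'w measure) \<Rightarrow> (nat \<Rightarrow> 'w \<Rightarrow> real) \<Rightarrow> (nat \<Rightarrow> real) \<Rightarrow> bool" where
  "smallo_p M T r \<longleftrightarrow> (\<forall>\<epsilon>>0.
     (\<lambda>n. measure (M n) {\<omega> \<in> space (M n). \<bar>T n \<omega>\<bar> > \<epsilon> * \<bar>r n\<bar>}) \<longlonglongrightarrow> 0)"

end

theory Submission
  imports Defs "HOL-Real_Asymp.Real_Asymp"
begin

text \<open>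
  With probability tending to one, all four estimators \<open>B\<close> satisfy \<open>S\<^sub>B = S\<^sub>B\<^sub>*\<close>, where \<open>B*\<close> is the
  block structure of \<open>\<Sigma>\<close>. This reduces both bounds to \<open>S\<^sub>B\<^sub>*\<close>, which has at most \<open>p m\<close> non-zero entries,
  each with mean square error \<open>O(1/n)\<close> (\<open>entry_second_moment\<close>), so Markov's inequality gives the rate
  (\<open>bigO_Bstar\<close>). The rate is sharp because each diagonal entry of \<open>S\<close> misses its target by a multiple
  of \<open>n\<^sup>-\<^sup>1\<^sup>/\<^sup>2\<close> with a probability bounded below (\<open>prob_diag_large\<close>); a positive fraction of the \<open>p\<close>
  diagonal entries does so on average (\<open>not_smallo_Bstar\<close>).

  The selection step is deterministic once \<open>S\<close> has spectrum in a fixed interval \<open>[c, K]\<close> with \<open>c > 0\<close>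
  and entries within \<open>\<tau> \<approx> n\<^sup>-\<^sup>\<beta>\<close> of \<open>\<Sigma>\<close>, for some \<open>\<beta> < 1/2\<close> above \<open>\<delta>/2\<close> and \<open>1/3\<close> (locale
  \<open>block_approx\<close>). Since \<open>Tr(S\<^sub>B\<^sup>-\<^sup>1 S) = p\<close>, the criterion \<open>p \<Psi>(B)\<close> is, up to a constant,
  \<open>ln |S\<^sub>B| + n\<^sup>-\<^sup>\<delta> \<Sum>p\<^sub>k\<^sup>2\<close>. Cutting a partition \<open>B\<close> along \<open>B*\<close> removes entries of size at most \<open>\<tau>\<close>; the
  log-determinant rises by at most \<open>\<tau>\<^sup>2/c\<^sup>2\<close> per removed entry (\<open>ln_det_diff_le_frob\<close>), which is less
  than the penalty \<open>n\<^sup>-\<^sup>\<delta>\<close> saved (\<open>crit_merge\<close>). If \<open>B\<close> is strictly finer than \<open>B*\<close>, the gap assumption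
  yields an entry of order at least \<open>n\<^sup>-\<^sup>1\<^sup>/\<^sup>4\<close> between two blocks of \<open>B\<close>; uniting these blocks lowers the
  log-determinant by at least a multiple of \<open>n\<^sup>-\<^sup>1\<^sup>/\<^sup>2\<close> (\<open>ln_det_le_regression\<close>) and costs a penalty of at most
  \<open>m\<^sup>2 n\<^sup>-\<^sup>\<delta>\<close>, which is smaller as \<open>\<delta> > 1/2\<close> (\<open>crit_split\<close>). Hence \<open>B*\<close> is the only minimiser of this
  criterion among all partitions. Thresholding the correlations anywhere between \<open>\<tau>/c\<close> and a multiple
  of \<open>n\<^sup>-\<^sup>1\<^sup>/\<^sup>4\<close> also produces \<open>B*\<close>, which settles the threshold \<open>n\<^sup>-\<^sup>1\<^sup>/\<^sup>3\<close> and puts \<open>B*\<close> into the two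
  restricted families of candidates (\<open>estimators_restrict\<close>).

  The probabilistic input rests on one-dimensional projections: \<open>\<langle>w, X - \<mu>\<rangle>\<close> is centred normal with
  variance \<open>w\<^sup>T \<Sigma> w\<close> (\<open>nn_integral_proj\<close>). Exponential moments of its squares give the entrywise bound
  (\<open>entries_close\<close>) and, on a net of the sphere, the upper spectral bound (\<open>op_norm_event\<close>). For the
  lower one, a fixed direction \<open>w\<close> violates \<open>w\<^sup>T S w \<ge> \<epsilon>\<^sup>2\<close> with probability of order \<open>(C \<epsilon>)\<^sup>n\<close>, because
  the normal density is bounded, while an \<open>\<epsilon>\<close>-net has of order \<open>(C/\<epsilon>)\<^sup>p\<close> points. As \<open>p/n\<close> tends to
  \<open>y < 1\<close>, a sufficiently small constant \<open>\<epsilon>\<close> makes the union bound converge to zero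
  (\<open>lower_event\<close>, \<open>ex_small_scale\<close>).
\<close>

section \<open>Quadratic forms and positive definite matrices\<close>

definition quad :: "real Matrix.mat \<Rightarrow> (nat \<Rightarrow> real) \<Rightarrow> real" where
  "quad A u = (\<Sum>i<dim_row A. \<Sum>j<dim_row A. u i * A $$ (i, j) * u j)"

lemma index_mult_sum:
  fixes A B :: "real Matrix.mat"
  assumes "A \<in> carrier_mat n k" "B \<in> carrier_mat k m" "i < n" "j < m"
  shows "(A * B) $$ (i, j) = (\<Sum>l<k. A $$ (i, l) * B $$ (l, j))"
  using assms by (auto simp: scalar_prod_def atLeast0LessThan intro!: sum.cong)

lemma quad_carrier:
  assumes "A \<in> carrier_mat n n"
  shows "quad A u = (\<Sum>i<n. \<Sum>j<n. u i * A $$ (i, j) * u j)"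
  using assms by (auto simp: quad_def)

lemma scalar_prod_quad:
  assumes "A \<in> carrier_mat n n" "v \<in> carrier_vec n"
  shows "scalar_prod v (A *\<^sub>v v) = quad A (vec_index v)"
  using assms by (auto simp: quad_carrier scalar_prod_def atLeast0LessThan sum_distrib_left
      mult.assoc intro!: sum.cong)

lemma quad_vec:
  assumes "A \<in> carrier_mat n n"
  shows "quad A u = scalar_prod (Matrix.vec n u) (A *\<^sub>v Matrix.vec n u)"
  using assms by (subst scalar_prod_quad[where n = n]) (auto simp: quad_carrier intro!: sum.cong)

lemma quad_cong:
  assumes "A \<in> carrier_mat n n" "\<And>i. i < n \<Longrightarrow> u i = v i"
  shows "quad A u = quad A v"
  using assms by (auto simp: quad_carrier intro!: sum.cong)

lemma sym_pos_def_iff_quad: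
  assumes A: "A \<in> carrier_mat n n"
  shows "sym_pos_def A \<longleftrightarrow> (\<forall>i<n. \<forall>j<n. A $$ (i, j) = A $$ (j, i)) \<and>
    (\<forall>u. (\<exists>i<n. u i \<noteq> 0) \<longrightarrow> quad A u > 0)"
proof -
  have "transpose_mat A = A \<longleftrightarrow> (\<forall>i<n. \<forall>j<n. A $$ (i, j) = A $$ (j, i))"
    using A by (auto simp: mat_eq_iff)
  moreover have "(\<forall>v \<in> carrier_vec n. v \<noteq> 0\<^sub>v n \<longrightarrow> scalar_prod v (A *\<^sub>v v) > 0) \<longleftrightarrow>
     (\<forall>u. (\<exists>i<n. u i \<noteq> 0) \<longrightarrow> quad A u > 0)" (is "?L \<longleftrightarrow> ?R")
  proof
    assume L: ?L
    show ?R
    proof (intro allI impI)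
      fix u :: "nat \<Rightarrow> real" assume "\<exists>i<n. u i \<noteq> 0"
      then have "Matrix.vec n u \<noteq> 0\<^sub>v n" by (auto simp: vec_eq_iff)
      then show "quad A u > 0" using L by (auto simp: quad_vec[OF A])
    qed
  next
    assume R: ?R
    show ?L
    proof (intro ballI impI)
      fix v :: "real Matrix.vec" assume v: "v \<in> carrier_vec n" "v \<noteq> 0\<^sub>v n"
      then have "\<exists>i<n. vec_index v i \<noteq> 0" by (auto simp: vec_eq_iff)
      then show "scalar_prod v (A *\<^sub>v v) > 0" using R v by (simp add: scalar_prod_quad[OF A])
    qed
  qed
  ultimately show ?thesis using A unfolding sym_pos_def_def by auto
qed

lemma sym_pos_def_symD:
  assumes "sym_pos_def A" "A \<in> carrier_mat n n" "i < n" "j < n"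
  shows "A $$ (i, j) = A $$ (j, i)"
  using assms by (auto simp: sym_pos_def_iff_quad)

lemma sym_pos_def_quad_pos:
  assumes "sym_pos_def A" "A \<in> carrier_mat n n" "i < n" "u i \<noteq> 0"
  shows "quad A u > 0"
  using assms by (auto simp: sym_pos_def_iff_quad)

lemma quad_unit:
  assumes "A \<in> carrier_mat n n" "i < n"
  shows "quad A (\<lambda>k. if k = i then 1 else 0) = A $$ (i, i)"
  using assms by (simp add: quad_carrier if_distrib[of "\<lambda>x. x * _"] if_distrib[of "\<lambda>x. _ * x"]
     sum.delta cong: if_cong)

lemma quad_congruence:
  assumes A: "A \<in> carrier_mat n n" and P: "P \<in> carrier_mat n n"
  shows "quad (transpose_mat P * A * P) u = quad A (\<lambda>i. \<Sum>j<n. P $$ (i, j) * u j)"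
proof -
  let ?v = "Matrix.vec n u"
  have Pv: "P *\<^sub>v ?v = Matrix.vec n (\<lambda>i. \<Sum>j<n. P $$ (i, j) * u j)"
    using P by (intro eq_vecI) (auto simp: scalar_prod_def atLeast0LessThan intro!: sum.cong)
  have c: "transpose_mat P * A * P \<in> carrier_mat n n" using A P by auto
  have e: "(transpose_mat P * A * P) *\<^sub>v ?v = transpose_mat P *\<^sub>v (A *\<^sub>v (P *\<^sub>v ?v))"
    using A P by (simp add: assoc_mult_mat_vec[of _ n n _ n])
  have "quad (transpose_mat P * A * P) u
      = scalar_prod (transpose_mat P *\<^sub>v (A *\<^sub>v (P *\<^sub>v ?v))) ?v"
    unfolding quad_vec[OF c] e using A P by (intro comm_scalar_prod[of _ n]) auto
  also have "\<dots> = scalar_prod (A *\<^sub>v (P *\<^sub>v ?v)) (P *\<^sub>v ?v)"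
    using A P by (intro transpose_vec_mult_scalar[of _ n n]) auto
  also have "\<dots> = scalar_prod (P *\<^sub>v ?v) (A *\<^sub>v (P *\<^sub>v ?v))"
    using A P by (intro comm_scalar_prod[of _ n]) auto
  finally show ?thesis unfolding Pv using A by (simp add: quad_vec)
qed

lemma sym_pos_def_det_nz:
  assumes "sym_pos_def A" "A \<in> carrier_mat n n"
  shows "Determinant.det A \<noteq> 0"
proof
  assume "Determinant.det A = 0"
  then obtain v where "v \<in> carrier_vec n" "v \<noteq> 0\<^sub>v n" "A *\<^sub>v v = 0\<^sub>v n"
    using det_0_iff_vec_prod_zero[OF assms(2)] by auto
  then show False using assms unfolding sym_pos_def_def by fastforce
qed

lemma minv_inverse:
  assumes A: "A \<in> carrier_mat n n" and d: "Determinant.det A \<noteq> 0"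
  shows "A * minv A = 1\<^sub>m n" "minv A * A = 1\<^sub>m n" "minv A \<in> carrier_mat n n"
proof -
  have "mat_inverse A \<noteq> None"
    using mat_inverse(1)[OF A, of "()"] det_non_zero_imp_unit[OF A d, of "()"] by auto
  then have "mat_inverse A = Some (minv A)" unfolding minv_def by auto
  from mat_inverse(2)[OF A this]
  show "A * minv A = 1\<^sub>m n" "minv A * A = 1\<^sub>m n" "minv A \<in> carrier_mat n n" by auto
qed

lemma sym_pos_def_congruence:
  assumes spd: "sym_pos_def A" and A: "A \<in> carrier_mat n n" and P: "P \<in> carrier_mat n n"
    and d: "Determinant.det P \<noteq> 0"
  shows "sym_pos_def (transpose_mat P * A * P)"
proof -
  have c: "transpose_mat P * A * P \<in> carrier_mat n n" using A P by auto
  have "transpose_mat (transpose_mat P * A * P) = transpose_mat P * A * P"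
    using A P spd unfolding sym_pos_def_def
    by (simp add: transpose_mult[of _ n n _ n] assoc_mult_mat[of _ n n _ n _ n])
  then have "\<forall>i<n. \<forall>j<n. (transpose_mat P * A * P) $$ (i, j) = (transpose_mat P * A * P) $$ (j, i)"
    using c by (metis carrier_matD index_transpose_mat(1))
  moreover have "quad (transpose_mat P * A * P) u > 0" if i: "i < n" "u i \<noteq> 0" for u i
  proof -
    let ?w = "\<lambda>i. \<Sum>j<n. P $$ (i, j) * u j"
    have "\<exists>k<n. ?w k \<noteq> 0"
    proof (rule ccontr)
      assume "\<not> (\<exists>k<n. ?w k \<noteq> 0)"
      then have "P *\<^sub>v Matrix.vec n u = 0\<^sub>v n"
        using P by (intro eq_vecI) (auto simp: scalar_prod_def atLeast0LessThan)
      moreover have "Matrix.vec n u \<noteq> 0\<^sub>v n" using i by (auto simp: vec_eq_iff)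
      ultimately show False using d det_0_iff_vec_prod_zero[OF P] by (metis vec_carrier)
    qed
    then show ?thesis unfolding quad_congruence[OF A P]
      using spd A by (auto simp: sym_pos_def_iff_quad)
  qed
  ultimately show ?thesis by (auto simp: sym_pos_def_iff_quad[OF c])
qed

text \<open>
  One step of a Cholesky factorisation: the unipotent \<open>U\<close> clears the last row and column of
  \<open>A\<close> and leaves the Schur complement \<open>s = A\<^sub>n\<^sub>n - b\<^sup>T A\<^sub>0\<^sup>-\<^sup>1 b\<close> in the corner. It carries the
  inductions on the dimension below.
\<close>
lemma sym_pos_def_border:
  assumes spd: "sym_pos_def A" and A: "A \<in> carrier_mat (Suc n) (Suc n)"
  obtains U A0 s where "U \<in> carrier_mat (Suc n) (Suc n)" "Determinant.det U = 1"
    "A0 \<in> carrier_mat n n" "sym_pos_def A0" "0 < s" "s \<le> A $$ (n, n)"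
    "\<And>i. i < n \<Longrightarrow> A0 $$ (i, i) = A $$ (i, i)"
    "transpose_mat U * A * U = four_block_mat A0 (0\<^sub>m n 1) (0\<^sub>m 1 n) (Matrix.mat 1 1 (\<lambda>_. s))"
proof -
  define A0 where "A0 = Matrix.mat n n (\<lambda>ij. A $$ ij)"
  have A0c: "A0 \<in> carrier_mat n n" by (simp add: A0_def)
  have sym: "A $$ (i, j) = A $$ (j, i)" if "i < Suc n" "j < Suc n" for i j
    using sym_pos_def_symD[OF spd A that] .
  have quad0: "quad A0 u = quad A (\<lambda>i. if i = n then 0 else u i)" for u
    unfolding quad_carrier[OF A0c] quad_carrier[OF A] by (auto simp: A0_def intro!: sum.cong)
  have A0spd: "sym_pos_def A0"
    unfolding sym_pos_def_iff_quad[OF A0c]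
  proof (intro conjI allI impI)
    fix u :: "nat \<Rightarrow> real" assume "\<exists>i<n. u i \<noteq> 0"
    then obtain i where i: "i < n" "u i \<noteq> 0" by auto
    show "quad A0 u > 0" unfolding quad0
      by (rule sym_pos_def_quad_pos[OF spd A, of i]) (use i in auto)
  qed (auto simp: A0_def sym)
  note inv = minv_inverse[OF A0c sym_pos_def_det_nz[OF A0spd A0c]]
  define b where "b = Matrix.mat n 1 (\<lambda>(i, _). A $$ (i, n))"
  define v where "v = minv A0 * b"
  have bc: "b \<in> carrier_mat n 1" and vc: "v \<in> carrier_mat n 1"
    using inv(3) by (auto simp: b_def v_def)
  have A0v: "A0 * v = b"
    unfolding v_def using inv A0c bc by (simp flip: assoc_mult_mat[of _ n n _ n _ 1])
  define g where "g = Matrix.mat 1 1 (\<lambda>_. A $$ (n, n))"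
  define S where "S = g + transpose_mat b * (- v)"
  define s where "s = S $$ (0, 0)"
  define U where "U = four_block_mat (1\<^sub>m n) (- v) (0\<^sub>m 1 n) (1\<^sub>m 1)"
  have gc: "g \<in> carrier_mat 1 1" by (simp add: g_def)
  have Sc: "S \<in> carrier_mat 1 1" using gc bc vc by (auto simp: S_def)
  have Ablock: "A = four_block_mat A0 b (transpose_mat b) g"
    using A by (intro eq_matI) (auto simp: A0_def b_def g_def sym less_Suc_eq)
  have Uc: "U \<in> carrier_mat (Suc n) (Suc n)"
    unfolding U_def using four_block_carrier_mat[of "1\<^sub>m n" n n "1\<^sub>m 1" 1 1] by simp
  have detU: "Determinant.det U = 1"
    unfolding U_def using vc
    by (subst det_four_block_mat_lower_left_zero[of _ n _ 1]) auto
  have Ut: "transpose_mat U = four_block_mat (1\<^sub>m n) (0\<^sub>m n 1) (- transpose_mat v) (1\<^sub>m 1)"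
    unfolding U_def using vc
    by (subst transpose_four_block_mat[of _ n n _ 1 _ 1]) (auto simp: transpose_uminus)
  have m0: "A0 * (- v) + b = 0\<^sub>m n 1"
    using A0c vc bc A0v by (auto intro!: eq_matI)
  have m1: "- transpose_mat v * A0 + transpose_mat b = 0\<^sub>m 1 n"
  proof -
    have "transpose_mat (A0 * (- v) + b) = - transpose_mat v * transpose_mat A0 + transpose_mat b"
      using A0c vc bc by (simp add: transpose_add[of _ n 1] transpose_mult[of _ n n _ 1] transpose_uminus)
    moreover have "transpose_mat A0 = A0" using A0spd unfolding sym_pos_def_def by auto
    ultimately show ?thesis using m0 by simp
  qed
  have AU: "A * U = four_block_mat A0 (0\<^sub>m n 1) (transpose_mat b) S"
    unfolding Ablock U_def
    by (subst mult_four_block_mat[of _ n n _ 1 _ 1])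
      (use A0c bc vc gc m0 in \<open>auto simp: S_def comm_add_mat[of _ 1 1]\<close>)
  have UAU: "transpose_mat U * A * U = four_block_mat A0 (0\<^sub>m n 1) (0\<^sub>m 1 n) S"
  proof -
    have "transpose_mat U * A * U = transpose_mat U * (A * U)"
      using Uc A by (simp add: assoc_mult_mat[of _ "Suc n" "Suc n" _ "Suc n" _ "Suc n"])
    also have "\<dots> = four_block_mat A0 (0\<^sub>m n 1) (0\<^sub>m 1 n) S"
      unfolding AU Ut
      by (subst mult_four_block_mat[of _ n n _ 1 _ 1]) (use A0c bc vc Sc m1 in auto)
    finally show ?thesis .
  qed
  have S_eq: "S = Matrix.mat 1 1 (\<lambda>_. s)" using Sc by (auto simp: s_def intro!: eq_matI)
  have spdU: "sym_pos_def (transpose_mat U * A * U)"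
    by (rule sym_pos_def_congruence[OF spd A Uc]) (simp add: detU)
  have s_pos: "0 < s"
  proof -
    have c: "transpose_mat U * A * U \<in> carrier_mat (Suc n) (Suc n)" using A Uc by auto
    have "quad (transpose_mat U * A * U) (\<lambda>k. if k = n then 1 else 0) > 0"
      by (rule sym_pos_def_quad_pos[OF spdU c, of n]) auto
    then have "(transpose_mat U * A * U) $$ (n, n) > 0" by (simp add: quad_unit[OF c])
    then show ?thesis unfolding UAU using A0c Sc by (simp add: s_def)
  qed
  have s_le: "s \<le> A $$ (n, n)"
  proof -
    have "(\<Sum>i<n. b $$ (i, 0) * v $$ (i, 0)) = quad A0 (\<lambda>i. v $$ (i, 0))"
      unfolding A0v[symmetric] quad_carrier[OF A0c] using A0c vc
      by (auto simp: index_mult_sum[OF A0c vc] sum_distrib_right sum_distrib_left ac_simps simp del: index_mult_mat intro!: sum.cong)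
    moreover have "quad A0 (\<lambda>i. v $$ (i, 0)) \<ge> 0"
    proof (cases "\<exists>i<n. v $$ (i, 0) \<noteq> 0")
      case True
      then show ?thesis using A0spd by (auto simp: sym_pos_def_iff_quad[OF A0c] intro: less_imp_le)
    next
      case False
      then show ?thesis by (simp add: quad_carrier[OF A0c])
    qed
    moreover have "s = A $$ (n, n) - (\<Sum>i<n. b $$ (i, 0) * v $$ (i, 0))"
      using bc vc by (simp add: s_def S_def g_def scalar_prod_def atLeast0LessThan sum_negf)
    ultimately show ?thesis by simp
  qed
  show ?thesis
    by (rule that[OF Uc detU A0c A0spd s_pos s_le _ UAU[unfolded S_eq]]) (simp add: A0_def)
qed

lemma sym_pos_def_det_congruence:
  assumes "A \<in> carrier_mat n n" "P \<in> carrier_mat n n"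
  shows "Determinant.det (transpose_mat P * A * P) = (Determinant.det P)\<^sup>2 * Determinant.det A"
  using assms by (simp add: det_mult[of _ n] det_transpose[of _ n] power2_eq_square)

lemma sym_pos_def_congruent_one:
  assumes "sym_pos_def A" "A \<in> carrier_mat n n"
  shows "\<exists>P \<in> carrier_mat n n. transpose_mat P * A * P = 1\<^sub>m n"
  using assms
proof (induction n arbitrary: A)
  case 0
  then show ?case by (intro bexI[of _ "1\<^sub>m 0"]) (auto intro!: eq_matI)
next
  case (Suc n)
  note A = Suc.prems(2)
  obtain U A0 s where U: "U \<in> carrier_mat (Suc n) (Suc n)" "A0 \<in> carrier_mat n n" "sym_pos_def A0" "0 < s"
    "transpose_mat U * A * U = four_block_mat A0 (0\<^sub>m n 1) (0\<^sub>m 1 n) (Matrix.mat 1 1 (\<lambda>_. s))"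
    using sym_pos_def_border[OF Suc.prems] by metis
  obtain P0 where P0: "P0 \<in> carrier_mat n n" "transpose_mat P0 * A0 * P0 = 1\<^sub>m n"
    using Suc.IH[OF U(3,2)] by auto
  define r where "r = Matrix.mat 1 1 (\<lambda>_::nat\<times>nat. 1 / sqrt s)"
  define D where "D = four_block_mat P0 (0\<^sub>m n 1) (0\<^sub>m 1 n) r"
  have rc: "r \<in> carrier_mat 1 1" by (simp add: r_def)
  have Dc: "D \<in> carrier_mat (Suc n) (Suc n)"
    unfolding D_def using four_block_carrier_mat[OF P0(1) rc] by simp
  have Dt: "transpose_mat D = four_block_mat (transpose_mat P0) (0\<^sub>m n 1) (0\<^sub>m 1 n) (transpose_mat r)"
    unfolding D_def using P0 rc by (subst transpose_four_block_mat[of _ n n _ 1 _ 1]) auto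
  have rs: "transpose_mat r * Matrix.mat 1 1 (\<lambda>_. s) * r = 1\<^sub>m 1"
    using U(4) by (auto simp: r_def scalar_prod_def intro!: eq_matI)
  have "transpose_mat (U * D) * A * (U * D) = transpose_mat D * (transpose_mat U * A * U) * D"
    using U(1) Dc A by (simp add: transpose_mult[of _ "Suc n" "Suc n" _ "Suc n"]
      assoc_mult_mat[of _ "Suc n" "Suc n" _ "Suc n" _ "Suc n"])
  also have "\<dots> = four_block_mat (transpose_mat P0 * A0 * P0) (0\<^sub>m n 1) (0\<^sub>m 1 n)
      (transpose_mat r * Matrix.mat 1 1 (\<lambda>_. s) * r)"
    unfolding U(5) Dt unfolding D_def
    apply (subst mult_four_block_mat[of _ n n _ 1 _ 1])
    using U(2) P0(1) rc apply (auto simp: )[8]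
    apply (subst mult_four_block_mat[of _ n n _ 1 _ 1])
    using U(2) P0(1) rc by auto
  also have "\<dots> = 1\<^sub>m (Suc n)"
    unfolding rs P0(2) by (intro eq_matI) auto
  finally show ?case using U(1) Dc by (intro bexI[of _ "U * D"]) auto
qed

lemma sym_pos_def_det_pos:
  assumes "sym_pos_def A" "A \<in> carrier_mat n n"
  shows "Determinant.det A > 0"
proof -
  obtain P where P: "P \<in> carrier_mat n n" "transpose_mat P * A * P = 1\<^sub>m n"
    using sym_pos_def_congruent_one[OF assms] by auto
  have "(Determinant.det P)\<^sup>2 * Determinant.det A = 1"
    using sym_pos_def_det_congruence[OF assms(2) P(1)] P(2) by simp
  then have "(Determinant.det P)\<^sup>2 * Determinant.det A > 0" by simp
  then show ?thesis by (simp add: zero_less_mult_iff)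
qed

text \<open>
  With \<open>|A| = |A\<^sub>0| s\<close> from the bordering step, \<open>ln s \<le> s - 1\<close> and \<open>s \<le> A\<^sub>n\<^sub>n\<close>, each dimension
  contributes at most its diagonal entry minus one.
\<close>
lemma sym_pos_def_hadamard:
  assumes "sym_pos_def A" "A \<in> carrier_mat n n"
  shows "ln (Determinant.det A) \<le> mtrace A - real n"
  using assms
proof (induction n arbitrary: A)
  case 0
  then have "Determinant.det A = 1" by simp
  then show ?case using 0 by (simp add: mtrace_def)
next
  case (Suc n)
  note A = Suc.prems(2)
  obtain U A0 s where U: "U \<in> carrier_mat (Suc n) (Suc n)" "Determinant.det U = 1" "A0 \<in> carrier_mat n n"
    "sym_pos_def A0" "0 < s" "s \<le> A $$ (n, n)" "\<And>i. i < n \<Longrightarrow> A0 $$ (i, i) = A $$ (i, i)"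
    "transpose_mat U * A * U = four_block_mat A0 (0\<^sub>m n 1) (0\<^sub>m 1 n) (Matrix.mat 1 1 (\<lambda>_. s))"
    using sym_pos_def_border[OF Suc.prems] by metis
  have "Determinant.det A = Determinant.det (transpose_mat U * A * U)"
    using sym_pos_def_det_congruence[OF A U(1)] U(2) by simp
  also have "\<dots> = Determinant.det A0 * Determinant.det (Matrix.mat 1 1 (\<lambda>_. s))"
    unfolding U(8) using U(3) by (intro det_four_block_mat_lower_left_zero[of _ n _ 1]) auto
  also have "Determinant.det (Matrix.mat 1 1 (\<lambda>_. s)) = s" by (simp add: det_single)
  finally have d: "Determinant.det A = Determinant.det A0 * s" .
  have "ln (Determinant.det A) = ln (Determinant.det A0) + ln s"
    unfolding d using sym_pos_def_det_pos[OF U(4,3)] U(5) by (simp add: ln_mult)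
  also have "\<dots> \<le> (mtrace A0 - real n) + (s - 1)"
    using Suc.IH[OF U(4,3)] ln_le_minus_one[OF U(5)] by simp
  also have "\<dots> \<le> mtrace A - real (Suc n)"
    using U(3,6,7) A by (simp add: mtrace_def)
  finally show ?case .
qed

lemma mtrace_mult_comm:
  assumes "A \<in> carrier_mat n n" "B \<in> carrier_mat n n"
  shows "mtrace (A * B) = mtrace (B * A)"
proof -
  have "mtrace (A * B) = (\<Sum>i<n. \<Sum>k<n. A $$ (i, k) * B $$ (k, i))"
    using assms by (auto simp: mtrace_def index_mult_sum[OF assms] simp del: index_mult_mat(1) intro!: sum.cong)
  also have "\<dots> = (\<Sum>k<n. \<Sum>i<n. B $$ (k, i) * A $$ (i, k))"
    by (subst sum.swap) (simp add: mult.commute)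
  also have "\<dots> = mtrace (B * A)"
    using assms by (auto simp: mtrace_def index_mult_sum[OF assms(2,1)] simp del: index_mult_mat(1) intro!: sum.cong)
  finally show ?thesis .
qed

text \<open>
  Gibbs' inequality for centred Gaussians (their relative entropy is non-negative). A
  congruence that turns \<open>A\<close> into the identity reduces it to the preceding bound.
\<close>
lemma ln_det_diff_le_trace:
  assumes A: "sym_pos_def A" "A \<in> carrier_mat n n" and C: "sym_pos_def C" "C \<in> carrier_mat n n"
  shows "ln (Determinant.det C) - ln (Determinant.det A) \<le> mtrace (minv A * C) - real n"
proof -
  obtain P where P: "P \<in> carrier_mat n n" "transpose_mat P * A * P = 1\<^sub>m n"
    using sym_pos_def_congruent_one[OF A] by auto
  let ?C = "transpose_mat P * C * P"
  have d1: "(Determinant.det P)\<^sup>2 * Determinant.det A = 1"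
    using sym_pos_def_det_congruence[OF A(2) P(1)] P(2) by simp
  then have dP: "Determinant.det P \<noteq> 0" by auto
  note inv = minv_inverse[OF A(2) sym_pos_def_det_nz[OF A]]
  have "P * (transpose_mat P * A) = 1\<^sub>m n"
    by (rule mat_mult_left_right_inverse[of _ n]) (use P A in auto)
  then have PPA: "(P * transpose_mat P) * A = 1\<^sub>m n"
    using P A by (simp add: assoc_mult_mat[of _ n n _ n _ n])
  have PPc: "P * transpose_mat P \<in> carrier_mat n n" using P by simp
  have "P * transpose_mat P = (P * transpose_mat P) * (A * minv A)"
    unfolding inv(1) by (rule right_mult_one_mat[OF PPc, symmetric])
  also have "\<dots> = (P * transpose_mat P * A) * minv A"
    by (rule assoc_mult_mat[OF PPc A(2) inv(3), symmetric])
  also have "\<dots> = minv A" unfolding PPA using inv(3) by simp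
  finally have PP: "P * transpose_mat P = minv A" .
  have "mtrace ?C = mtrace (P * (transpose_mat P * C))"
    using P C by (intro mtrace_mult_comm[of _ n]) auto
  also have "P * (transpose_mat P * C) = minv A * C"
    unfolding PP[symmetric] using P C by (simp add: assoc_mult_mat[of _ n n _ n _ n])
  finally have tr: "mtrace ?C = mtrace (minv A * C)" .
  have detA: "ln (Determinant.det A) = - ln ((Determinant.det P)\<^sup>2)"
    using inverse_unique[OF d1] dP by (metis ln_inverse zero_less_power2)
  have "ln (Determinant.det ?C) \<le> mtrace ?C - real n"
    using sym_pos_def_congruence[OF C P(1) dP] P C by (intro sym_pos_def_hadamard) auto
  moreover have "ln (Determinant.det ?C) = ln ((Determinant.det P)\<^sup>2) + ln (Determinant.det C)"
    unfolding sym_pos_def_det_congruence[OF C(2) P(1)]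
    using dP sym_pos_def_det_pos[OF C] by (intro ln_mult_pos) auto
  ultimately show ?thesis using tr detA by simp
qed

section \<open>Comparing log-determinants\<close>

lemma mean_le: "a \<le> c \<Longrightarrow> b \<le> c \<Longrightarrow> (a + b) / 2 \<le> (c::real)"
  by simp

lemma frob_sq_carrier:
  "A \<in> carrier_mat n n \<Longrightarrow> frob_sq A = (\<Sum>i<n. \<Sum>j<n. (A $$ (i, j))\<^sup>2)"
  by (auto simp: frob_sq_def)

lemma sq_sum_le_solution:
  fixes x d :: "nat \<Rightarrow> real"
  assumes c: "0 < c" and le: "c * (\<Sum>i<n. (x i)\<^sup>2) \<le> (\<Sum>i<n. x i * d i)"
  shows "(\<Sum>i<n. (x i)\<^sup>2) \<le> (\<Sum>i<n. (d i)\<^sup>2) / c\<^sup>2"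
proof -
  have "x i * d i \<le> c / 2 * (x i)\<^sup>2 + 1 / (2 * c) * (d i)\<^sup>2" for i
  proof -
    have "0 \<le> (c * x i - d i)\<^sup>2 / (2 * c)" using c by simp
    also have "\<dots> = c / 2 * (x i)\<^sup>2 + 1 / (2 * c) * (d i)\<^sup>2 - x i * d i"
      using c by (simp add: field_simps power2_eq_square)
    finally show ?thesis by simp
  qed
  then have "(\<Sum>i<n. x i * d i) \<le> (\<Sum>i<n. c / 2 * (x i)\<^sup>2 + 1 / (2 * c) * (d i)\<^sup>2)"
    by (intro sum_mono)
  also have "\<dots> = c / 2 * (\<Sum>i<n. (x i)\<^sup>2) + 1 / (2 * c) * (\<Sum>i<n. (d i)\<^sup>2)"
    by (simp add: sum.distrib sum_distrib_left)
  finally have "c / 2 * (\<Sum>i<n. (x i)\<^sup>2) \<le> 1 / (2 * c) * (\<Sum>i<n. (d i)\<^sup>2)"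
    using le by simp
  then show ?thesis using c by (simp add: field_simps power2_eq_square)
qed

text \<open>
  Multiplication by \<open>A\<close> stretches each column of \<open>X\<close> at least by the factor \<open>c\<close>.
\<close>
lemma frob_sq_solution_le:
  assumes A: "A \<in> carrier_mat n n" and X: "X \<in> carrier_mat n n" and c: "0 < c"
    and lower: "\<And>u. c * (\<Sum>i<n. (u i)\<^sup>2) \<le> quad A u"
  shows "frob_sq X \<le> frob_sq (A * X) / c\<^sup>2"
proof -
  have AX: "A * X \<in> carrier_mat n n" using A X by simp
  have "(\<Sum>i<n. (X $$ (i, j))\<^sup>2) \<le> (\<Sum>i<n. ((A * X) $$ (i, j))\<^sup>2) / c\<^sup>2" if j: "j < n" for j
  proof (rule sq_sum_le_solution[OF c])
    have "quad A (\<lambda>i. X $$ (i, j)) = (\<Sum>i<n. X $$ (i, j) * (A * X) $$ (i, j))"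
      unfolding quad_carrier[OF A]
      by (auto simp: index_mult_sum[OF A X _ j] sum_distrib_left mult.assoc
          simp del: index_mult_mat intro!: sum.cong)
    then show "c * (\<Sum>i<n. (X $$ (i, j))\<^sup>2) \<le> (\<Sum>i<n. X $$ (i, j) * (A * X) $$ (i, j))"
      using lower[of "\<lambda>i. X $$ (i, j)"] by simp
  qed
  then have "(\<Sum>j<n. \<Sum>i<n. (X $$ (i, j))\<^sup>2) \<le> (\<Sum>j<n. (\<Sum>i<n. ((A * X) $$ (i, j))\<^sup>2) / c\<^sup>2)"
    by (intro sum_mono) auto
  then have "(\<Sum>j<n. \<Sum>i<n. (X $$ (i, j))\<^sup>2) \<le> (\<Sum>j<n. \<Sum>i<n. ((A * X) $$ (i, j))\<^sup>2) / c\<^sup>2"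
    by (simp only: sum_divide_distrib)
  then show ?thesis unfolding frob_sq_carrier[OF X] frob_sq_carrier[OF AX]
    by (subst (1 2) sum.swap)
qed

lemma mtrace_minus: "A \<in> carrier_mat n n \<Longrightarrow> B \<in> carrier_mat n n \<Longrightarrow> mtrace (A - B) = mtrace A - mtrace B"
  by (auto simp: mtrace_def sum_subtractf)

lemma mtrace_mult_sum:
  assumes "A \<in> carrier_mat n n" "B \<in> carrier_mat n n"
  shows "mtrace (A * B) = (\<Sum>i<n. \<Sum>k<n. A $$ (i, k) * B $$ (k, i))"
  using assms by (auto simp: mtrace_def index_mult_sum[OF assms] simp del: index_mult_mat(1) intro!: sum.cong)

lemma mtrace_mult_le:
  assumes A: "A \<in> carrier_mat n n" and B: "B \<in> carrier_mat n n"
  shows "mtrace (A * B) \<le> (frob_sq A + frob_sq B) / 2"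
proof -
  have "mtrace (A * B) \<le> (\<Sum>i<n. \<Sum>k<n. ((A $$ (i, k))\<^sup>2 + (B $$ (k, i))\<^sup>2) / 2)"
    unfolding mtrace_mult_sum[OF A B]
  proof (intro sum_mono)
    fix i k
    show "A $$ (i, k) * B $$ (k, i) \<le> ((A $$ (i, k))\<^sup>2 + (B $$ (k, i))\<^sup>2) / 2"
      using sum_squares_bound[of "A $$ (i, k)" "B $$ (k, i)"] by simp
  qed
  also have "\<dots> = ((\<Sum>i<n. \<Sum>k<n. (A $$ (i, k))\<^sup>2) + (\<Sum>i<n. \<Sum>k<n. (B $$ (k, i))\<^sup>2)) / 2"
    by (simp only: sum_divide_distrib[symmetric] sum.distrib)
  also have "(\<Sum>i<n. \<Sum>k<n. (B $$ (k, i))\<^sup>2) = (\<Sum>k<n. \<Sum>i<n. (B $$ (k, i))\<^sup>2)"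
    by (rule sum.swap)
  also have "((\<Sum>i<n. \<Sum>k<n. (A $$ (i, k))\<^sup>2) + (\<Sum>k<n. \<Sum>i<n. (B $$ (k, i))\<^sup>2)) / 2 = (frob_sq A + frob_sq B) / 2"
    unfolding frob_sq_carrier[OF A] frob_sq_carrier[OF B] ..
  finally show ?thesis .
qed

text \<open>
  Gibbs' inequality bounds the difference by \<open>-Tr(A\<^sup>-\<^sup>1 D)\<close> with \<open>D = A - A'\<close>. The trace
  condition says \<open>Tr(A'\<^sup>-\<^sup>1 D) = 0\<close>, so the first-order term disappears through the resolvent
  identity \<open>A\<^sup>-\<^sup>1 D = A'\<^sup>-\<^sup>1 D - A\<^sup>-\<^sup>1 D A'\<^sup>-\<^sup>1 D\<close>, and what remains is quadratic in \<open>D\<close>. The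
  condition holds when \<open>A'\<close> is a block restriction of \<open>A\<close>; the bound is then the price of
  cutting blocks.
\<close>
lemma ln_det_diff_le_frob:
  assumes A: "sym_pos_def A" "A \<in> carrier_mat n n" and A': "sym_pos_def A'" "A' \<in> carrier_mat n n"
    and c: "0 < c"
    and lower: "\<And>u. c * (\<Sum>i<n. (u i)\<^sup>2) \<le> quad A u" "\<And>u. c * (\<Sum>i<n. (u i)\<^sup>2) \<le> quad A' u"
    and tr: "mtrace (minv A' * A) = real n"
  shows "ln (Determinant.det A') - ln (Determinant.det A) \<le> frob_sq (A - A') / c\<^sup>2"
proof -
  define D where "D = A - A'"
  have Dc: "D \<in> carrier_mat n n" unfolding D_def by (rule minus_carrier_mat[OF A'(2)])
  define R where "R = minv A"
  define R' where "R' = minv A'"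
  note inv = minv_inverse[OF A(2) sym_pos_def_det_nz[OF A], folded R_def]
  note inv' = minv_inverse[OF A'(2) sym_pos_def_det_nz[OF A'], folded R'_def]
  have t1: "mtrace (1\<^sub>m n) = real n" by (simp add: mtrace_def)
  have RD: "R * D \<in> carrier_mat n n" and RD': "R' * D \<in> carrier_mat n n" using inv inv' Dc by auto
  have e1: "R * A' = 1\<^sub>m n - R * D"
  proof -
    have "R * D = R * A - R * A'" unfolding D_def using inv A A' by (simp add: mult_minus_distrib_mat[of _ n n _ n])
    then show ?thesis unfolding inv(2) using inv A A' by (auto intro!: eq_matI)
  qed
  have e2: "R' * D = R' * A - 1\<^sub>m n"
    unfolding D_def using inv' A A' by (simp add: mult_minus_distrib_mat[of _ n n _ n])
  \<comment> \<open>the resolvent identity\<close>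
  have e3: "R * D = R' * D - R * D * (R' * D)"
  proof -
    have "R * D * (R' * D) = R * (D * R') * D"
      using inv inv' Dc by (simp add: assoc_mult_mat[of _ n n _ n _ n])
    also have "D * R' = A * R' - 1\<^sub>m n"
      unfolding D_def using inv' A A' by (simp add: minus_mult_distrib_mat[of _ n n _ _ n])
    also have "R * (A * R' - 1\<^sub>m n) = R' - R"
    proof -
      have "R * (A * R' - 1\<^sub>m n) = R * (A * R') - R * 1\<^sub>m n"
        using inv inv' A by (intro mult_minus_distrib_mat[of _ n n _ n]) auto
      also have "R * (A * R') = (R * A) * R'"
        by (rule assoc_mult_mat[symmetric]) (use inv inv' A in auto)
      finally show ?thesis unfolding inv(2) using inv inv' by simp
    qed
    also have "(R' - R) * D = R' * D - R * D"
      using inv inv' Dc by (intro minus_mult_distrib_mat) auto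
    finally show ?thesis using RD RD' by (auto intro!: eq_matI)
  qed
  have "mtrace (R' * D) = 0"
    unfolding e2 using tr inv' A t1 by (subst mtrace_minus[of _ n]) (auto simp: R'_def)
  then have tRD: "mtrace (R * D) = - mtrace (R * D * (R' * D))"
    using arg_cong[OF e3, of mtrace] RD RD' by (simp add: mtrace_minus[of _ n])
  have "ln (Determinant.det A') - ln (Determinant.det A) \<le> mtrace (R * A') - real n"
    unfolding R_def by (rule ln_det_diff_le_trace[OF A A'])
  also have "\<dots> = mtrace (R * D * (R' * D))"
    unfolding e1 using RD tRD t1 by (simp add: mtrace_minus[of _ n])
  also have "\<dots> \<le> (frob_sq (R * D) + frob_sq (R' * D)) / 2"
    by (rule mtrace_mult_le[OF RD RD'])
  also have "\<dots> \<le> frob_sq D / c\<^sup>2"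
  proof -
    have "A * (R * D) = D"
      using inv A Dc by (simp flip: assoc_mult_mat[OF A(2) inv(3) Dc])
    moreover have "A' * (R' * D) = D"
      using inv' A' Dc by (simp flip: assoc_mult_mat[OF A'(2) inv'(3) Dc])
    ultimately have "frob_sq (R * D) \<le> frob_sq D / c\<^sup>2" "frob_sq (R' * D) \<le> frob_sq D / c\<^sup>2"
      using frob_sq_solution_le[OF A(2) RD c lower(1)] frob_sq_solution_le[OF A'(2) RD' c lower(2)] by simp_all
    then show ?thesis by (rule mean_le)
  qed
  finally show ?thesis unfolding D_def .
qed

text \<open>
  Here \<open>x = A\<^sup>-\<^sup>1 d\<close>, so the claim is \<open>d\<^sup>T A\<^sup>-\<^sup>1 d \<ge> |d|\<^sup>2 / K\<close>. It follows from evaluating the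
  form of \<open>A\<close> at \<open>x - d/K\<close>.
\<close>
lemma quad_inverse_ge:
  assumes A: "A \<in> carrier_mat n n" and sym: "\<And>i j. i < n \<Longrightarrow> j < n \<Longrightarrow> A $$ (i, j) = A $$ (j, i)"
    and K: "0 < K"
    and nonneg: "\<And>u. 0 \<le> quad A u"
    and upper: "\<And>u. quad A u \<le> K * (\<Sum>i<n. (u i)\<^sup>2)"
    and eq: "\<And>i. i < n \<Longrightarrow> (\<Sum>j<n. A $$ (i, j) * x j) = d i"
  shows "(\<Sum>i<n. (d i)\<^sup>2) / K \<le> (\<Sum>i<n. d i * x i)"
proof -
  have e1: "(\<Sum>i<n. \<Sum>j<n. f i * A $$ (i, j) * x j) = (\<Sum>i<n. f i * d i)" for f
    by (auto simp flip: eq simp: sum_distrib_left mult.assoc intro!: sum.cong)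
  have e2: "(\<Sum>i<n. \<Sum>j<n. x i * A $$ (i, j) * f j) = (\<Sum>i<n. f i * d i)" for f
  proof -
    have "(\<Sum>i<n. \<Sum>j<n. x i * A $$ (i, j) * f j) = (\<Sum>j<n. \<Sum>i<n. f j * A $$ (j, i) * x i)"
      by (subst sum.swap) (auto simp: sym intro!: sum.cong)
    then show ?thesis using e1 by simp
  qed
  have "0 \<le> quad A (\<lambda>i. x i - d i / K)" by (rule nonneg)
  also have "\<dots> = (\<Sum>i<n. \<Sum>j<n. x i * A $$ (i, j) * x j) - (\<Sum>i<n. \<Sum>j<n. (d i / K) * A $$ (i, j) * x j)
     - (\<Sum>i<n. \<Sum>j<n. x i * A $$ (i, j) * (d j / K)) + quad A (\<lambda>i. d i / K)"
  proof -
    have "quad A (\<lambda>i. x i - d i / K) = (\<Sum>i<n. \<Sum>j<n. x i * A $$ (i, j) * x j - (d i / K) * A $$ (i, j) * x j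
        - x i * A $$ (i, j) * (d j / K) + (d i / K) * A $$ (i, j) * (d j / K))"
      unfolding quad_carrier[OF A] by (intro sum.cong refl) (simp add: algebra_simps diff_divide_distrib)
    then show ?thesis unfolding quad_carrier[OF A] by (simp only: sum.distrib sum_subtractf)
  qed
  also have "\<dots> = (\<Sum>i<n. d i * x i) - 2 * ((\<Sum>i<n. (d i)\<^sup>2) / K) + quad A (\<lambda>i. d i / K)"
    unfolding e1 e2 by (simp add: sum_divide_distrib power2_eq_square mult.commute)
  also have "quad A (\<lambda>i. d i / K) \<le> K * (\<Sum>i<n. (d i / K)\<^sup>2)" by (rule upper)
  also have "K * (\<Sum>i<n. (d i / K)\<^sup>2) = (\<Sum>i<n. (d i)\<^sup>2) / K"
    using K by (simp add: power_divide power2_eq_square sum_distrib_left sum_divide_distrib)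
  finally show ?thesis by simp
qed

lemma det_one_minus_column:
  fixes v :: "nat \<Rightarrow> real"
  assumes i: "i < n" and v: "v i = 0"
  shows "Determinant.det (Matrix.mat n n (\<lambda>(k, l). (if k = l then 1 else 0) - v k * (if l = i then 1 else 0))) = 1"
    (is "Determinant.det ?L = 1")
proof -
  have L: "?L \<in> carrier_mat n n" by simp
  have row: "?L $$ (i, j) = (if j = i then 1 else 0)" if "j < n" for j using that i v by auto
  have "Determinant.det ?L = (\<Sum>j<n. ?L $$ (i, j) * cofactor ?L i j)"
    by (rule laplace_expansion_row[OF L i])
  also have "\<dots> = (\<Sum>j<n. if j = i then cofactor ?L i j else 0)"
    by (intro sum.cong refl) (use row in auto)
  also have "\<dots> = cofactor ?L i i" using i by (simp add: sum.delta)
  also have "mat_delete ?L i i = 1\<^sub>m (n - 1)"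
    using i by (intro eq_matI) (auto simp: mat_delete_def)
  then have "cofactor ?L i i = 1" by (simp add: cofactor_def)
  finally show ?thesis .
qed

lemma minv_sym:
  assumes A: "A \<in> carrier_mat n n" and d: "Determinant.det A \<noteq> 0" and AT: "transpose_mat A = A"
    and kl: "k < n" "l < n"
  shows "minv A $$ (k, l) = minv A $$ (l, k)"
proof -
  note inv = minv_inverse[OF A d]
  have "transpose_mat (minv A) * A = 1\<^sub>m n"
    using transpose_mult[OF A inv(3)] unfolding inv(1) AT by simp
  then have "transpose_mat (minv A) * (A * minv A) = minv A"
    using A inv by (subst assoc_mult_mat[symmetric, of _ n n _ n _ n]) auto
  then have "transpose_mat (minv A) = minv A" unfolding inv(1) using inv by simp
  then show ?thesis using kl inv(3) by (metis carrier_matD index_transpose_mat(1))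
qed

text \<open>
  The gain from uniting blocks. Think of \<open>A\<close> as the block restriction of the covariance
  matrix \<open>C\<close>, of \<open>i\<close> as a variable in one block and of \<open>d\<close> as the covariances of \<open>i\<close> with
  the variables of another block. Regressing the latter on variable \<open>i\<close> is a shear \<open>L\<close> of
  determinant one, so \<open>C\<close> and \<open>L C L\<^sup>T\<close> have the same determinant. Comparing \<open>A\<close> with
  \<open>L C L\<^sup>T\<close> instead of \<open>C\<close> in Gibbs' inequality lowers the trace by
  \<open>d\<^sup>T A\<^sup>-\<^sup>1 d / C\<^sub>i\<^sub>i \<ge> |d|\<^sup>2 / K\<^sup>2\<close>.

  The condition on \<open>d\<^sup>T A\<^sup>-\<^sup>1\<close> says that it sees only the part \<open>d\<close> of the column \<open>C\<^sub>\<cdot>\<^sub>i\<close>, which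
  holds as \<open>A\<^sup>-\<^sup>1\<close> has the blocks of \<open>A\<close>.
\<close>
lemma ln_det_le_regression:
  fixes d :: "nat \<Rightarrow> real"
  assumes A: "sym_pos_def A" "A \<in> carrier_mat n n" and C: "sym_pos_def C" "C \<in> carrier_mat n n"
    and tr: "mtrace (minv A * C) = real n"
    and i: "i < n" and di: "d i = 0"
    and K: "0 < K" and upper: "\<And>u. quad A u \<le> K * (\<Sum>k<n. (u k)\<^sup>2)" and Cii: "C $$ (i, i) \<le> K"
    and cross: "(\<Sum>k<n. \<Sum>l<n. d k * minv A $$ (k, l) * C $$ (l, i))
       = (\<Sum>k<n. \<Sum>l<n. d k * minv A $$ (k, l) * d l)"
  shows "ln (Determinant.det C) + (\<Sum>k<n. (d k)\<^sup>2) / K\<^sup>2 \<le> ln (Determinant.det A)"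
proof -
  define R where "R = minv A"
  note inv = minv_inverse[OF A(2) sym_pos_def_det_nz[OF A], folded R_def]
  have symA: "A $$ (k, l) = A $$ (l, k)" if "k < n" "l < n" for k l
    using sym_pos_def_symD[OF A that] .
  have symC: "C $$ (k, l) = C $$ (l, k)" if "k < n" "l < n" for k l
    using sym_pos_def_symD[OF C that] .
  have symR: "R $$ (k, l) = R $$ (l, k)" if "k < n" "l < n" for k l
    using minv_sym[OF A(2) sym_pos_def_det_nz[OF A] _ that] A unfolding sym_pos_def_def R_def by simp
  define q where "q = C $$ (i, i)"
  have q: "0 < q"
    using sym_pos_def_quad_pos[OF C i, of "\<lambda>k. if k = i then 1 else 0"] quad_unit[OF C(2) i] by (simp add: q_def)
  \<comment> \<open>the regression coefficients on variable \<open>i\<close>\<close>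
  define v where "v = (\<lambda>k. d k / q)"
  define L where "L = Matrix.mat n n (\<lambda>(k, l). (if k = l then 1 else 0) - v k * (if l = i then 1 else 0))"
  have Lc: "L \<in> carrier_mat n n" by (simp add: L_def)
  have detL: "Determinant.det L = 1" unfolding L_def by (rule det_one_minus_column[OF i]) (simp add: v_def di)
  have ind: "(\<Sum>l<n. (if l = i then 1 else 0) * f l) = f i" for f :: "nat \<Rightarrow> real"
    using i by (simp add: if_distrib[of "\<lambda>x. x * _"] sum.delta cong: if_cong)
  have ind': "(\<Sum>l<n. (if k = l then 1 else 0) * f l) = f k" if "k < n" for k and f :: "nat \<Rightarrow> real"
    using that by (simp add: if_distrib[of "\<lambda>x. x * _"] sum.delta cong: if_cong)
  have LC: "(L * C) $$ (k, l) = C $$ (k, l) - v k * C $$ (i, l)" if "k < n" "l < n" for k l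
  proof -
    have "(L * C) $$ (k, l) = (\<Sum>j<n. (if k = j then 1 else 0) * C $$ (j, l)) - (\<Sum>j<n. (if j = i then 1 else 0) * (v k * C $$ (j, l)))"
      unfolding index_mult_sum[OF Lc C(2) that] sum_subtractf[symmetric] using that
      by (auto simp: L_def algebra_simps intro!: sum.cong)
    then show ?thesis using ind ind' that by simp
  qed
  define C' where "C' = L * C * transpose_mat L"
  have LCc: "L * C \<in> carrier_mat n n" using Lc C by simp
  have C'c: "C' \<in> carrier_mat n n" using Lc C by (simp add: C'_def)
  have C': "C' $$ (k, l) = C $$ (k, l) - v k * C $$ (i, l) - v l * C $$ (k, i) + v k * v l * q"
    if "k < n" "l < n" for k l
  proof -
    have "C' $$ (k, l) = (\<Sum>j<n. (L * C) $$ (k, j) * L $$ (l, j))"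
      unfolding C'_def using Lc that by (subst index_mult_sum[OF LCc _ that]) auto
    also have "\<dots> = (\<Sum>j<n. (if l = j then 1 else 0) * (L * C) $$ (k, j)) - (\<Sum>j<n. (if j = i then 1 else 0) * (v l * (L * C) $$ (k, j)))"
      unfolding sum_subtractf[symmetric] using that
      by (auto simp: L_def algebra_simps simp del: index_mult_mat intro!: sum.cong)
    also have "\<dots> = (L * C) $$ (k, l) - v l * (L * C) $$ (k, i)"
      using ind ind' that by simp
    finally show ?thesis using LC that i by (simp add: q_def algebra_simps)
  qed
  have spd': "sym_pos_def C'"
    using sym_pos_def_congruence[OF C, of "transpose_mat L"] Lc detL by (simp add: C'_def det_transpose[OF Lc])
  have detC': "Determinant.det C' = Determinant.det C"
    using sym_pos_def_det_congruence[OF C(2), of "transpose_mat L"] Lc detL by (simp add: C'_def det_transpose[OF Lc])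
  define x where "x = (\<lambda>k. \<Sum>l<n. R $$ (k, l) * d l)"
  define G where "G = (\<Sum>k<n. d k * x k)"
  have G1: "(\<Sum>k<n. \<Sum>l<n. d k * R $$ (k, l) * d l) = G"
    by (simp add: G_def x_def sum_distrib_left mult.assoc)
  have G2: "(\<Sum>k<n. \<Sum>l<n. d k * R $$ (k, l) * C $$ (l, i)) = G"
    using cross G1 by (simp add: R_def)
  have G3: "(\<Sum>k<n. \<Sum>l<n. R $$ (k, l) * (d l * C $$ (i, k))) = G"
  proof -
    have "(\<Sum>k<n. \<Sum>l<n. R $$ (k, l) * (d l * C $$ (i, k))) = (\<Sum>l<n. \<Sum>k<n. R $$ (k, l) * (d l * C $$ (i, k)))"
      by (rule sum.swap)
    also have "\<dots> = (\<Sum>k<n. \<Sum>l<n. d k * R $$ (k, l) * C $$ (l, i))"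
      by (intro sum.cong refl) (use symR symC i in auto)
    finally show ?thesis using G2 by simp
  qed
  have "mtrace (R * C') = (\<Sum>k<n. \<Sum>l<n. R $$ (k, l) * C' $$ (l, k))"
    by (rule mtrace_mult_sum[OF inv(3) C'c])
  also have "\<dots> = (\<Sum>k<n. \<Sum>l<n. R $$ (k, l) * C $$ (l, k) - R $$ (k, l) * (d l * C $$ (i, k)) / q
      - d k * R $$ (k, l) * C $$ (l, i) / q + d k * R $$ (k, l) * d l / q)"
    by (intro sum.cong refl) (use q in \<open>auto simp: C' v_def field_simps\<close>)
  also have "\<dots> = (\<Sum>k<n. \<Sum>l<n. R $$ (k, l) * C $$ (l, k)) - (\<Sum>k<n. \<Sum>l<n. R $$ (k, l) * (d l * C $$ (i, k))) / q
      - (\<Sum>k<n. \<Sum>l<n. d k * R $$ (k, l) * C $$ (l, i)) / q + (\<Sum>k<n. \<Sum>l<n. d k * R $$ (k, l) * d l) / q"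
    by (simp only: sum.distrib sum_subtractf sum_divide_distrib)
  also have "\<dots> = real n - G / q"
    unfolding G1 G2 G3 mtrace_mult_sum[OF inv(3) C(2), symmetric] using tr by (simp add: R_def)
  finally have tr': "mtrace (R * C') = real n - G / q" .
  have "ln (Determinant.det C) - ln (Determinant.det A) \<le> mtrace (R * C') - real n"
    using ln_det_diff_le_trace[OF A spd' C'c] by (simp add: detC' R_def)
  also have "\<dots> = - (G / q)" using tr' by simp
  finally have main: "ln (Determinant.det C) + G / q \<le> ln (Determinant.det A)" by simp
  have nonneg: "0 \<le> quad A u" for u
  proof (cases "\<exists>i<n. u i \<noteq> 0")
    case True
    then show ?thesis using A by (auto simp: sym_pos_def_iff_quad intro: less_imp_le)
  next
    case False
    then show ?thesis by (simp add: quad_carrier[OF A(2)])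
  qed
  have Ax: "(\<Sum>j<n. A $$ (k, j) * x j) = d k" if k: "k < n" for k
  proof -
    have "(\<Sum>j<n. A $$ (k, j) * x j) = (\<Sum>j<n. \<Sum>l<n. A $$ (k, j) * R $$ (j, l) * d l)"
      by (simp add: x_def sum_distrib_left mult.assoc)
    also have "\<dots> = (\<Sum>l<n. (A * R) $$ (k, l) * d l)"
      by (subst sum.swap) (auto simp: index_mult_sum[OF A(2) inv(3) k] sum_distrib_right
        simp del: index_mult_mat intro!: sum.cong)
    also have "\<dots> = (\<Sum>l<n. (if k = l then 1 else 0) * d l)"
      unfolding inv(1) using k by (intro sum.cong) auto
    finally show ?thesis using ind'[OF k] by simp
  qed
  have Gge: "(\<Sum>k<n. (d k)\<^sup>2) / K \<le> G"
    unfolding G_def by (rule quad_inverse_ge[OF A(2) symA K nonneg upper Ax])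
  have s0: "0 \<le> (\<Sum>k<n. (d k)\<^sup>2)" by (intro sum_nonneg) simp
  have "(\<Sum>k<n. (d k)\<^sup>2) / K\<^sup>2 = ((\<Sum>k<n. (d k)\<^sup>2) / K) / K" by (simp add: power2_eq_square)
  also have "\<dots> \<le> ((\<Sum>k<n. (d k)\<^sup>2) / K) / q"
    using Cii q K s0 by (intro divide_left_mono) (auto simp: q_def)
  also have "\<dots> \<le> G / q" using Gge q by (intro divide_right_mono) auto
  finally show ?thesis using main by simp
qed

section \<open>Eigenvalues and quadratic forms\<close>

text \<open>
  The eigenvalue is the largest \<open>s\<close> for which \<open>A - s I\<close> is positive semidefinite. If
  \<open>P = A - s I\<close> were invertible, its quadratic form would be bounded below by \<open>1/b\<close> with \<open>b\<close>
  a bound for \<open>P\<^sup>-\<^sup>1\<close>, and \<open>s\<close> could be increased.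
\<close>
lemma ex_eigenvalue_lower:
  assumes A: "A \<in> carrier_mat n n" and n: "0 < n"
    and sym: "\<And>i j. i < n \<Longrightarrow> j < n \<Longrightarrow> A $$ (i, j) = A $$ (j, i)"
  shows "\<exists>k. eigenvalue A k \<and> (\<forall>u. k * (\<Sum>i<n. (u i)\<^sup>2) \<le> quad A u)"
proof -
  define T where "T = {s. \<forall>u. s * (\<Sum>i<n. (u i)\<^sup>2) \<le> quad A u}"
  have TD: "s * (\<Sum>i<n. (u i)\<^sup>2) \<le> quad A u" if "s \<in> T" for s u
    using that unfolding T_def by blast
  have bilin: "\<bar>quad B u\<bar> \<le> (\<Sum>i<n. \<Sum>j<n. \<bar>B $$ (i, j)\<bar>) * (\<Sum>i<n. (u i)\<^sup>2)" if B: "B \<in> carrier_mat n n" for B u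
  proof -
    have "\<bar>quad B u\<bar> \<le> (\<Sum>i<n. \<Sum>j<n. \<bar>u i * B $$ (i, j) * u j\<bar>)"
      unfolding quad_carrier[OF B] by (rule order_trans[OF sum_abs], rule sum_mono, rule sum_abs)
    also have "\<dots> \<le> (\<Sum>i<n. \<Sum>j<n. \<bar>B $$ (i, j)\<bar> * (\<Sum>i<n. (u i)\<^sup>2))"
    proof (intro sum_mono)
      fix i j assume ij: "i \<in> {..<n}" "j \<in> {..<n}"
      have le: "(u k)\<^sup>2 \<le> (\<Sum>i<n. (u i)\<^sup>2)" if "k \<in> {..<n}" for k
        using that by (intro member_le_sum) auto
      then have "((u i)\<^sup>2 + (u j)\<^sup>2) / 2 \<le> (\<Sum>i<n. (u i)\<^sup>2)" using mean_le[OF le[OF ij(1)] le[OF ij(2)]] by simp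
      moreover have "\<bar>u i * u j\<bar> \<le> ((u i)\<^sup>2 + (u j)\<^sup>2) / 2"
        using sum_squares_bound[of "\<bar>u i\<bar>" "\<bar>u j\<bar>"] by (simp add: abs_mult)
      ultimately have "\<bar>u i * u j\<bar> \<le> (\<Sum>i<n. (u i)\<^sup>2)" by simp
      then have "\<bar>B $$ (i, j)\<bar> * \<bar>u i * u j\<bar> \<le> \<bar>B $$ (i, j)\<bar> * (\<Sum>i<n. (u i)\<^sup>2)"
        by (rule mult_left_mono) simp
      then show "\<bar>u i * B $$ (i, j) * u j\<bar> \<le> \<bar>B $$ (i, j)\<bar> * (\<Sum>i<n. (u i)\<^sup>2)"
        by (simp add: abs_mult mult_ac)
    qed
    finally show ?thesis by (simp add: sum_distrib_right)
  qed
  have "- (\<Sum>i<n. \<Sum>j<n. \<bar>A $$ (i, j)\<bar>) \<in> T"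
    unfolding T_def using bilin[OF A] by (auto simp: abs_le_iff) (metis minus_le_iff)
  then have ne: "T \<noteq> {}" by blast
  have s0: "(\<Sum>k<n. (if k = (0::nat) then 1 else 0 :: real)\<^sup>2) = 1"
    using n by (subst sum.remove[of _ 0]) auto
  have bd: "bdd_above T"
  proof (rule bdd_aboveI[of _ "A $$ (0, 0)"])
    fix s assume "s \<in> T"
    then have "s * (\<Sum>k<n. (if k = (0::nat) then 1 else 0)\<^sup>2) \<le> quad A (\<lambda>k. if k = 0 then 1 else 0)"
      by (rule TD)
    then show "s \<le> A $$ (0, 0)" unfolding s0 quad_unit[OF A n] by simp
  qed
  define s where "s = Sup T"
  have sT: "s * (\<Sum>i<n. (u i)\<^sup>2) \<le> quad A u" for u
  proof (cases "(\<Sum>i<n. (u i)\<^sup>2) = 0")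
    case True
    obtain s' where "s' \<in> T" using ne by blast
    from TD[OF this, of u] show ?thesis using True by simp
  next
    case False
    then have pos: "0 < (\<Sum>i<n. (u i)\<^sup>2)" by (simp add: sum_nonneg order_less_le)
    have "s \<le> quad A u / (\<Sum>i<n. (u i)\<^sup>2)"
      unfolding s_def using ne pos by (intro cSup_least) (auto simp: T_def pos_le_divide_eq)
    then show ?thesis using pos by (simp add: pos_le_divide_eq)
  qed
  have "eigenvalue A s"
  proof (rule ccontr)
    assume "\<not> eigenvalue A s"
    then have dP: "Determinant.det (char_matrix A s) \<noteq> 0" using eigenvalue_det[OF A] by simp
    define P where "P = char_matrix A s"
    have P: "P \<in> carrier_mat n n" using A by (simp add: P_def)
    note inv = minv_inverse[OF P dP[folded P_def]]
    have Pij: "P $$ (i, j) = A $$ (i, j) - s * (if i = j then 1 else 0)" if "i < n" "j < n" for i j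
      using that A by (simp add: P_def char_matrix_def)
    have quadP: "quad P u = quad A u - s * (\<Sum>i<n. (u i)\<^sup>2)" for u
    proof -
      have "quad P u = (\<Sum>i<n. \<Sum>j<n. u i * A $$ (i, j) * u j - (if i = j then s * (u i * u j) else 0))"
        unfolding quad_carrier[OF P] by (intro sum.cong) (auto simp: Pij algebra_simps)
      then show ?thesis unfolding quad_carrier[OF A]
        by (simp add: sum_subtractf sum.delta sum_distrib_left power2_eq_square)
    qed
    define b where "b = (\<Sum>i<n. \<Sum>j<n. \<bar>minv P $$ (i, j)\<bar>) + 1"
    have b: "0 < b" unfolding b_def by (intro add_nonneg_pos sum_nonneg) auto
    have "s + 1 / b \<in> T"
      unfolding T_def
    proof (intro CollectI allI)
      fix u :: "nat \<Rightarrow> real"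
      define x where "x = (\<lambda>k. \<Sum>l<n. minv P $$ (k, l) * u l)"
      have Px: "(\<Sum>j<n. P $$ (k, j) * x j) = u k" if k: "k < n" for k
      proof -
        have "(\<Sum>j<n. P $$ (k, j) * x j) = (\<Sum>j<n. \<Sum>l<n. P $$ (k, j) * minv P $$ (j, l) * u l)"
          by (simp add: x_def sum_distrib_left mult.assoc)
        also have "\<dots> = (\<Sum>l<n. (P * minv P) $$ (k, l) * u l)"
          by (subst sum.swap) (auto simp: index_mult_sum[OF P inv(3) k] sum_distrib_right
            simp del: index_mult_mat intro!: sum.cong)
        also have "\<dots> = (\<Sum>l<n. (if l = k then u l else 0))"
          unfolding inv(1) using k by (intro sum.cong) auto
        finally show ?thesis using k by (simp add: sum.delta)
      qed
      have symP: "P $$ (k, l) = P $$ (l, k)" if "k < n" "l < n" for k l using Pij sym that by simp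
      have e1: "(\<Sum>i<n. \<Sum>j<n. f i * P $$ (i, j) * x j) = (\<Sum>i<n. f i * u i)" for f
        by (auto simp flip: Px simp: sum_distrib_left mult.assoc intro!: sum.cong)
      have e2: "(\<Sum>i<n. \<Sum>j<n. x i * P $$ (i, j) * f j) = (\<Sum>i<n. f i * u i)" for f
      proof -
        have "(\<Sum>i<n. \<Sum>j<n. x i * P $$ (i, j) * f j) = (\<Sum>j<n. \<Sum>i<n. f j * P $$ (j, i) * x i)"
          by (subst sum.swap) (auto simp: symP intro!: sum.cong)
        then show ?thesis using e1 by simp
      qed
      \<comment> \<open>with \<open>x = P\<^sup>-\<^sup>1 u\<close>, this expands to \<open>u\<^sup>T P\<^sup>-\<^sup>1 u - 2 b |u|\<^sup>2 + b\<^sup>2 u\<^sup>T P u\<close>\<close>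
      have "0 \<le> quad P (\<lambda>i. x i - b * u i)" using sT unfolding quadP by (simp add: algebra_simps)
      also have "\<dots> = (\<Sum>i<n. \<Sum>j<n. x i * P $$ (i, j) * x j) - (\<Sum>i<n. \<Sum>j<n. (b * u i) * P $$ (i, j) * x j)
         - (\<Sum>i<n. \<Sum>j<n. x i * P $$ (i, j) * (b * u j)) + b\<^sup>2 * quad P u"
      proof -
        have "quad P (\<lambda>i. x i - b * u i) = (\<Sum>i<n. \<Sum>j<n. x i * P $$ (i, j) * x j - (b * u i) * P $$ (i, j) * x j
            - x i * P $$ (i, j) * (b * u j) + b\<^sup>2 * (u i * P $$ (i, j) * u j))"
          unfolding quad_carrier[OF P] by (intro sum.cong refl) (simp add: algebra_simps power2_eq_square)
        then show ?thesis unfolding quad_carrier[OF P] by (simp only: sum.distrib sum_subtractf sum_distrib_left)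
      qed
      also have "\<dots> = (\<Sum>i<n. x i * u i) - 2 * b * (\<Sum>i<n. (u i)\<^sup>2) + b\<^sup>2 * quad P u"
        unfolding e1 e2 by (simp add: sum_distrib_left power2_eq_square mult_ac sum_negf)
      also have "(\<Sum>i<n. x i * u i) = quad (minv P) u"
        unfolding quad_carrier[OF inv(3)] x_def by (simp add: sum_distrib_left sum_distrib_right mult_ac)
      also have "quad (minv P) u \<le> b * (\<Sum>i<n. (u i)\<^sup>2)"
      proof -
        have "quad (minv P) u \<le> (b - 1) * (\<Sum>i<n. (u i)\<^sup>2)"
          using bilin[OF inv(3), of u] by (simp add: b_def)
        also have "\<dots> \<le> b * (\<Sum>i<n. (u i)\<^sup>2)"
          by (intro mult_right_mono sum_nonneg) auto
        finally show ?thesis .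
      qed
      finally have "b * (\<Sum>i<n. (u i)\<^sup>2) \<le> b * (b * quad P u)" by (simp add: power2_eq_square algebra_simps)
      then have "(\<Sum>i<n. (u i)\<^sup>2) \<le> b * quad P u" using b by simp
      then have "(\<Sum>i<n. (u i)\<^sup>2) / b \<le> quad P u" using b by (simp add: field_simps)
      then show "(s + 1 / b) * (\<Sum>i<n. (u i)\<^sup>2) \<le> quad A u"
        unfolding quadP by (simp add: algebra_simps)
    qed
    then have "s + 1 / b \<le> s" unfolding s_def using bd by (rule cSup_upper)
    then show False using b by simp
  qed
  then show ?thesis using sT by blast
qed

text \<open>
  The upper bound is the lower one for \<open>-A\<close>.
\<close>
lemma eigenvalue_bounds_quad:
  assumes A: "A \<in> carrier_mat n n"
    and sym: "\<And>i j. i < n \<Longrightarrow> j < n \<Longrightarrow> A $$ (i, j) = A $$ (j, i)"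
    and ev: "\<And>k. eigenvalue A k \<Longrightarrow> lo \<le> k \<and> k \<le> hi"
  shows "lo * (\<Sum>i<n. (u i)\<^sup>2) \<le> quad A u" "quad A u \<le> hi * (\<Sum>i<n. (u i)\<^sup>2)"
proof -
  have nonneg: "0 \<le> (\<Sum>i<n. (u i)\<^sup>2)" by (intro sum_nonneg) simp
  have "lo * (\<Sum>i<n. (u i)\<^sup>2) \<le> quad A u \<and> quad A u \<le> hi * (\<Sum>i<n. (u i)\<^sup>2)"
  proof (cases "n = 0")
    case True then show ?thesis by (simp add: quad_carrier[OF A])
  next
    case False
    obtain k where k: "eigenvalue A k" "k * (\<Sum>i<n. (u i)\<^sup>2) \<le> quad A u"
      using ex_eigenvalue_lower[OF A _ sym] False by blast
    have mA: "- A \<in> carrier_mat n n" using A by simp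
    obtain k' where k': "eigenvalue (- A) k'" "k' * (\<Sum>i<n. (u i)\<^sup>2) \<le> quad (- A) u"
      using ex_eigenvalue_lower[OF mA] False sym A by auto
    have q: "quad (- A) u = - quad A u"
      unfolding quad_carrier[OF mA] quad_carrier[OF A] using A by (simp add: sum_negf)
    have "eigenvalue A (- k')"
    proof -
      obtain v where v: "v \<in> carrier_vec n" "v \<noteq> 0\<^sub>v n" "(- A) *\<^sub>v v = k' \<cdot>\<^sub>v v"
        using k'(1) A unfolding eigenvalue_def eigenvector_def by auto
      have "A *\<^sub>v v = - ((- A) *\<^sub>v v)" using A v(1) by (intro eq_vecI) auto
      also have "\<dots> = (- k') \<cdot>\<^sub>v v" unfolding v(3) by (intro eq_vecI) auto
      finally show ?thesis using v A unfolding eigenvalue_def eigenvector_def by auto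
    qed
    then have "- k' \<le> hi" using ev by blast
    then have "- k' * (\<Sum>i<n. (u i)\<^sup>2) \<le> hi * (\<Sum>i<n. (u i)\<^sup>2)" using nonneg by (rule mult_right_mono)
    moreover have "lo * (\<Sum>i<n. (u i)\<^sup>2) \<le> k * (\<Sum>i<n. (u i)\<^sup>2)"
      using ev[OF k(1)] nonneg by (intro mult_right_mono) auto
    ultimately show ?thesis using k k' q by simp
  qed
  then show "lo * (\<Sum>i<n. (u i)\<^sup>2) \<le> quad A u" "quad A u \<le> hi * (\<Sum>i<n. (u i)\<^sup>2)" by auto
qed

section \<open>Partitions and block restrictions\<close>

lemma same_block_refl:
  assumes "partition_on {..<p} B" "i < p"
  shows "same_block B i i"
proof -
  have "i \<in> \<Union>B" using partition_onD1[OF assms(1)] assms(2) by auto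
  then show ?thesis unfolding same_block_def by blast
qed

lemma same_block_sym: "same_block B i j \<Longrightarrow> same_block B j i"
  unfolding same_block_def by blast

lemma block_unique:
  assumes "partition_on A B" "X \<in> B" "Y \<in> B" "i \<in> X" "i \<in> Y"
  shows "X = Y"
proof (rule ccontr)
  assume "X \<noteq> Y"
  from disjointD[OF partition_onD2[OF assms(1)] assms(2,3) this] show False using assms(4,5) by blast
qed

lemma same_block_trans:
  assumes "partition_on {..<p} B" "same_block B i j" "same_block B j k"
  shows "same_block B i k"
proof -
  obtain X where X: "X \<in> B" "i \<in> X" "j \<in> X" using assms(2) unfolding same_block_def by blast
  obtain Y where Y: "Y \<in> B" "j \<in> Y" "k \<in> Y" using assms(3) unfolding same_block_def by blast
  have "X = Y" by (rule block_unique[OF assms(1) X(1) Y(1) X(3) Y(2)])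
  then show ?thesis using X Y unfolding same_block_def by blast
qed

lemma same_block_less:
  assumes "partition_on {..<p} B" "same_block B i j"
  shows "i < p \<and> j < p"
proof -
  have "i \<in> \<Union>B" "j \<in> \<Union>B" using assms(2) unfolding same_block_def by blast+
  then show ?thesis using partition_onD1[OF assms(1)] by auto
qed

lemma same_block_iff_mem:
  assumes "partition_on {..<p} B" "A \<in> B" "i \<in> A"
  shows "same_block B i j \<longleftrightarrow> j \<in> A"
proof
  assume "same_block B i j"
  then obtain X where X: "X \<in> B" "i \<in> X" "j \<in> X" unfolding same_block_def by blast
  have "X = A" by (rule block_unique[OF assms(1) X(1) assms(2) X(2) assms(3)])
  then show "j \<in> A" using X by simp
next
  assume "j \<in> A"
  then show "same_block B i j" using assms unfolding same_block_def by blast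
qed

lemma refines_iff_same_block:
  assumes B: "partition_on {..<p} B" and B': "partition_on {..<p} B'"
  shows "refines {..<p} B B' \<longleftrightarrow> (\<forall>i j. same_block B i j \<longrightarrow> same_block B' i j)"
proof
  assume "refines {..<p} B B'"
  then have r: "\<And>X. X \<in> B \<Longrightarrow> \<exists>Y\<in>B'. X \<subseteq> Y" unfolding refines_def by simp
  show "\<forall>i j. same_block B i j \<longrightarrow> same_block B' i j"
  proof (intro allI impI)
    fix i j assume "same_block B i j"
    then obtain X where X: "X \<in> B" "i \<in> X" "j \<in> X" unfolding same_block_def by blast
    obtain Y where "Y \<in> B'" "X \<subseteq> Y" using r[OF X(1)] by blast
    then show "same_block B' i j" using X(2,3) unfolding same_block_def by (intro bexI[of _ Y]) auto
  qed
next
  assume r: "\<forall>i j. same_block B i j \<longrightarrow> same_block B' i j"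
  have "\<exists>Y\<in>B'. A \<subseteq> Y" if A: "A \<in> B" for A
  proof -
    have "A \<noteq> {}" using A partition_onD3[OF B] by auto
    then obtain i where i: "i \<in> A" by blast
    have "i \<in> \<Union>B" using A i by blast
    then have "i \<in> \<Union>B'" unfolding partition_onD1[OF B, symmetric] partition_onD1[OF B', symmetric] .
    then obtain Y where Y: "Y \<in> B'" "i \<in> Y" by blast
    have "A \<subseteq> Y"
    proof
      fix j assume "j \<in> A"
      then have "same_block B i j" using i A unfolding same_block_def by (intro bexI[of _ A]) auto
      then have "same_block B' i j" using r by simp
      then show "j \<in> Y" using same_block_iff_mem[OF B' Y] by blast
    qed
    then show ?thesis using Y by blast
  qed
  then show "refines {..<p} B B'" using B B' unfolding refines_def by simp
qed

lemma partition_eqI: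
  assumes "partition_on {..<p} B" "partition_on {..<p} B'"
    and "\<And>i j. same_block B i j \<longleftrightarrow> same_block B' i j"
  shows "B = B'"
  by (rule refines_asym[of "{..<p}"]) (simp_all add: refines_iff_same_block assms)

lemma ex_meet_partition:
  assumes B: "partition_on {..<p} B" and B': "partition_on {..<p} B'"
  obtains M where "partition_on {..<p} M"
    "\<And>i j. same_block M i j \<longleftrightarrow> same_block B i j \<and> same_block B' i j"
proof -
  define r where "r = {(i, j). same_block B i j \<and> same_block B' i j}"
  have eq: "equiv {..<p} r"
  proof (rule equivI)
    show "r \<subseteq> {..<p} \<times> {..<p}" unfolding r_def using same_block_less[OF B] by auto
    show "refl_on {..<p} r"
      unfolding refl_on_def r_def using same_block_refl[OF B] same_block_refl[OF B'] by simp
    show "sym r" unfolding sym_def r_def using same_block_sym by simp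
    show "trans r" unfolding r_def
      by (rule transI) (use same_block_trans[OF B] same_block_trans[OF B'] in \<open>simp, meson\<close>)
  qed
  have "partition_on {..<p} ({..<p} // r)" using eq by (rule partition_on_quotient)
  moreover have "same_block ({..<p} // r) i j \<longleftrightarrow> same_block B i j \<and> same_block B' i j" for i j
    using same_block_quotient[OF eq] by (simp add: r_def)
  ultimately show ?thesis by (rule that)
qed

definition block_pairs :: "nat set set \<Rightarrow> (nat \<times> nat) set" where
  "block_pairs B = {(i, j). same_block B i j}"

lemma finite_block_pairs: "partition_on {..<p} B \<Longrightarrow> finite (block_pairs B)"
  by (rule finite_subset[of _ "{..<p} \<times> {..<p}"]) (auto simp: block_pairs_def dest: same_block_less)

lemma sum_card_sq_eq_card_pairs:
  assumes B: "partition_on {..<p} B"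
  shows "(\<Sum>A\<in>B. (real (card A))\<^sup>2) = real (card (block_pairs B))"
proof -
  have fB: "finite B" using finite_elements[OF _ B] by simp
  have fA: "finite A" if "A \<in> B" for A
  proof -
    have "A \<subseteq> {..<p}" unfolding partition_onD1[OF B] using that by blast
    then show ?thesis by (rule finite_subset) simp
  qed
  have "block_pairs B = (\<Union>A\<in>B. A \<times> A)"
    unfolding block_pairs_def same_block_def by auto
  moreover have "card (\<Union>A\<in>B. A \<times> A) = (\<Sum>A\<in>B. card (A \<times> A))"
    using fB fA block_unique[OF B] by (intro card_UN_disjoint) auto
  ultimately show ?thesis by (simp add: card_cartesian_product power2_eq_square)
qed

lemma restrict_blocks_carrier[simp]: "G \<in> carrier_mat n n \<Longrightarrow> restrict_blocks B G \<in> carrier_mat n n"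
  by (auto simp: restrict_blocks_def)

lemma restrict_blocks_index:
  "G \<in> carrier_mat n n \<Longrightarrow> i < n \<Longrightarrow> j < n \<Longrightarrow>
    restrict_blocks B G $$ (i, j) = (if same_block B i j then G $$ (i, j) else 0)"
  by (auto simp: restrict_blocks_def)

lemma restrict_blocks_fixed_iff:
  "G \<in> carrier_mat n n \<Longrightarrow> restrict_blocks B G = G \<longleftrightarrow>
     (\<forall>i<n. \<forall>j<n. G $$ (i, j) \<noteq> 0 \<longrightarrow> same_block B i j)"
  by (auto simp: mat_eq_iff restrict_blocks_def)

lemma block_partition_props:
  assumes G: "G \<in> carrier_mat n n" and sym: "transpose_mat G = G"
  shows "partition_on {..<n} (block_partition G)"
    "restrict_blocks (block_partition G) G = G"
    "\<And>B'. partition_on {..<n} B' \<Longrightarrow> restrict_blocks B' G = G \<Longrightarrow> refines {..<n} (block_partition G) B'"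
proof -
  from theI'[OF block_partition_well_defined[OF sym]]
  have "is_finest_partition G (block_partition G)" unfolding block_partition_def .
  then show "partition_on {..<n} (block_partition G)"
    "restrict_blocks (block_partition G) G = G"
    "\<And>B'. partition_on {..<n} B' \<Longrightarrow> restrict_blocks B' G = G \<Longrightarrow> refines {..<n} (block_partition G) B'"
    unfolding is_finest_partition_def using G by auto
qed

text \<open>
  The quadratic form of \<open>G\<^sub>B\<close> splits into the forms of \<open>G\<close> on the blocks, so \<open>G\<^sub>B\<close> inherits
  every spectral bound of \<open>G\<close>.
\<close>
lemma quad_restrict_blocks:
  assumes B: "partition_on {..<n} B" and G: "G \<in> carrier_mat n n"
  shows "quad (restrict_blocks B G) u = (\<Sum>A\<in>B. quad G (\<lambda>i. if i \<in> A then u i else 0))"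
proof -
  have fB: "finite B" using finite_elements[OF _ B] by simp
  have ind: "(\<Sum>A\<in>B. if i \<in> A \<and> j \<in> A then x else 0) = (if same_block B i j then x else (0::real))" for i j x
  proof (cases "same_block B i j")
    case True
    then obtain A where A: "A \<in> B" "i \<in> A" "j \<in> A" unfolding same_block_def by blast
    have "(\<Sum>A\<in>B. if i \<in> A \<and> j \<in> A then x else 0) = (\<Sum>A'\<in>B. if A' = A then x else 0)"
    proof (intro sum.cong refl)
      fix A' assume "A' \<in> B"
      then have "i \<in> A' \<longleftrightarrow> A' = A" using block_unique[OF B _ A(1) _ A(2)] A(2) by auto
      then show "(if i \<in> A' \<and> j \<in> A' then x else 0) = (if A' = A then x else 0)" using A by auto
    qed
    then show ?thesis using True A fB by (simp add: sum.delta)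
  next
    case False
    then have no: "\<And>A. A \<in> B \<Longrightarrow> \<not> (i \<in> A \<and> j \<in> A)" unfolding same_block_def by blast
    have "(\<Sum>A\<in>B. if i \<in> A \<and> j \<in> A then x else 0) = 0"
      by (rule sum.neutral) (use no in auto)
    then show ?thesis using False by simp
  qed
  have "(\<Sum>A\<in>B. quad G (\<lambda>i. if i \<in> A then u i else 0))
    = (\<Sum>A\<in>B. \<Sum>i<n. \<Sum>j<n. if i \<in> A \<and> j \<in> A then u i * G $$ (i, j) * u j else 0)"
    unfolding quad_carrier[OF G] by (intro sum.cong refl) auto
  also have "\<dots> = (\<Sum>i<n. \<Sum>A\<in>B. \<Sum>j<n. if i \<in> A \<and> j \<in> A then u i * G $$ (i, j) * u j else 0)"
    by (rule sum.swap)
  also have "\<dots> = (\<Sum>i<n. \<Sum>j<n. \<Sum>A\<in>B. if i \<in> A \<and> j \<in> A then u i * G $$ (i, j) * u j else 0)"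
    by (rule sum.cong[OF refl], rule sum.swap)
  also have "\<dots> = quad (restrict_blocks B G) u"
    unfolding ind quad_carrier[OF restrict_blocks_carrier[OF G]]
    by (intro sum.cong refl) (auto simp: restrict_blocks_index[OF G])
  finally show ?thesis ..
qed

lemma sum_sq_blocks:
  fixes u :: "nat \<Rightarrow> real"
  assumes B: "partition_on {..<n} B"
  shows "(\<Sum>i<n. (u i)\<^sup>2) = (\<Sum>A\<in>B. \<Sum>i<n. (if i \<in> A then u i else 0)\<^sup>2)"
proof -
  have one: "1\<^sub>m n \<in> carrier_mat n n" by simp
  have q: "quad (1\<^sub>m n) v = (\<Sum>i<n. (v i)\<^sup>2)" for v
    unfolding quad_carrier[OF one]
    by (intro sum.cong refl) (simp add: if_distrib[of "\<lambda>x. _ * x"] if_distrib[of "\<lambda>x. x * _"] sum.delta power2_eq_square cong: if_cong)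
  have "restrict_blocks B (1\<^sub>m n) = 1\<^sub>m n"
    unfolding restrict_blocks_fixed_iff[OF one] using same_block_refl[OF B] by auto
  then show ?thesis using quad_restrict_blocks[OF B one, of u] by (simp add: q)
qed

text \<open>
  Cutting the inverse down to the blocks leaves a left inverse.
\<close>
lemma minv_restrict_blocks:
  assumes B: "partition_on {..<n} B" and G: "G \<in> carrier_mat n n" and d: "Determinant.det G \<noteq> 0"
    and fixed: "restrict_blocks B G = G"
  shows "restrict_blocks B (minv G) = minv G"
proof -
  note inv = minv_inverse[OF G d]
  let ?R = "restrict_blocks B (minv G)"
  have Rc: "?R \<in> carrier_mat n n" using inv by simp
  have "?R * G = 1\<^sub>m n"
  proof (rule eq_matI)
    fix i j assume "i < dim_row (1\<^sub>m n)" "j < dim_col (1\<^sub>m n)"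
    then have ij: "i < n" "j < n" by auto
    have G0: "G $$ (l, j) = 0" if "l < n" "\<not> same_block B l j" for l
      using fixed that ij G unfolding restrict_blocks_fixed_iff[OF G] by auto
    have t: "(?R * G) $$ (i, j) = (\<Sum>l<n. ?R $$ (i, l) * G $$ (l, j))"
      by (rule index_mult_sum[OF Rc G ij])
    show "(?R * G) $$ (i, j) = 1\<^sub>m n $$ (i, j)"
    proof (cases "same_block B i j")
      case True
      have "(\<Sum>l<n. ?R $$ (i, l) * G $$ (l, j)) = (\<Sum>l<n. minv G $$ (i, l) * G $$ (l, j))"
      proof (intro sum.cong refl)
        fix l assume "l \<in> {..<n}"
        then have l: "l < n" by simp
        show "?R $$ (i, l) * G $$ (l, j) = minv G $$ (i, l) * G $$ (l, j)"
          using restrict_blocks_index[OF inv(3) ij(1) l] G0[OF l] True same_block_trans[OF B True, of l] same_block_sym[of B l j]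
          by auto
      qed
      also have "\<dots> = (minv G * G) $$ (i, j)" by (rule index_mult_sum[OF inv(3) G ij, symmetric])
      finally show ?thesis unfolding t inv(2) .
    next
      case False
      have "(\<Sum>l<n. ?R $$ (i, l) * G $$ (l, j)) = 0"
      proof (intro sum.neutral ballI)
        fix l assume "l \<in> {..<n}"
        then have l: "l < n" by simp
        show "?R $$ (i, l) * G $$ (l, j) = 0"
          using restrict_blocks_index[OF inv(3) ij(1) l] G0[OF l] False same_block_trans[OF B, of i l j] by auto
      qed
      moreover have "i \<noteq> j" using False same_block_refl[OF B] ij by auto
      ultimately show ?thesis unfolding t using ij by simp
    qed
  qed (use Rc G in auto)
  then have "?R * (G * minv G) = minv G"
    using assoc_mult_mat[OF Rc G inv(3)] inv(3) by simp
  then show ?thesis unfolding inv(1) using right_mult_one_mat[OF Rc] by simp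
qed

text \<open>
  \<open>G\<^sub>B\<^sup>-\<^sup>1\<close> vanishes off the blocks, where alone \<open>G\<close> and \<open>G\<^sub>B\<close> differ. This removes the trace
  from the criterion and supplies the trace conditions of the log-determinant comparisons.
\<close>
lemma mtrace_minv_restrict:
  assumes B: "partition_on {..<n} B" and G: "G \<in> carrier_mat n n" and d: "Determinant.det (restrict_blocks B G) \<noteq> 0"
  shows "mtrace (minv (restrict_blocks B G) * G) = real n"
proof -
  let ?A = "restrict_blocks B G"
  have A: "?A \<in> carrier_mat n n" using G by simp
  note inv = minv_inverse[OF A d]
  have fix0: "restrict_blocks B ?A = ?A"
    unfolding restrict_blocks_fixed_iff[OF A] using G by (auto simp: restrict_blocks_index)
  have m0: "minv ?A $$ (i, j) = 0" if "i < n" "j < n" "\<not> same_block B i j" for i j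
    using minv_restrict_blocks[OF B A d fix0] that unfolding restrict_blocks_fixed_iff[OF inv(3)] by blast
  have "mtrace (minv ?A * G) = (\<Sum>i<n. \<Sum>k<n. minv ?A $$ (i, k) * G $$ (k, i))"
    by (rule mtrace_mult_sum[OF inv(3) G])
  also have "\<dots> = (\<Sum>i<n. \<Sum>k<n. minv ?A $$ (i, k) * ?A $$ (k, i))"
    by (intro sum.cong refl) (use m0 restrict_blocks_index[OF G] same_block_sym in fastforce)
  also have "\<dots> = mtrace (minv ?A * ?A)"
    by (rule mtrace_mult_sum[OF inv(3) A, symmetric])
  also have "\<dots> = real n" unfolding inv(2) by (simp add: mtrace_def)
  finally show ?thesis .
qed

lemma max_norm_ge_imp_entry:
  assumes A: "A \<in> carrier_mat n n" and n: "0 < n" and g: "g \<le> max_norm A"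
  shows "\<exists>i<n. \<exists>j<n. g \<le> \<bar>A $$ (i, j)\<bar>"
proof -
  let ?T = "{\<bar>A $$ (i, j)\<bar> | i j. i < dim_row A \<and> j < dim_col A}"
  have "?T = (\<lambda>(i, j). \<bar>A $$ (i, j)\<bar>) ` ({..<n} \<times> {..<n})" using A by auto
  then have fin: "finite ?T" and ne: "?T \<noteq> {}" using n by auto
  have "max_norm A \<in> ?T" unfolding max_norm_def by (rule Max_in[OF fin ne])
  then obtain i j where "i < n" "j < n" "max_norm A = \<bar>A $$ (i, j)\<bar>" using A by blast
  then show ?thesis using g by (intro exI[of _ i] exI[of _ j] conjI) auto
qed

section \<open>Selecting the blocks from a good approximation\<close>

lemma restrict_blocks_restrict:
  assumes G: "G \<in> carrier_mat n n" and "\<And>i j. same_block M i j \<Longrightarrow> same_block B i j"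
  shows "restrict_blocks M (restrict_blocks B G) = restrict_blocks M G"
  by (rule eq_matI) (auto simp: restrict_blocks_def assms(2))

text \<open>
  The deterministic situation in which every estimator finds the blocks \<open>Bs\<close> of \<open>Sg\<close>: \<open>c\<close>
  and \<open>K\<close> bound the spectrum of \<open>S\<close>, \<open>\<tau>\<close> bounds its entrywise error, \<open>g\<close> is the gap of \<open>Sg\<close>,
  and \<open>k0\<close> is the penalty \<open>\<kappa>\<close> multiplied by the dimension. The last two conditions compare
  the penalty with the price of dropping an entry that is absent from \<open>Sg\<close>, and with the
  gain from restoring one that is present.
\<close>
locale block_approx =
  fixes p m :: nat and S Sg :: "real Matrix.mat" and Bs :: "nat set set" and c K \<tau> g k0 :: real
  assumes p: "0 < p" and S: "S \<in> carrier_mat p p" and Sg: "Sg \<in> carrier_mat p p"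
    and S_transpose: "transpose_mat S = S" and Sg_transpose: "transpose_mat Sg = Sg"
    and Bs_eq: "Bs = block_partition Sg"
    and c: "0 < c" and K: "0 < K"
    and lower: "\<And>u. c * (\<Sum>i<p. (u i)\<^sup>2) \<le> quad S u"
    and upper: "\<And>u. quad S u \<le> K * (\<Sum>i<p. (u i)\<^sup>2)"
    and close: "\<And>i j. i < p \<Longrightarrow> j < p \<Longrightarrow> \<bar>S $$ (i, j) - Sg $$ (i, j)\<bar> \<le> \<tau>"
    and tau: "0 \<le> \<tau>"
    and blocks: "\<And>A. A \<in> Bs \<Longrightarrow> card A \<le> m"
    and gap: "\<And>B. refines {..<p} B Bs \<Longrightarrow> B \<noteq> Bs \<Longrightarrow> g \<le> max_norm (restrict_blocks B Sg - Sg)"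
    and g: "\<tau> < g"
    and merge_cost: "\<tau>\<^sup>2 / c\<^sup>2 < k0"
    and split_gain: "k0 * (real m)\<^sup>2 < (g - \<tau>)\<^sup>2 / K\<^sup>2"
begin

lemma k0_nonneg: "0 \<le> k0"
proof -
  have "0 \<le> \<tau>\<^sup>2 / c\<^sup>2" by simp
  then show ?thesis using merge_cost by linarith
qed

lemma symS:
  assumes "i < p" "j < p"
  shows "S $$ (i, j) = S $$ (j, i)"
  using arg_cong[OF S_transpose, of "\<lambda>A. A $$ (j, i)"] assms S by simp

lemmas Bs_props = block_partition_props[OF Sg Sg_transpose, folded Bs_eq]
lemmas Bs_part = Bs_props(1)

lemma Sg_zero: "i < p \<Longrightarrow> j < p \<Longrightarrow> \<not> same_block Bs i j \<Longrightarrow> Sg $$ (i, j) = 0"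
  using Bs_props(2) unfolding restrict_blocks_fixed_iff[OF Sg] by blast

lemma lower_blocks:
  assumes B: "partition_on {..<p} B"
  shows "c * (\<Sum>i<p. (u i)\<^sup>2) \<le> quad (restrict_blocks B S) u"
  unfolding quad_restrict_blocks[OF B S] sum_sq_blocks[OF B, of u] sum_distrib_left[of c _ B]
  by (rule sum_mono, rule lower)

lemma upper_blocks:
  assumes B: "partition_on {..<p} B"
  shows "quad (restrict_blocks B S) u \<le> K * (\<Sum>i<p. (u i)\<^sup>2)"
  unfolding quad_restrict_blocks[OF B S] sum_sq_blocks[OF B, of u] sum_distrib_left[of K _ B]
  by (rule sum_mono, rule upper)

lemma sym_blocks:
  assumes ij: "i < p" "j < p"
  shows "restrict_blocks B S $$ (i, j) = restrict_blocks B S $$ (j, i)"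
proof -
  have "same_block B i j \<longleftrightarrow> same_block B j i" using same_block_sym by blast
  then show ?thesis
    unfolding restrict_blocks_index[OF S ij] restrict_blocks_index[OF S ij(2,1)] symS[OF ij] by simp
qed

lemma spd_blocks:
  assumes B: "partition_on {..<p} B"
  shows "sym_pos_def (restrict_blocks B S)"
  unfolding sym_pos_def_iff_quad[OF restrict_blocks_carrier[OF S]]
proof (intro conjI allI impI)
  fix u :: "nat \<Rightarrow> real" assume "\<exists>i<p. u i \<noteq> 0"
  then obtain i where i: "i < p" "u i \<noteq> 0" by blast
  have "0 < (u i)\<^sup>2" using i by simp
  also have "\<dots> \<le> (\<Sum>i<p. (u i)\<^sup>2)" using i by (intro member_le_sum) auto
  finally have "0 < c * (\<Sum>i<p. (u i)\<^sup>2)" using c by simp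
  also have "\<dots> \<le> quad (restrict_blocks B S) u" by (rule lower_blocks[OF B])
  finally show "0 < quad (restrict_blocks B S) u" .
qed (rule sym_blocks)

lemma diag_bounds: "i < p \<Longrightarrow> c \<le> S $$ (i, i) \<and> S $$ (i, i) \<le> K"
proof -
  assume i: "i < p"
  have "(\<Sum>k<p. (if k = i then 1 else 0 :: real)\<^sup>2) = 1"
    using i by (subst sum.remove[of _ i]) auto
  then show ?thesis using lower[of "\<lambda>k. if k = i then 1 else 0"] upper[of "\<lambda>k. if k = i then 1 else 0"]
    quad_unit[OF S i] by simp
qed

text \<open>
  The value \<open>p \<Psi>(B)\<close> up to an additive constant, except that the penalty here counts the
  blocks of \<open>B\<close> itself. These may be coarser than the blocks of \<open>S\<^sub>B\<close> when \<open>S\<close> has vanishing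
  entries.
\<close>
definition crit :: "nat set set \<Rightarrow> real" where
  "crit B = ln (Determinant.det (restrict_blocks B S)) + k0 * real (card (block_pairs B))"

text \<open>
  \<open>M\<close> is the common refinement of \<open>B\<close> and \<open>Bs\<close>. The entries lost in passing from \<open>B\<close> to \<open>M\<close>
  lie outside the blocks of \<open>Sg\<close>, hence are at most \<open>\<tau>\<close>; each raises the log-determinant by
  at most \<open>\<tau>\<^sup>2/c\<^sup>2\<close> and saves the penalty \<open>k0\<close>.
\<close>
lemma crit_merge:
  assumes B: "partition_on {..<p} B" and M: "partition_on {..<p} M"
    and MB: "\<And>i j. same_block M i j \<longleftrightarrow> same_block B i j \<and> same_block Bs i j" and ne: "M \<noteq> B"
  shows "crit M < crit B"
proof -
  let ?A = "restrict_blocks B S" and ?M = "restrict_blocks M S"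
  have Ac: "?A \<in> carrier_mat p p" and Mc: "?M \<in> carrier_mat p p" using S by auto
  have RA: "restrict_blocks M ?A = ?M"
    by (rule restrict_blocks_restrict[OF S]) (simp add: MB)
  have tr: "mtrace (minv ?M * ?A) = real p"
    using mtrace_minv_restrict[OF M Ac] sym_pos_def_det_nz[OF spd_blocks[OF M] Mc] unfolding RA by simp
  \<comment> \<open>the index pairs whose entries are lost\<close>
  define D where "D = block_pairs B - block_pairs M"
  have fin: "finite (block_pairs B)" "finite (block_pairs M)" using finite_block_pairs B M by auto
  have sub: "block_pairs M \<subseteq> block_pairs B" using MB by (auto simp: block_pairs_def)
  have cD: "real (card D) = real (card (block_pairs B)) - real (card (block_pairs M))"
    unfolding D_def using fin sub by (simp add: card_Diff_subset card_mono of_nat_diff)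
  have "D \<noteq> {}"
  proof
    assume "D = {}"
    then have "\<And>i j. same_block M i j \<longleftrightarrow> same_block B i j"
      using sub unfolding D_def block_pairs_def by blast
    then show False using partition_eqI[OF M B] ne by blast
  qed
  then have D0: "0 < card D" using fin by (simp add: D_def card_gt_0_iff)
  have AMc: "?A - ?M \<in> carrier_mat p p" using Mc by (rule minus_carrier_mat)
  have Dsub: "D \<subseteq> {..<p} \<times> {..<p}" using same_block_less[OF B] by (auto simp: D_def block_pairs_def)
  have minus: "(?A - ?M) $$ (i, j) = ?A $$ (i, j) - ?M $$ (i, j)" if "i < p" "j < p" for i j
    using that Mc by (intro index_minus_mat) auto
  have entry: "((?A - ?M) $$ (i, j))\<^sup>2 \<le> (if (i, j) \<in> D then \<tau>\<^sup>2 else 0)" if ij: "i < p" "j < p" for i j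
  proof (cases "(i, j) \<in> D")
    case True
    then have sb: "same_block B i j" "\<not> same_block M i j" "\<not> same_block Bs i j"
      using MB by (auto simp: D_def block_pairs_def)
    have "\<bar>S $$ (i, j)\<bar> \<le> \<tau>" using close[OF ij] Sg_zero[OF ij sb(3)] by simp
    then have "(S $$ (i, j))\<^sup>2 \<le> \<tau>\<^sup>2" using tau by (simp add: abs_le_square_iff[symmetric])
    moreover have "(?A - ?M) $$ (i, j) = S $$ (i, j)"
      using minus[OF ij] sb by (simp add: restrict_blocks_index[OF S ij])
    ultimately show ?thesis using True by simp
  next
    case False
    then have "(?A - ?M) $$ (i, j) = 0"
      using minus[OF ij] MB by (auto simp: restrict_blocks_index[OF S ij] D_def block_pairs_def)
    then show ?thesis using False by simp
  qed
  have "frob_sq (?A - ?M) \<le> (\<Sum>i<p. \<Sum>j<p. if (i, j) \<in> D then \<tau>\<^sup>2 else 0)"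
    unfolding frob_sq_carrier[OF AMc] by (intro sum_mono entry) auto
  also have "\<dots> = (\<Sum>x\<in>{..<p} \<times> {..<p}. if x \<in> D then \<tau>\<^sup>2 else 0)"
    by (simp add: sum.cartesian_product case_prod_unfold)
  also have "\<dots> = (\<Sum>x\<in>D. \<tau>\<^sup>2)"
    using Dsub by (subst sum.inter_restrict[symmetric]) (auto simp: Int_absorb1)
  also have "\<dots> = \<tau>\<^sup>2 * real (card D)" by simp
  finally have fr: "frob_sq (?A - ?M) \<le> \<tau>\<^sup>2 * real (card D)" .
  have "ln (Determinant.det ?M) - ln (Determinant.det ?A) \<le> frob_sq (?A - ?M) / c\<^sup>2"
    by (rule ln_det_diff_le_frob[OF spd_blocks[OF B] Ac spd_blocks[OF M] Mc c lower_blocks[OF B] lower_blocks[OF M] tr])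
  also have "\<dots> \<le> \<tau>\<^sup>2 * real (card D) / c\<^sup>2" using fr by (intro divide_right_mono) auto
  also have "\<dots> = \<tau>\<^sup>2 / c\<^sup>2 * real (card D)" by simp
  also have "\<dots> < k0 * real (card D)" using merge_cost D0 by (intro mult_strict_right_mono) auto
  finally show ?thesis unfolding crit_def cD by (simp add: algebra_simps)
qed

lemma gap_pair:
  assumes B: "partition_on {..<p} B" and r: "refines {..<p} B Bs" and ne: "B \<noteq> Bs"
  shows "\<exists>i<p. \<exists>j<p. \<not> same_block B i j \<and> same_block Bs i j \<and> g \<le> \<bar>Sg $$ (i, j)\<bar>"
proof -
  have Dc: "restrict_blocks B Sg - Sg \<in> carrier_mat p p" using Sg by (rule minus_carrier_mat)
  obtain i j where ij: "i < p" "j < p" "g \<le> \<bar>(restrict_blocks B Sg - Sg) $$ (i, j)\<bar>"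
    using max_norm_ge_imp_entry[OF Dc p gap[OF r ne]] by blast
  have e: "(restrict_blocks B Sg - Sg) $$ (i, j) = (if same_block B i j then 0 else - Sg $$ (i, j))"
    using ij Sg by (simp add: restrict_blocks_index[OF Sg])
  have g0: "0 < g" using g tau by simp
  have nB: "\<not> same_block B i j" using e ij(3) g0 by (auto split: if_splits)
  then have gS: "g \<le> \<bar>Sg $$ (i, j)\<bar>" using e ij(3) by simp
  then have "same_block Bs i j" using Sg_zero[OF ij(1,2)] g0 by force
  then show ?thesis using ij nB gS by blast
qed

lemma large_entry:
  assumes "i < p" "j < p" "g \<le> \<bar>Sg $$ (i, j)\<bar>"
  shows "g - \<tau> \<le> \<bar>S $$ (i, j)\<bar>"
  using close[OF assms(1,2)] assms(3) by linarith

text \<open>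
  By the gap, some entry \<open>(i, j)\<close> inside \<open>Bs\<close> but outside \<open>B\<close> is at least \<open>g - \<tau>\<close> in \<open>S\<close>.
  Uniting the blocks of \<open>i\<close> and \<open>j\<close> lowers the log-determinant by \<open>(g - \<tau>)\<^sup>2/K\<^sup>2\<close>; the union
  stays within a block of \<open>Bs\<close>, so the penalty rises by at most \<open>k0 m\<^sup>2\<close>.
\<close>
lemma crit_split:
  assumes B: "partition_on {..<p} B" and r: "refines {..<p} B Bs" and ne: "B \<noteq> Bs"
  shows "\<exists>B'. partition_on {..<p} B' \<and> crit B' < crit B"
proof -
  obtain i j where ij: "i < p" "j < p" and nB: "\<not> same_block B i j" and sBs: "same_block Bs i j"
    and gS: "g \<le> \<bar>Sg $$ (i, j)\<bar>" using gap_pair[OF assms] by blast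
  have "i \<in> \<Union>B" "j \<in> \<Union>B" using ij partition_onD1[OF B] by auto
  then obtain bi bj where b: "bi \<in> B" "i \<in> bi" "bj \<in> B" "j \<in> bj" by blast
  have bne: "bi \<noteq> bj" using nB b unfolding same_block_def by blast
  have inot: "i \<notin> bj" using block_unique[OF B b(1) b(3) b(2)] bne by blast
  define B' where "B' = insert (bi \<union> bj) (B - {bi, bj})"
  have B': "partition_on {..<p} B'"
  proof (rule partition_onI)
    show "\<Union>B' = {..<p}" unfolding partition_onD1[OF B] B'_def using b by blast
    show "{} \<notin> B'" using partition_onD3[OF B] b by (auto simp: B'_def)
    fix X Y assume XY: "X \<in> B'" "Y \<in> B'" "X \<noteq> Y"
    have dj: "disjnt X Y" if "X \<in> B" "Y \<in> B" "X \<noteq> Y" for X Y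
      using disjointD[OF partition_onD2[OF B] that] by (simp add: disjnt_def)
    have dj2: "disjnt (bi \<union> bj) Y" if "Y \<in> B - {bi, bj}" for Y
      using dj[OF b(1), of Y] dj[OF b(3), of Y] that by auto
    from XY consider "X = bi \<union> bj" "Y \<in> B - {bi, bj}" | "Y = bi \<union> bj" "X \<in> B - {bi, bj}"
      | "X \<in> B - {bi, bj}" "Y \<in> B - {bi, bj}" unfolding B'_def by blast
    then show "disjnt X Y"
    proof cases
      case 1 then show ?thesis using dj2 by simp
    next
      case 2 then show ?thesis using dj2 disjnt_sym by blast
    next
      case 3 then show ?thesis using dj XY(3) by blast
    qed
  qed
  have sb': "same_block B' k l \<longleftrightarrow> same_block B k l \<or> (k \<in> bi \<union> bj \<and> l \<in> bi \<union> bj)" for k l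
  proof
    assume "same_block B' k l"
    then obtain X where X: "X \<in> B'" "k \<in> X" "l \<in> X" unfolding same_block_def by blast
    then have "X = bi \<union> bj \<or> X \<in> B" by (auto simp: B'_def)
    then show "same_block B k l \<or> (k \<in> bi \<union> bj \<and> l \<in> bi \<union> bj)"
      using X unfolding same_block_def by blast
  next
    assume "same_block B k l \<or> (k \<in> bi \<union> bj \<and> l \<in> bi \<union> bj)"
    then show "same_block B' k l"
    proof
      assume "same_block B k l"
      then obtain X where X: "X \<in> B" "k \<in> X" "l \<in> X" unfolding same_block_def by blast
      show ?thesis
      proof (cases "X = bi \<or> X = bj")
        case True
        then have "k \<in> bi \<union> bj" "l \<in> bi \<union> bj" using X by auto
        then show ?thesis unfolding same_block_def by (intro bexI[of _ "bi \<union> bj"]) (auto simp: B'_def)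
      next
        case False
        then show ?thesis using X unfolding same_block_def by (intro bexI[of _ X]) (auto simp: B'_def)
      qed
    next
      assume "k \<in> bi \<union> bj \<and> l \<in> bi \<union> bj"
      then show ?thesis unfolding same_block_def by (intro bexI[of _ "bi \<union> bj"]) (auto simp: B'_def)
    qed
  qed
  let ?A = "restrict_blocks B S" and ?C = "restrict_blocks B' S"
  have Ac: "?A \<in> carrier_mat p p" and Cc: "?C \<in> carrier_mat p p" using S by auto
  note spdA = spd_blocks[OF B] and spdC = spd_blocks[OF B']
  have dA: "Determinant.det ?A \<noteq> 0" by (rule sym_pos_def_det_nz[OF spdA Ac])
  have RC: "restrict_blocks B ?C = ?A"
    by (rule restrict_blocks_restrict[OF S]) (simp add: sb')
  have RA: "restrict_blocks B ?A = ?A"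
    by (rule restrict_blocks_restrict[OF S])
  have tr: "mtrace (minv ?A * ?C) = real p"
    using mtrace_minv_restrict[OF B Cc] dA unfolding RC by simp
  \<comment> \<open>the covariances of variable \<open>i\<close> with the block of \<open>j\<close>\<close>
  define d where "d = (\<lambda>k. if k \<in> bj then S $$ (k, i) else 0)"
  have minv0: "minv ?A $$ (k, l) = 0" if "k < p" "l < p" "\<not> same_block B k l" for k l
    using minv_restrict_blocks[OF B Ac dA RA] that
    unfolding restrict_blocks_fixed_iff[OF minv_inverse(3)[OF Ac dA]] by blast
  have cross: "(\<Sum>k<p. \<Sum>l<p. d k * minv ?A $$ (k, l) * ?C $$ (l, i))
      = (\<Sum>k<p. \<Sum>l<p. d k * minv ?A $$ (k, l) * d l)"
  proof (intro sum.cong refl)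
    fix k l assume "k \<in> {..<p}" "l \<in> {..<p}"
    then have kl: "k < p" "l < p" by auto
    show "d k * minv ?A $$ (k, l) * ?C $$ (l, i) = d k * minv ?A $$ (k, l) * d l"
    proof (cases "k \<in> bj \<and> same_block B k l")
      case True
      then have l: "l \<in> bj" using same_block_iff_mem[OF B b(3)] by blast
      then have "?C $$ (l, i) = S $$ (l, i)"
        using sb' b kl ij by (simp add: restrict_blocks_index[OF S])
      then show ?thesis using l by (simp add: d_def)
    next
      case False
      then show ?thesis using minv0[OF kl] by (auto simp: d_def)
    qed
  qed
  have "?C $$ (i, i) = S $$ (i, i)"
    using same_block_refl[OF B' ij(1)] ij by (simp add: restrict_blocks_index[OF S])
  then have Cii: "?C $$ (i, i) \<le> K" using diag_bounds[OF ij(1)] by simp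
  have gain: "ln (Determinant.det ?C) + (\<Sum>k<p. (d k)\<^sup>2) / K\<^sup>2 \<le> ln (Determinant.det ?A)"
    by (rule ln_det_le_regression[OF spdA Ac spdC Cc tr ij(1) _ K upper_blocks[OF B] Cii cross])
      (simp add: d_def inot)
  have "(g - \<tau>)\<^sup>2 \<le> (S $$ (j, i))\<^sup>2"
    using large_entry[OF ij gS] g symS[OF ij] by (simp add: abs_le_square_iff[symmetric])
  also have "\<dots> = (d j)\<^sup>2" using b by (simp add: d_def)
  also have "\<dots> \<le> (\<Sum>k<p. (d k)\<^sup>2)" using ij by (intro member_le_sum) auto
  finally have dsum: "(g - \<tau>)\<^sup>2 / K\<^sup>2 \<le> (\<Sum>k<p. (d k)\<^sup>2) / K\<^sup>2" by (intro divide_right_mono) auto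
  have pairs: "real (card (block_pairs B')) \<le> real (card (block_pairs B)) + (real m)\<^sup>2"
  proof -
    obtain A where A: "A \<in> Bs" "i \<in> A" "j \<in> A" using sBs unfolding same_block_def by blast
    have rr: "same_block Bs k l" if "same_block B k l" for k l
      using r that unfolding refines_iff_same_block[OF B Bs_part] by blast
    have subA: "bi \<union> bj \<subseteq> A"
    proof
      fix k assume "k \<in> bi \<union> bj"
      then have "same_block B i k \<or> same_block B j k" using b unfolding same_block_def by blast
      then show "k \<in> A" using rr same_block_iff_mem[OF Bs_part A(1,2)] same_block_iff_mem[OF Bs_part A(1,3)] by blast
    qed
    have "A \<subseteq> {..<p}" unfolding partition_onD1[OF Bs_part] using A(1) by blast
    then have finA: "finite A" by (rule finite_subset) simp
    have cm: "card (bi \<union> bj) \<le> m" using card_mono[OF finA subA] blocks[OF A(1)] by simp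
    have "block_pairs B' \<subseteq> block_pairs B \<union> (bi \<union> bj) \<times> (bi \<union> bj)"
      using sb' by (auto simp: block_pairs_def)
    then have "card (block_pairs B') \<le> card (block_pairs B \<union> (bi \<union> bj) \<times> (bi \<union> bj))"
      using finite_block_pairs[OF B] finite_subset[OF subA finA] by (intro card_mono) auto
    also have "\<dots> \<le> card (block_pairs B) + card (bi \<union> bj) * card (bi \<union> bj)"
      using card_Un_le[of "block_pairs B" "(bi \<union> bj) \<times> (bi \<union> bj)"] by (simp add: card_cartesian_product)
    also have "\<dots> \<le> card (block_pairs B) + m * m"
      using mult_le_mono[OF cm cm] by simp
    finally have "card (block_pairs B') \<le> card (block_pairs B) + m * m" .
    then have "real (card (block_pairs B')) \<le> real (card (block_pairs B) + m * m)" by (simp only: of_nat_le_iff)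
    then show ?thesis by (simp add: power2_eq_square)
  qed
  have "crit B' \<le> ln (Determinant.det ?A) - (g - \<tau>)\<^sup>2 / K\<^sup>2 + k0 * (real (card (block_pairs B)) + (real m)\<^sup>2)"
    unfolding crit_def using gain dsum mult_left_mono[OF pairs k0_nonneg] by linarith
  also have "\<dots> < crit B" unfolding crit_def using split_gain by (simp add: algebra_simps)
  finally show ?thesis using B' by blast
qed

text \<open>
  There are finitely many partitions, and each one except \<open>Bs\<close> can be improved: by cutting
  along \<open>Bs\<close> if it does not refine \<open>Bs\<close>, by uniting two blocks otherwise.
\<close>
lemma crit_unique_min:
  assumes B: "partition_on {..<p} B" and ne: "B \<noteq> Bs"
  shows "crit Bs < crit B"
proof -
  have improve: "\<exists>B'. partition_on {..<p} B' \<and> crit B' < crit B"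
    if B: "partition_on {..<p} B" and ne: "B \<noteq> Bs" for B
  proof -
    obtain M where M: "partition_on {..<p} M"
      "\<And>i j. same_block M i j \<longleftrightarrow> same_block B i j \<and> same_block Bs i j"
      using ex_meet_partition[OF B Bs_part] by blast
    show ?thesis
    proof (cases "M = B")
      case True
      then have "\<forall>i j. same_block B i j \<longrightarrow> same_block Bs i j" using M(2) by blast
      then show ?thesis using crit_split[OF B _ ne] by (simp add: refines_iff_same_block[OF B Bs_part])
    next
      case False
      then show ?thesis using crit_merge[OF B M(1) M(2)] M(1) by blast
    qed
  qed
  let ?P = "{B. partition_on {..<p} B}"
  have fin: "finite ?P" by (rule finitely_many_partition_on) simp
  define B0 where "B0 = arg_min_on crit ?P"
  have B0: "B0 \<in> ?P" unfolding B0_def using fin Bs_part by (intro arg_min_if_finite) auto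
  have least: "\<not> crit B' < crit B0" if "B' \<in> ?P" for B'
    unfolding B0_def using arg_min_if_finite(2)[OF fin, of crit] that by blast
  have B0Bs: "B0 = Bs"
    using improve[of B0] B0 least by blast
  obtain B' where B': "partition_on {..<p} B'" "crit B' < crit B" using improve[OF B ne] by blast
  have "crit Bs \<le> crit B'" using least[of B'] B'(1) B0Bs by simp
  then show ?thesis using B'(2) by simp
qed

text \<open>
  The penalty of \<open>S\<^sub>B\<close> is that of its own finest partition, which refines \<open>B\<close> and gives the
  same restriction of \<open>S\<close>.
\<close>
lemma Psi_eq_crit:
  assumes B: "partition_on {..<p} B"
  shows "partition_on {..<p} (block_partition (restrict_blocks B S))"
    "restrict_blocks (block_partition (restrict_blocks B S)) S = restrict_blocks B S"
    "refines {..<p} (block_partition (restrict_blocks B S)) B"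
    "Psi \<kappa> S B = ln (Determinant.det (restrict_blocks B S)) / real p + 1 + \<kappa> * real (card (block_pairs (block_partition (restrict_blocks B S))))"
proof -
  let ?B' = "block_partition (restrict_blocks B S)"
  let ?A = "restrict_blocks B S"
  have Ac: "?A \<in> carrier_mat p p" using S by simp
  have At: "transpose_mat ?A = ?A"
    by (rule eq_matI) (use Ac sym_blocks in auto)
  note bp = block_partition_props[OF Ac At]
  show B': "partition_on {..<p} ?B'" by (rule bp(1))
  have RA: "restrict_blocks B ?A = ?A"
    by (rule restrict_blocks_restrict[OF S])
  show rf: "refines {..<p} ?B' B" by (rule bp(3)[OF B RA])
  then have imp: "same_block B i j" if "same_block ?B' i j" for i j
    using that unfolding refines_iff_same_block[OF B' B] by blast
  have "restrict_blocks ?B' S = restrict_blocks ?B' ?A"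
    by (rule restrict_blocks_restrict[OF S, symmetric]) (rule imp)
  then show "restrict_blocks ?B' S = ?A" using bp(2) by simp
  have dA: "Determinant.det ?A \<noteq> 0" by (rule sym_pos_def_det_nz[OF spd_blocks[OF B] Ac])
  have "loglik S ?A = ln (Determinant.det ?A) / real p + 1"
    unfolding loglik_def mtrace_minv_restrict[OF B S dA] using p S by (simp add: add_divide_distrib)
  moreover have "pen ?A = real (card (block_pairs ?B'))"
    unfolding pen_def by (rule sum_card_sq_eq_card_pairs[OF B'])
  ultimately show "Psi \<kappa> S B = ln (Determinant.det ?A) / real p + 1 + \<kappa> * real (card (block_pairs ?B'))"
    unfolding Psi_def Phi_def by simp
qed

lemma Psi_crit:
  assumes B: "partition_on {..<p} B" and kap: "\<kappa> = k0 / real p"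
  shows "real p * Psi \<kappa> S B = crit (block_partition (restrict_blocks B S)) + real p"
  unfolding Psi_eq_crit(4)[OF B] crit_def Psi_eq_crit(2)[OF B] kap using p by (simp add: field_simps)

text \<open>
  The conclusion concerns \<open>S\<^sub>B\<close> and not \<open>B\<close>, as \<open>\<Psi>\<close> does not distinguish partitions with the
  same restriction of \<open>S\<close>.
\<close>
lemma Psi_le_imp_restrict_eq:
  assumes B: "partition_on {..<p} B" and kap: "\<kappa> = k0 / real p" and le: "Psi \<kappa> S B \<le> Psi \<kappa> S Bs"
  shows "restrict_blocks B S = restrict_blocks Bs S"
proof -
  let ?B' = "block_partition (restrict_blocks B S)" and ?Bs' = "block_partition (restrict_blocks Bs S)"
  note b = Psi_eq_crit[OF B] and bs = Psi_eq_crit[OF Bs_part]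
  note e = Psi_crit[OF B kap] and es = Psi_crit[OF Bs_part kap]
  have "block_pairs ?Bs' \<subseteq> block_pairs Bs"
    using bs(3) unfolding refines_iff_same_block[OF bs(1) Bs_part] by (auto simp: block_pairs_def)
  then have "card (block_pairs ?Bs') \<le> card (block_pairs Bs)"
    by (rule card_mono[OF finite_block_pairs[OF Bs_part]])
  then have "crit ?Bs' \<le> crit Bs"
    unfolding crit_def bs(2) using k0_nonneg by (simp add: mult_left_mono)
  moreover have "real p * Psi \<kappa> S B \<le> real p * Psi \<kappa> S Bs" using le by (simp add: mult_left_mono)
  ultimately have "crit ?B' \<le> crit Bs" using e es by simp
  then have "?B' = Bs" using crit_unique_min[OF b(1)] by fastforce
  then show ?thesis using b(2) by simp
qed

lemma corr_index:
  assumes "i < p" "j < p"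
  shows "corr_mat S $$ (i, j) = S $$ (i, j) / sqrt (S $$ (i, i) * S $$ (j, j))"
  using assms S by (simp add: corr_mat_def)

lemma corr_bounds:
  assumes ij: "i < p" "j < p"
  shows "\<bar>S $$ (i, j)\<bar> / K \<le> \<bar>corr_mat S $$ (i, j)\<bar>" "\<bar>corr_mat S $$ (i, j)\<bar> \<le> \<bar>S $$ (i, j)\<bar> / c"
proof -
  let ?q = "sqrt (S $$ (i, i) * S $$ (j, j))"
  note d = diag_bounds[OF ij(1)] diag_bounds[OF ij(2)]
  have cc: "c * c \<le> S $$ (i, i) * S $$ (j, j)" using d c by (intro mult_mono) auto
  have "c = sqrt (c * c)" using c by simp
  also have "\<dots> \<le> ?q" by (rule real_sqrt_le_mono[OF cc])
  finally have q1: "c \<le> ?q" .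
  have prod0: "0 < S $$ (i, i) * S $$ (j, j)" using d c by (intro mult_pos_pos) auto
  have KK: "S $$ (i, i) * S $$ (j, j) \<le> K * K" using d c K by (intro mult_mono) auto
  have "?q \<le> sqrt (K * K)" by (rule real_sqrt_le_mono[OF KK])
  also have "sqrt (K * K) = K" using K by simp
  finally have q2: "?q \<le> K" .
  have q0: "0 < ?q" using q1 c by linarith
  have e: "\<bar>corr_mat S $$ (i, j)\<bar> = \<bar>S $$ (i, j)\<bar> / ?q"
    unfolding corr_index[OF ij] using q0 prod0 by simp
  show "\<bar>S $$ (i, j)\<bar> / K \<le> \<bar>corr_mat S $$ (i, j)\<bar>"
    unfolding e by (rule divide_left_mono[OF q2 _ mult_pos_pos[OF K q0]]) simp
  show "\<bar>corr_mat S $$ (i, j)\<bar> \<le> \<bar>S $$ (i, j)\<bar> / c"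
    unfolding e by (rule divide_left_mono[OF q1 _ mult_pos_pos[OF q0 c]]) simp
qed

lemma threshold_sym:
  assumes ij: "i < p" "j < p"
  shows "threshold t (corr_mat S) $$ (i, j) = threshold t (corr_mat S) $$ (j, i)"
  using ij S symS[OF ij] by (simp add: threshold_def corr_mat_def mult.commute)

lemma threshold_carrier: "threshold t (corr_mat S) \<in> carrier_mat p p"
  using S by (auto simp: threshold_def corr_mat_def)

lemma B_thr_props:
  shows "partition_on {..<p} (B_thr S t)"
    "restrict_blocks (B_thr S t) (threshold t (corr_mat S)) = threshold t (corr_mat S)"
    "\<And>B'. partition_on {..<p} B' \<Longrightarrow> restrict_blocks B' (threshold t (corr_mat S)) = threshold t (corr_mat S) \<Longrightarrow>
       refines {..<p} (B_thr S t) B'"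
proof -
  have At: "transpose_mat (threshold t (corr_mat S)) = threshold t (corr_mat S)"
    by (rule eq_matI) (use threshold_carrier[of t] threshold_sym in auto)
  note bp = block_partition_props[OF threshold_carrier At, folded B_thr_def]
  show "partition_on {..<p} (B_thr S t)" by (rule bp(1))
  show "restrict_blocks (B_thr S t) (threshold t (corr_mat S)) = threshold t (corr_mat S)" by (rule bp(2))
  show "\<And>B'. partition_on {..<p} B' \<Longrightarrow> restrict_blocks B' (threshold t (corr_mat S)) = threshold t (corr_mat S) \<Longrightarrow>
       refines {..<p} (B_thr S t) B'" by (rule bp(3))
qed

lemma threshold_index:
  assumes "i < p" "j < p"
  shows "threshold t (corr_mat S) $$ (i, j) = (if \<bar>corr_mat S $$ (i, j)\<bar> > t then corr_mat S $$ (i, j) else 0)"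
  using assms S by (simp add: threshold_def corr_mat_def)

text \<open>
  Nothing outside \<open>Bs\<close> survives the threshold, so the thresholded partition refines \<open>Bs\<close>.
  Were it strictly finer, it would separate a pair whose absolute correlation is at least
  \<open>(g - \<tau>)/K > t\<close>.
\<close>
lemma B_thr_eq:
  assumes out: "\<And>i j. i < p \<Longrightarrow> j < p \<Longrightarrow> \<not> same_block Bs i j \<Longrightarrow> \<bar>corr_mat S $$ (i, j)\<bar> \<le> t"
    and t: "0 \<le> t" "t < (g - \<tau>) / K"
  shows "B_thr S t = Bs"
proof (rule ccontr)
  assume ne: "B_thr S t \<noteq> Bs"
  note props = B_thr_props[where t = t]
  have "restrict_blocks Bs (threshold t (corr_mat S)) = threshold t (corr_mat S)"
    unfolding restrict_blocks_fixed_iff[OF threshold_carrier]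
  proof (intro allI impI)
    fix i j assume ij: "i < p" "j < p" and nz: "threshold t (corr_mat S) $$ (i, j) \<noteq> 0"
    show "same_block Bs i j"
    proof (rule ccontr)
      assume "\<not> same_block Bs i j"
      from out[OF ij this] show False using nz by (simp add: threshold_index[OF ij])
    qed
  qed
  then have r: "refines {..<p} (B_thr S t) Bs" by (rule props(3)[OF Bs_part])
  obtain i j where ij: "i < p" "j < p" and nB: "\<not> same_block (B_thr S t) i j" and gS: "g \<le> \<bar>Sg $$ (i, j)\<bar>"
    using gap_pair[OF props(1) r ne] by blast
  have "(g - \<tau>) / K \<le> \<bar>S $$ (i, j)\<bar> / K"
    using large_entry[OF ij gS] K by (intro divide_right_mono) auto
  then have "t < \<bar>corr_mat S $$ (i, j)\<bar>" using t corr_bounds(1)[OF ij] by linarith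
  then have "threshold t (corr_mat S) $$ (i, j) \<noteq> 0" using t(1) by (auto simp: threshold_index[OF ij])
  then have "same_block (B_thr S t) i j"
    using props(2) ij unfolding restrict_blocks_fixed_iff[OF threshold_carrier] by blast
  then show False using nB by contradiction
qed

lemma corr_out:
  assumes "i < p" "j < p" "\<not> same_block Bs i j"
  shows "\<bar>corr_mat S $$ (i, j)\<bar> \<le> \<tau> / c"
proof -
  have "\<bar>S $$ (i, j)\<bar> \<le> \<tau>" using close[OF assms(1,2)] Sg_zero[OF assms] by simp
  then have "\<bar>S $$ (i, j)\<bar> / c \<le> \<tau> / c" using c by (simp add: divide_right_mono)
  then show ?thesis using corr_bounds(2)[OF assms(1,2)] by linarith
qed

lemma B_thr_eq_window:
  assumes t: "\<tau> / c \<le> t" "t < (g - \<tau>) / K"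
  shows "B_thr S t = Bs"
proof (rule B_thr_eq)
  have "0 \<le> \<tau> / c" using tau c by simp
  then show "0 \<le> t" using t(1) by linarith
qed (use t corr_out order_trans in \<open>blast+\<close>)

text \<open>
  The threshold to take is the largest absolute correlation outside \<open>Bs\<close>; there is one
  because \<open>m < p\<close> prevents \<open>Bs\<close> from having a single block.
\<close>
lemma Bs_in_A_corr:
  assumes mp: "m < p" and w: "\<tau> / c < (g - \<tau>) / K"
  shows "Bs \<in> B_thr S ` A_corr S"
proof -
  define Out where "Out = {(i, j). i < j \<and> j < p \<and> \<not> same_block Bs i j}"
  have sub: "Out \<subseteq> {..<p} \<times> {..<p}" by (auto simp: Out_def)
  have finO: "finite Out" by (rule finite_subset[OF sub]) simp
  have O_ne: "Out \<noteq> {}"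
  proof
    assume O0: "Out = {}"
    have "0 \<in> \<Union>Bs" using partition_onD1[OF Bs_part] p by auto
    then obtain A where A: "A \<in> Bs" "0 \<in> A" by blast
    have "{..<p} \<subseteq> A"
    proof
      fix j assume "j \<in> {..<p}"
      then have j: "j < p" by simp
      have "same_block Bs 0 j" using O0 j same_block_refl[OF Bs_part p] by (cases "j = 0") (auto simp: Out_def)
      then show "j \<in> A" using same_block_iff_mem[OF Bs_part A] by blast
    qed
    moreover have "A \<subseteq> {..<p}" unfolding partition_onD1[OF Bs_part] using A(1) by blast
    ultimately have "A = {..<p}" by blast
    then show False using blocks[OF A(1)] mp by simp
  qed
  define t where "t = Max ((\<lambda>(i, j). \<bar>corr_mat S $$ (i, j)\<bar>) ` Out)"
  have t_in: "t \<in> (\<lambda>(i, j). \<bar>corr_mat S $$ (i, j)\<bar>) ` Out"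
    unfolding t_def using finO O_ne by (intro Max_in) auto
  then obtain i j where ij: "(i, j) \<in> Out" "t = \<bar>corr_mat S $$ (i, j)\<bar>" by auto
  have symc: "corr_mat S $$ (i, j) = corr_mat S $$ (j, i)" if "i < p" "j < p" for i j
    using that by (simp add: corr_index symS mult.commute)
  have out: "\<bar>corr_mat S $$ (i, j)\<bar> \<le> t" if ij: "i < p" "j < p" and n: "\<not> same_block Bs i j" for i j
  proof -
    have le: "\<bar>corr_mat S $$ (i, j)\<bar> \<le> t" if "(i, j) \<in> Out" for i j
      unfolding t_def using that finO by (intro Max_ge) auto
    have "i \<noteq> j" using n same_block_refl[OF Bs_part ij(1)] by auto
    then have "(i, j) \<in> Out \<or> (j, i) \<in> Out" using ij n same_block_sym[of Bs j i] by (auto simp: Out_def)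
    then show ?thesis using le[of i j] le[of j i] symc[OF ij] by auto
  qed
  have "t \<le> \<tau> / c" unfolding ij(2) by (rule corr_out) (use ij(1) in \<open>auto simp: Out_def\<close>)
  then have "B_thr S t = Bs" using out w ij(2) by (intro B_thr_eq) auto
  moreover have "t \<in> A_corr S" unfolding A_corr_def using ij S by (auto simp: Out_def)
  ultimately show ?thesis by blast
qed

text \<open>
  The window of good thresholds is longer than \<open>1/p\<close> and so contains a multiple of it. As
  the partition found there is \<open>Bs\<close>, with blocks of size at most \<open>m\<close>, this multiple is not
  below the starting point of the grid.
\<close>
lemma Bs_in_A_s:
  assumes w: "\<tau> / c + 1 / real p < (g - \<tau>) / K" and le1: "(g - \<tau>) / K \<le> 1"
  shows "Bs \<in> B_thr S ` A_s m S"
proof -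
  define k where "k = nat \<lceil>\<tau> / c * real p\<rceil>"
  have n0: "0 \<le> \<tau> / c * real p" using tau c by simp
  have k: "\<tau> / c * real p \<le> real k" "real k < \<tau> / c * real p + 1"
    using n0 unfolding k_def by linarith+
  have k1: "\<tau> / c \<le> real k / real p" using k(1) p by (simp add: field_simps)
  have "real k / real p < (\<tau> / c * real p + 1) / real p" using k(2) p by (intro divide_strict_right_mono) auto
  also have "\<dots> = \<tau> / c + 1 / real p" using p by (simp add: add_divide_distrib)
  finally have k2: "real k / real p < (g - \<tau>) / K" using w by linarith
  have eq: "B_thr S (real k / real p) = Bs" by (rule B_thr_eq_window[OF k1 k2])
  have "real k / real p < 1" using k2 le1 by linarith
  then have kp: "k \<le> p" using p by (simp add: field_simps)
  have dr: "dim_row S = p" using S by simp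
  have "s_min m S \<le> k" unfolding s_min_def dr by (rule Least_le) (use eq blocks in auto)
  then have "real k / real p \<in> A_s m S" unfolding A_s_def dr using kp by blast
  then show ?thesis using eq by blast
qed

lemma is_B_tot_restrict:
  assumes kap: "\<kappa> = k0 / real p" and B: "is_B_tot \<kappa> S B"
  shows "restrict_blocks B S = restrict_blocks Bs S"
proof (rule Psi_le_imp_restrict_eq[OF _ kap])
  have dr: "dim_row S = p" using S by simp
  show "partition_on {..<p} B" using B unfolding is_B_tot_def is_arg_min_def dr by blast
  show "Psi \<kappa> S B \<le> Psi \<kappa> S Bs" using B Bs_part unfolding is_B_tot_def is_arg_min_def dr by (meson not_le)
qed

lemma arg_min_thr_restrict:
  assumes kap: "\<kappa> = k0 / real p" and B: "is_arg_min (Psi \<kappa> S) (\<lambda>B. B \<in> B_thr S ` T) B" and Bs: "Bs \<in> B_thr S ` T"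
  shows "restrict_blocks B S = restrict_blocks Bs S"
proof (rule Psi_le_imp_restrict_eq[OF _ kap])
  show "partition_on {..<p} B" using B B_thr_props(1) unfolding is_arg_min_def by blast
  show "Psi \<kappa> S B \<le> Psi \<kappa> S Bs" using B Bs unfolding is_arg_min_def by (meson not_le)
qed

lemma estimators_restrict:
  assumes kap: "\<kappa> = k0 / real p" and mp: "m < p"
    and w: "\<tau> / c + 1 / real p < (g - \<tau>) / K" and le1: "(g - \<tau>) / K \<le> 1"
    and t: "\<tau> / c \<le> t" "t < (g - \<tau>) / K"
    and B: "is_B_tot \<kappa> S B \<or> is_B_corr \<kappa> S B \<or> B = B_thr S t \<or> is_B_s m \<kappa> S B"
  shows "restrict_blocks B S = restrict_blocks Bs S"
proof -
  have "\<tau> / c < (g - \<tau>) / K" using t by linarith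
  then show ?thesis
    using B is_B_tot_restrict[OF kap] arg_min_thr_restrict[OF kap _ Bs_in_A_corr[OF mp]]
      arg_min_thr_restrict[OF kap _ Bs_in_A_s[OF w le1]] B_thr_eq_window[OF t]
    unfolding is_B_corr_def is_B_s_def by blast
qed

end

section \<open>Gaussian integrals\<close>

lemma normal_density_zero_mean:
  assumes "0 < \<sigma>"
  shows "normal_density 0 \<sigma> x = exp (- (x\<^sup>2) / (2 * \<sigma>\<^sup>2)) / (\<sigma> * sqrt (2 * pi))"
  using assms by (simp add: normal_density_def real_sqrt_mult real_sqrt_mult_self)

lemma nn_integral_normal_density_1:
  assumes "0 < \<sigma>"
  shows "(\<integral>\<^sup>+x. ennreal (normal_density \<mu> \<sigma> x) \<partial>lborel) = 1"
  using assms by (subst nn_integral_eq_integral) (auto simp: integral_normal_density)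

text \<open>
  The centred normal law of variance \<open>s\<close> is determined by the density of its translates.
  Average the hypothesis over \<open>h \<in> [0, 1]\<close> and substitute \<open>t = x + h\<close>: this expresses \<open>\<nu>\<close>
  through Lebesgue measure in \<open>t\<close> with density \<open>exp (-t\<^sup>2/(2s)) C(t)\<close>, where \<open>C(t)\<close> is the
  \<open>\<nu>\<close>-integral of \<open>exp (x\<^sup>2/(2s))\<close> over \<open>[t - 1, t]\<close>. The hypothesis once more shows that \<open>C\<close>
  is constant, and the total mass fixes the constant.
\<close>
lemma gaussian_by_shift:
  fixes \<nu> :: "real measure"
  assumes prob: "prob_space \<nu>" and sets[measurable_cong]: "sets \<nu> = sets borel" and s: "0 < s"
    and shift: "\<And>g h. g \<in> borel_measurable borel \<Longrightarrow>
      (\<integral>\<^sup>+x. g x \<partial>\<nu>) = (\<integral>\<^sup>+x. g (x + h) * ennreal (exp (- (h * x) / s - h\<^sup>2 / (2 * s))) \<partial>\<nu>)"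
    and g[measurable]: "g \<in> borel_measurable borel"
  shows "(\<integral>\<^sup>+x. g x \<partial>\<nu>) = (\<integral>\<^sup>+x. ennreal (normal_density 0 (sqrt s) x) * g x \<partial>lborel)"
proof -
  interpret \<nu>: prob_space \<nu> by (rule prob)
  interpret pair: pair_sigma_finite lborel \<nu> by standard
  define C :: "real \<Rightarrow> ennreal" where
    "C = (\<lambda>t. \<integral>\<^sup>+x. indicator {0..1} (t - x) * ennreal (exp (x\<^sup>2 / (2 * s))) \<partial>\<nu>)"
  have C_const: "C t = C 0" for t
  proof -
    have "C t = (\<integral>\<^sup>+x. (indicator {0..1} (t - (x + t)) * ennreal (exp ((x + t)\<^sup>2 / (2 * s))))
        * ennreal (exp (- (t * x) / s - t\<^sup>2 / (2 * s))) \<partial>\<nu>)"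
      unfolding C_def by (rule shift) measurable
    also have "\<dots> = C 0"
      unfolding C_def
    proof (rule nn_integral_cong)
      fix x
      have "exp ((x + t)\<^sup>2 / (2 * s)) * exp (- (t * x) / s - t\<^sup>2 / (2 * s)) = exp (x\<^sup>2 / (2 * s))"
        unfolding exp_add[symmetric] using s by (simp add: field_simps power2_eq_square)
      then show "(indicator {0..1} (t - (x + t)) * ennreal (exp ((x + t)\<^sup>2 / (2 * s))))
          * ennreal (exp (- (t * x) / s - t\<^sup>2 / (2 * s)))
        = indicator {0..1} (0 - x) * ennreal (exp (x\<^sup>2 / (2 * s)))"
        by (simp add: mult.assoc flip: ennreal_mult')
    qed
    finally show ?thesis .
  qed
  define c where "c = C 0 * ennreal (sqrt s * sqrt (2 * pi))"
  have main: "(\<integral>\<^sup>+x. g x \<partial>\<nu>) = c * (\<integral>\<^sup>+t. ennreal (normal_density 0 (sqrt s) t) * g t \<partial>lborel)"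
    if g[measurable]: "g \<in> borel_measurable borel" for g
  proof -
    have "(\<integral>\<^sup>+x. g x \<partial>\<nu>) = (\<integral>\<^sup>+h. (\<integral>\<^sup>+x. g x \<partial>\<nu>) * indicator {0..1::real} h \<partial>lborel)"
      by (simp add: nn_integral_cmult)
    also have "\<dots> = (\<integral>\<^sup>+h. (\<integral>\<^sup>+x. (g (x + h) * ennreal (exp (- (h * x) / s - h\<^sup>2 / (2 * s)))) * indicator {0..1} h \<partial>\<nu>) \<partial>lborel)"
    proof (rule nn_integral_cong)
      fix h
      have "(\<integral>\<^sup>+x. (g (x + h) * ennreal (exp (- (h * x) / s - h\<^sup>2 / (2 * s)))) * indicator {0..1} h \<partial>\<nu>)
        = (\<integral>\<^sup>+x. g (x + h) * ennreal (exp (- (h * x) / s - h\<^sup>2 / (2 * s))) \<partial>\<nu>) * indicator {0..1} h"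
        by (rule nn_integral_multc) measurable
      then show "(\<integral>\<^sup>+x. g x \<partial>\<nu>) * indicator {0..1} h
        = (\<integral>\<^sup>+x. (g (x + h) * ennreal (exp (- (h * x) / s - h\<^sup>2 / (2 * s)))) * indicator {0..1} h \<partial>\<nu>)"
        using shift[OF g, of h] by simp
    qed
    also have "\<dots> = (\<integral>\<^sup>+x. (\<integral>\<^sup>+h. (g (x + h) * ennreal (exp (- (h * x) / s - h\<^sup>2 / (2 * s)))) * indicator {0..1} h \<partial>lborel) \<partial>\<nu>)"
      by (rule pair.Fubini'[symmetric]) measurable
    also have "\<dots> = (\<integral>\<^sup>+x. (\<integral>\<^sup>+t. (g t * ennreal (exp (- (t\<^sup>2) / (2 * s)))) * (indicator {0..1} (t - x) * ennreal (exp (x\<^sup>2 / (2 * s)))) \<partial>lborel) \<partial>\<nu>)"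
    proof (rule nn_integral_cong)
      fix x
      have "(\<integral>\<^sup>+h. (g (x + h) * ennreal (exp (- (h * x) / s - h\<^sup>2 / (2 * s)))) * indicator {0..1} h \<partial>lborel)
        = (\<integral>\<^sup>+t. (g (x + (- x + 1 * t)) * ennreal (exp (- ((- x + 1 * t) * x) / s - (- x + 1 * t)\<^sup>2 / (2 * s)))) * indicator {0..1} (- x + 1 * t) \<partial>lborel)"
        by (subst nn_integral_real_affine[where c = 1 and t = "- x"]) auto
      also have "\<dots> = (\<integral>\<^sup>+t. (g t * ennreal (exp (- (t\<^sup>2) / (2 * s)))) * (indicator {0..1} (t - x) * ennreal (exp (x\<^sup>2 / (2 * s)))) \<partial>lborel)"
      proof (rule nn_integral_cong)
        fix t
        have "exp (- ((- x + t) * x) / s - (- x + t)\<^sup>2 / (2 * s)) = exp (- (t\<^sup>2) / (2 * s)) * exp (x\<^sup>2 / (2 * s))"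
          unfolding exp_add[symmetric] using s by (simp add: field_simps power2_eq_square)
        then show "(g (x + (- x + 1 * t)) * ennreal (exp (- ((- x + 1 * t) * x) / s - (- x + 1 * t)\<^sup>2 / (2 * s)))) * indicator {0..1} (- x + 1 * t)
          = (g t * ennreal (exp (- (t\<^sup>2) / (2 * s)))) * (indicator {0..1} (t - x) * ennreal (exp (x\<^sup>2 / (2 * s))))"
          by (simp add: ennreal_mult mult_ac)
      qed
      finally show "(\<integral>\<^sup>+h. (g (x + h) * ennreal (exp (- (h * x) / s - h\<^sup>2 / (2 * s)))) * indicator {0..1} h \<partial>lborel)
        = (\<integral>\<^sup>+t. (g t * ennreal (exp (- (t\<^sup>2) / (2 * s)))) * (indicator {0..1} (t - x) * ennreal (exp (x\<^sup>2 / (2 * s)))) \<partial>lborel)" .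
    qed
    also have "\<dots> = (\<integral>\<^sup>+t. (\<integral>\<^sup>+x. (g t * ennreal (exp (- (t\<^sup>2) / (2 * s)))) * (indicator {0..1} (t - x) * ennreal (exp (x\<^sup>2 / (2 * s)))) \<partial>\<nu>) \<partial>lborel)"
      by (rule pair.Fubini') measurable
    also have "\<dots> = (\<integral>\<^sup>+t. (g t * ennreal (exp (- (t\<^sup>2) / (2 * s)))) * C t \<partial>lborel)"
      unfolding C_def by (intro nn_integral_cong nn_integral_cmult) measurable
    also have "\<dots> = (\<integral>\<^sup>+t. C 0 * ennreal (sqrt s * sqrt (2 * pi)) * (ennreal (normal_density 0 (sqrt s) t) * g t) \<partial>lborel)"
    proof (rule nn_integral_cong)
      fix t
      have "exp (- (t\<^sup>2) / (2 * s)) = (sqrt s * sqrt (2 * pi)) * normal_density 0 (sqrt s) t"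
        using s by (simp add: normal_density_zero_mean)
      then show "(g t * ennreal (exp (- (t\<^sup>2) / (2 * s)))) * C t
         = C 0 * ennreal (sqrt s * sqrt (2 * pi)) * (ennreal (normal_density 0 (sqrt s) t) * g t)"
        unfolding C_const[of t] using s by (simp add: ennreal_mult mult_ac)
    qed
    also have "\<dots> = c * (\<integral>\<^sup>+t. ennreal (normal_density 0 (sqrt s) t) * g t \<partial>lborel)"
      unfolding c_def by (rule nn_integral_cmult) measurable
    finally show ?thesis .
  qed
  have "1 = (\<integral>\<^sup>+x. 1 \<partial>\<nu>)" by (simp add: \<nu>.emeasure_space_1)
  also have "\<dots> = c * (\<integral>\<^sup>+t. ennreal (normal_density 0 (sqrt s) t) * 1 \<partial>lborel)"
    by (rule main) measurable
  also have "\<dots> = c" using s by (simp add: nn_integral_normal_density_1)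
  finally show ?thesis using main[OF g] by simp
qed

lemma nn_integral_normal_exp_square:
  assumes \<sigma>: "0 < \<sigma>" and a: "2 * a * \<sigma>\<^sup>2 < 1"
  shows "(\<integral>\<^sup>+x. ennreal (normal_density 0 \<sigma> x) * ennreal (exp (a * x\<^sup>2)) \<partial>lborel) = ennreal (1 / sqrt (1 - 2 * a * \<sigma>\<^sup>2))"
proof -
  define r where "r = sqrt (1 - 2 * a * \<sigma>\<^sup>2)"
  have r: "0 < r" and r2: "r\<^sup>2 = 1 - 2 * a * \<sigma>\<^sup>2" using a by (simp_all add: r_def)
  have e: "normal_density 0 \<sigma> x * exp (a * x\<^sup>2) = 1 / r * normal_density 0 (\<sigma> / r) x" for x
  proof -
    have "- (x\<^sup>2) / (2 * \<sigma>\<^sup>2) + a * x\<^sup>2 = - (x\<^sup>2 * r\<^sup>2) / (2 * \<sigma>\<^sup>2)"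
      unfolding r2 using \<sigma> by (simp add: field_simps)
    also have "\<dots> = - (x\<^sup>2) / (2 * (\<sigma> / r)\<^sup>2)" using r by (simp add: power_divide)
    finally have "exp (- (x\<^sup>2) / (2 * \<sigma>\<^sup>2)) * exp (a * x\<^sup>2) = exp (- (x\<^sup>2) / (2 * (\<sigma> / r)\<^sup>2))"
      by (simp flip: exp_add)
    then show ?thesis
      using \<sigma> r by (simp add: normal_density_zero_mean)
  qed
  have "(\<integral>\<^sup>+x. ennreal (normal_density 0 \<sigma> x) * ennreal (exp (a * x\<^sup>2)) \<partial>lborel)
    = (\<integral>\<^sup>+x. ennreal (1 / r) * ennreal (normal_density 0 (\<sigma> / r) x) \<partial>lborel)"
    using r by (intro nn_integral_cong) (simp add: e flip: ennreal_mult)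
  also have "\<dots> = ennreal (1 / r)"
    using \<sigma> r by (subst nn_integral_cmult) (auto simp: nn_integral_normal_density_1)
  finally show ?thesis by (simp add: r_def)
qed

lemma nn_integral_normal_exp_linear:
  assumes \<sigma>: "0 < \<sigma>"
  shows "(\<integral>\<^sup>+x. ennreal (normal_density 0 \<sigma> x) * ennreal (exp (t * x)) \<partial>lborel) = ennreal (exp (t\<^sup>2 * \<sigma>\<^sup>2 / 2))"
proof -
  have e: "normal_density 0 \<sigma> x * exp (t * x) = exp (t\<^sup>2 * \<sigma>\<^sup>2 / 2) * normal_density (t * \<sigma>\<^sup>2) \<sigma> x" for x
  proof -
    have "- (x\<^sup>2) / (2 * \<sigma>\<^sup>2) + t * x = t\<^sup>2 * \<sigma>\<^sup>2 / 2 + - ((x - t * \<sigma>\<^sup>2)\<^sup>2) / (2 * \<sigma>\<^sup>2)"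
      using \<sigma> by (simp add: field_simps power2_eq_square)
    then show ?thesis unfolding normal_density_def by (simp flip: exp_add)
  qed
  have "(\<integral>\<^sup>+x. ennreal (normal_density 0 \<sigma> x) * ennreal (exp (t * x)) \<partial>lborel)
    = (\<integral>\<^sup>+x. ennreal (exp (t\<^sup>2 * \<sigma>\<^sup>2 / 2)) * ennreal (normal_density (t * \<sigma>\<^sup>2) \<sigma> x) \<partial>lborel)"
    by (intro nn_integral_cong) (simp add: e flip: ennreal_mult)
  also have "\<dots> = ennreal (exp (t\<^sup>2 * \<sigma>\<^sup>2 / 2))"
    using \<sigma> by (subst nn_integral_cmult) (auto simp: nn_integral_normal_density_1)
  finally show ?thesis .
qed

text \<open>
  The normal density is at most \<open>1/(\<sigma> \<surd>(2\<pi>))\<close>, and the remaining factor is a Gaussian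
  integral. The bound is uniform in the centre \<open>c\<close>.
\<close>
lemma nn_integral_normal_small_ball:
  assumes \<sigma>: "0 < \<sigma>" and \<theta>: "0 < \<theta>"
  shows "(\<integral>\<^sup>+x. ennreal (normal_density 0 \<sigma> x) * ennreal (exp (- \<theta> * (x - c)\<^sup>2)) \<partial>lborel) \<le> ennreal (1 / (\<sigma> * sqrt (2 * \<theta>)))"
proof -
  define \<tau> where "\<tau> = 1 / sqrt (2 * \<theta>)"
  have \<tau>: "0 < \<tau>" and \<tau>2: "\<tau>\<^sup>2 = 1 / (2 * \<theta>)" using \<theta> by (simp_all add: \<tau>_def power_divide)
  have e: "normal_density 0 \<sigma> x * exp (- \<theta> * (x - c)\<^sup>2) \<le> \<tau> / \<sigma> * normal_density c \<tau> x" for x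
  proof -
    have "normal_density 0 \<sigma> x \<le> 1 / (\<sigma> * sqrt (2 * pi))"
      using \<sigma> by (simp add: normal_density_zero_mean divide_right_mono)
    then have "normal_density 0 \<sigma> x * exp (- \<theta> * (x - c)\<^sup>2) \<le> 1 / (\<sigma> * sqrt (2 * pi)) * exp (- \<theta> * (x - c)\<^sup>2)"
      by (rule mult_right_mono) simp
    also have "\<dots> = 1 / (\<sigma> * sqrt (2 * pi)) * exp (- ((x - c)\<^sup>2) / (2 * \<tau>\<^sup>2))" unfolding \<tau>2 using \<theta> by simp
    also have "1 / (\<sigma> * sqrt (2 * pi)) * exp (- ((x - c)\<^sup>2) / (2 * \<tau>\<^sup>2)) = \<tau> / \<sigma> * normal_density c \<tau> x"
      using \<sigma> \<tau> by (simp add: normal_density_def real_sqrt_mult)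
    finally show ?thesis .
  qed
  have "(\<integral>\<^sup>+x. ennreal (normal_density 0 \<sigma> x) * ennreal (exp (- \<theta> * (x - c)\<^sup>2)) \<partial>lborel)
    \<le> (\<integral>\<^sup>+x. ennreal (\<tau> / \<sigma>) * ennreal (normal_density c \<tau> x) \<partial>lborel)"
    using \<sigma> \<tau> e by (intro nn_integral_mono) (simp add: ennreal_leI flip: ennreal_mult)
  also have "\<dots> = ennreal (\<tau> / \<sigma>)"
    using \<tau> by (subst nn_integral_cmult) (auto simp: nn_integral_normal_density_1)
  also have "\<tau> / \<sigma> = 1 / (\<sigma> * sqrt (2 * \<theta>))" by (simp add: \<tau>_def)
  finally show ?thesis .
qed

lemma nn_integral_PiM_lborel_shift:
  fixes f :: "('i \<Rightarrow> real) \<Rightarrow> ennreal"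
  assumes I: "finite I" and f[measurable]: "f \<in> borel_measurable (\<Pi>\<^sub>M i\<in>I. lborel)"
  shows "(\<integral>\<^sup>+x. f x \<partial>(\<Pi>\<^sub>M i\<in>I. lborel)) = (\<integral>\<^sup>+x. f (\<lambda>i\<in>I. x i + v i) \<partial>(\<Pi>\<^sub>M i\<in>I. lborel))"
proof -
  interpret product_sigma_finite "\<lambda>_::'i. lborel :: real measure" by standard
  let ?P = "\<Pi>\<^sub>M i\<in>I. (lborel :: real measure)"
  let ?T = "\<lambda>x. \<lambda>i\<in>I. x i + v i"
  have T[measurable]: "?T \<in> measurable ?P ?P" by measurable
  have "distr ?P ?P ?T = ?P"
  proof (rule PiM_eqI[OF I])
    fix A assume A: "\<And>i. i \<in> I \<Longrightarrow> A i \<in> sets (lborel :: real measure)"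
    have Bm: "(\<lambda>x. x + v i) -` A i \<in> sets lborel" if "i \<in> I" for i
    proof -
      have "(\<lambda>x. x + v i) -` A i \<inter> space lborel \<in> sets lborel"
        by (rule measurable_sets[OF _ A[OF that]]) measurable
      then show ?thesis by simp
    qed
    have "emeasure (distr ?P ?P ?T) (Pi\<^sub>E I A) = emeasure ?P (?T -` Pi\<^sub>E I A \<inter> space ?P)"
      using A I by (intro emeasure_distr T sets_PiM_I_finite) auto
    also have "?T -` Pi\<^sub>E I A \<inter> space ?P = Pi\<^sub>E I (\<lambda>i. (\<lambda>x. x + v i) -` A i)"
      by (auto simp: space_PiM PiE_iff extensional_def)
    also have "emeasure ?P \<dots> = (\<Prod>i\<in>I. emeasure lborel ((\<lambda>x. x + v i) -` A i))"
      by (rule emeasure_PiM[OF I Bm])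
    also have "\<dots> = (\<Prod>i\<in>I. emeasure lborel (A i))"
    proof (rule prod.cong[OF refl])
      fix i assume i: "i \<in> I"
      have "emeasure lborel (A i) = emeasure (distr lborel borel ((+) (v i))) (A i)"
        by (simp add: lborel_distr_plus)
      also have "\<dots> = emeasure lborel ((+) (v i) -` A i \<inter> space lborel)"
        using A[OF i] by (intro emeasure_distr) auto
      also have "(+) (v i) -` A i \<inter> space lborel = (\<lambda>x. x + v i) -` A i"
        by (auto simp: add.commute)
      finally show "emeasure lborel ((\<lambda>x. x + v i) -` A i) = emeasure lborel (A i)" ..
    qed
    finally show "emeasure (distr ?P ?P ?T) (Pi\<^sub>E I A) = (\<Prod>i\<in>I. emeasure lborel (A i))" .
  qed simp
  then have "(\<integral>\<^sup>+x. f x \<partial>?P) = (\<integral>\<^sup>+x. f x \<partial>(distr ?P ?P ?T))" by simp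
  also have "\<dots> = (\<integral>\<^sup>+x. f (?T x) \<partial>?P)" by (rule nn_integral_distr) measurable
  finally show ?thesis .
qed

lemma neg_ln_one_minus_upper:
  fixes x :: real assumes "\<bar>x\<bar> \<le> 1 / 2"
  shows "- ln (1 - x) - x \<le> 2 * x\<^sup>2"
  using abs_ln_one_plus_x_minus_x_bound[of "- x"] assms by (auto simp: abs_le_iff)

lemma neg_ln_one_minus_lower:
  fixes x :: real assumes "0 \<le> x" "x < 1"
  shows "x\<^sup>2 / 2 \<le> - ln (1 - x) - x"
proof -
  let ?f = "\<lambda>x::real. - ln (1 - x) - x - x\<^sup>2 / 2"
  have "?f 0 \<le> ?f x"
  proof (rule DERIV_nonneg_imp_nondecreasing[OF assms(1)])
    fix y assume y: "0 \<le> y" "y \<le> x"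
    then have y1: "y < 1" using assms by simp
    have "(?f has_real_derivative (1 / (1 - y) - 1 - y)) (at y)"
      using y1 by (auto intro!: derivative_eq_intros simp: field_simps power2_eq_square)
    moreover have "0 \<le> 1 / (1 - y) - 1 - y"
    proof -
      have "1 / (1 - y) - 1 - y = y\<^sup>2 / (1 - y)" using y1 by (simp add: field_simps power2_eq_square)
      then show ?thesis using y1 by simp
    qed
    ultimately show "\<exists>d. (?f has_real_derivative d) (at y) \<and> 0 \<le> d" by blast
  qed
  then show ?thesis by simp
qed

section \<open>Linear functionals of a Gaussian sample\<close>

lemma mvn_density_quad:
  assumes mu: "\<mu> \<in> carrier_vec p" and R: "minv Sig \<in> carrier_mat p p"
  shows "mvn_density p \<mu> Sig x = exp (- quad (minv Sig) (\<lambda>i. x i - vec_index \<mu> i) / 2) / sqrt ((2 * pi) ^ p * Determinant.det Sig)"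
proof -
  have c: "Matrix.vec p x - \<mu> \<in> carrier_vec p" using mu by simp
  have "scalar_prod (Matrix.vec p x - \<mu>) (minv Sig *\<^sub>v (Matrix.vec p x - \<mu>)) = quad (minv Sig) (\<lambda>i. x i - vec_index \<mu> i)"
    unfolding scalar_prod_quad[OF R c] using mu by (intro quad_cong[OF R]) auto
  then show ?thesis unfolding mvn_density_def by simp
qed

text \<open>
  Translation by \<open>h \<Sigma>w/s\<close> multiplies the density by a function of \<open>\<langle>w, x - \<mu>\<rangle>\<close> alone, since
  \<open>\<Sigma>\<^sup>-\<^sup>1 \<Sigma>w = w\<close>; at the same time it moves \<open>\<langle>w, x - \<mu>\<rangle>\<close> by exactly \<open>h\<close>.
\<close>
lemma mvn_density_shift:
  assumes mu: "\<mu> \<in> carrier_vec p" and Sig: "Sig \<in> carrier_mat p p" and spd: "sym_pos_def Sig"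
    and s: "s = quad Sig w" "0 < s"
  shows "mvn_density p \<mu> Sig (\<lambda>i\<in>{..<p}. x i + h * ((\<Sum>j<p. Sig $$ (i, j) * w j) / s))
    = mvn_density p \<mu> Sig x * exp (- (h * (\<Sum>i<p. w i * (x i - vec_index \<mu> i))) / s - h\<^sup>2 / (2 * s))"
proof -
  define R where "R = minv Sig"
  have d: "Determinant.det Sig \<noteq> 0" by (rule sym_pos_def_det_nz[OF spd Sig])
  note inv = minv_inverse[OF Sig d, folded R_def]
  have symR: "R $$ (k, l) = R $$ (l, k)" if "k < p" "l < p" for k l
    using minv_sym[OF Sig d _ that] spd unfolding sym_pos_def_def R_def by simp
  define v where "v = (\<lambda>i. (\<Sum>j<p. Sig $$ (i, j) * w j) / s)"
  define y where "y = (\<lambda>i. x i - vec_index \<mu> i)"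
  have Rv: "(\<Sum>j<p. R $$ (i, j) * v j) = w i / s" if i: "i < p" for i
  proof -
    have "(\<Sum>j<p. R $$ (i, j) * v j) = (\<Sum>j<p. \<Sum>l<p. R $$ (i, j) * Sig $$ (j, l) * w l) / s"
      by (simp add: v_def sum_distrib_left sum_divide_distrib mult.assoc)
    also have "(\<Sum>j<p. \<Sum>l<p. R $$ (i, j) * Sig $$ (j, l) * w l) = (\<Sum>l<p. (R * Sig) $$ (i, l) * w l)"
      by (subst sum.swap) (auto simp: index_mult_sum[OF inv(3) Sig i] sum_distrib_right
            simp del: index_mult_mat intro!: sum.cong)
    also have "\<dots> = (\<Sum>l<p. if l = i then w l else 0)"
      unfolding inv(2) using i by (intro sum.cong) auto
    finally show ?thesis using i by (simp add: sum.delta)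
  qed
  have b1: "(\<Sum>i<p. \<Sum>j<p. f i * R $$ (i, j) * v j) = (\<Sum>i<p. w i * f i) / s" for f
  proof -
    have "(\<Sum>i<p. \<Sum>j<p. f i * R $$ (i, j) * v j) = (\<Sum>i<p. f i * (\<Sum>j<p. R $$ (i, j) * v j))"
      by (simp add: sum_distrib_left mult.assoc)
    also have "\<dots> = (\<Sum>i<p. f i * (w i / s))" by (intro sum.cong) (auto simp: Rv)
    finally show ?thesis by (simp add: sum_divide_distrib mult.commute)
  qed
  have b2: "(\<Sum>i<p. \<Sum>j<p. v i * R $$ (i, j) * f j) = (\<Sum>i<p. w i * f i) / s" for f
  proof -
    have "(\<Sum>i<p. \<Sum>j<p. v i * R $$ (i, j) * f j) = (\<Sum>j<p. \<Sum>i<p. f j * R $$ (j, i) * v i)"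
      by (subst sum.swap) (auto simp: symR intro!: sum.cong)
    then show ?thesis using b1 by simp
  qed
  have wv: "(\<Sum>i<p. w i * v i) = 1"
  proof -
    have "(\<Sum>i<p. w i * v i) = quad Sig w / s"
      unfolding quad_carrier[OF Sig] v_def by (simp add: sum_distrib_left sum_divide_distrib mult.assoc)
    then show ?thesis using s by simp
  qed
  have "quad R (\<lambda>i. y i + h * v i) = (\<Sum>i<p. \<Sum>j<p. y i * R $$ (i, j) * y j + h * (y i * R $$ (i, j) * v j)
      + h * (v i * R $$ (i, j) * y j) + h\<^sup>2 * (v i * R $$ (i, j) * v j))"
    unfolding quad_carrier[OF inv(3)] by (intro sum.cong refl) (simp add: algebra_simps power2_eq_square)
  also have "\<dots> = quad R y + h * (\<Sum>i<p. \<Sum>j<p. y i * R $$ (i, j) * v j)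
      + h * (\<Sum>i<p. \<Sum>j<p. v i * R $$ (i, j) * y j) + h\<^sup>2 * (\<Sum>i<p. \<Sum>j<p. v i * R $$ (i, j) * v j)"
    unfolding quad_carrier[OF inv(3)] by (simp only: sum.distrib sum_distrib_left)
  also have "\<dots> = quad R y + 2 * (h * (\<Sum>i<p. w i * y i) / s) + h\<^sup>2 / s"
    unfolding b1 b2 wv by simp
  finally have q: "quad R (\<lambda>i. y i + h * v i) = quad R y + 2 * (h * (\<Sum>i<p. w i * y i) / s) + h\<^sup>2 / s" .
  have q': "quad R (\<lambda>i. (\<lambda>i\<in>{..<p}. x i + h * v i) i - vec_index \<mu> i) = quad R (\<lambda>i. y i + h * v i)"
    by (rule quad_cong[OF inv(3)]) (auto simp: y_def)
  have "exp (- quad R (\<lambda>i. (\<lambda>i\<in>{..<p}. x i + h * v i) i - vec_index \<mu> i) / 2)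
      = exp (- quad R y / 2) * exp (- (h * (\<Sum>i<p. w i * y i)) / s - h\<^sup>2 / (2 * s))"
    unfolding q' q exp_add[symmetric] using s(2) by (simp add: field_simps)
  then show ?thesis
    unfolding mvn_density_quad[OF mu inv(3)[unfolded R_def]] R_def[symmetric] by (simp add: v_def y_def)
qed

text \<open>
  One sample size of the model, with \<open>lo\<close> and \<open>hi\<close> bounding the spectrum of \<open>\<Sigma>\<close>.
\<close>
locale gauss_sample = prob_space M for M :: "'w measure" +
  fixes p n :: nat and \<mu> :: "real Matrix.vec" and Sig :: "real Matrix.mat"
    and X :: "nat \<Rightarrow> 'w \<Rightarrow> nat \<Rightarrow> real" and lo hi :: real
  assumes mu: "\<mu> \<in> carrier_vec p" and Sig: "Sig \<in> carrier_mat p p" and spd: "sym_pos_def Sig"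
    and iid: "iid_mvn M p n \<mu> Sig X" and lo: "0 < lo" and n: "0 < n" and p: "0 < p"
    and quad_lower: "\<And>u. lo * (\<Sum>i<p. (u i)\<^sup>2) \<le> quad Sig u"
    and quad_upper: "\<And>u. quad Sig u \<le> hi * (\<Sum>i<p. (u i)\<^sup>2)"
begin

definition proj :: "(nat \<Rightarrow> real) \<Rightarrow> nat \<Rightarrow> 'w \<Rightarrow> real" where
  "proj w l \<omega> = (\<Sum>i<p. w i * (X l \<omega> i - vec_index \<mu> i))"

lemma X_distributed: "l \<in> {1..n} \<Longrightarrow> distributed M (\<Pi>\<^sub>M i\<in>{..<p}. lborel) (X l) (\<lambda>x. ennreal (mvn_density p \<mu> Sig x))"
  using iid unfolding iid_mvn_def by blast

lemma X_measurable: "l \<in> {1..n} \<Longrightarrow> X l \<in> measurable M (\<Pi>\<^sub>M i\<in>{..<p}. lborel)"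
  using X_distributed unfolding distributed_def by blast

lemma lin_measurable:
  "(\<lambda>x. \<Sum>i<p. w i * (x i - vec_index \<mu> i)) \<in> borel_measurable (\<Pi>\<^sub>M i\<in>{..<p}. lborel)"
  by measurable

lemma proj_measurable: "l \<in> {1..n} \<Longrightarrow> proj w l \<in> borel_measurable M"
  unfolding proj_def using measurable_compose[OF X_measurable lin_measurable] .

lemma quad_pos: "i < p \<Longrightarrow> w i \<noteq> 0 \<Longrightarrow> 0 < quad Sig w"
  by (rule sym_pos_def_quad_pos[OF spd Sig])

text \<open>
  The translation of the density turns into the hypothesis of \<open>gaussian_by_shift\<close> for the
  law of \<open>\<langle>w, X\<^sub>l - \<mu>\<rangle>\<close>.
\<close>
lemma nn_integral_proj:
  assumes l: "l \<in> {1..n}" and s: "0 < quad Sig w" and g: "g \<in> borel_measurable borel"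
  shows "(\<integral>\<^sup>+\<omega>. g (proj w l \<omega>) \<partial>M) = (\<integral>\<^sup>+x. ennreal (normal_density 0 (sqrt (quad Sig w)) x) * g x \<partial>lborel)"
proof -
  let ?P = "\<Pi>\<^sub>M i\<in>{..<p}. (lborel :: real measure)"
  let ?L = "\<lambda>x. \<Sum>i<p. w i * (x i - vec_index \<mu> i)"
  let ?f = "\<lambda>x. ennreal (mvn_density p \<mu> Sig x)"
  define s' where "s' = quad Sig w"
  define v where "v = (\<lambda>i. (\<Sum>j<p. Sig $$ (i, j) * w j) / s')"
  note dist = X_distributed[OF l]
  have fm[measurable]: "?f \<in> borel_measurable ?P" using dist unfolding distributed_def by blast
  note pm[measurable] = proj_measurable[OF l, of w]
  note lm[measurable] = lin_measurable[of w]
  have push: "(\<integral>\<^sup>+\<omega>. G (proj w l \<omega>) \<partial>M) = (\<integral>\<^sup>+x. ?f x * G (?L x) \<partial>?P)" if G[measurable]: "G \<in> borel_measurable borel" for G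
    unfolding proj_def by (rule distributed_nn_integral[OF dist, symmetric]) measurable
  have wv: "(\<Sum>i<p. w i * v i) = 1"
  proof -
    have "(\<Sum>i<p. w i * v i) = quad Sig w / s'"
      unfolding quad_carrier[OF Sig] v_def by (simp add: sum_distrib_left sum_divide_distrib mult.assoc)
    then show ?thesis using s by (simp add: s'_def)
  qed
  have shift: "(\<integral>\<^sup>+\<omega>. G (proj w l \<omega>) \<partial>M)
     = (\<integral>\<^sup>+\<omega>. G (proj w l \<omega> + h) * ennreal (exp (- (h * proj w l \<omega>) / s' - h\<^sup>2 / (2 * s'))) \<partial>M)"
    if G[measurable]: "G \<in> borel_measurable borel" for G h
  proof -
    have "(\<integral>\<^sup>+\<omega>. G (proj w l \<omega>) \<partial>M) = (\<integral>\<^sup>+x. ?f x * G (?L x) \<partial>?P)" by (rule push[OF G])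
    also have "\<dots> = (\<integral>\<^sup>+x. ?f (\<lambda>i\<in>{..<p}. x i + h * v i) * G (?L (\<lambda>i\<in>{..<p}. x i + h * v i)) \<partial>?P)"
      by (rule nn_integral_PiM_lborel_shift) (simp, measurable)
    also have "\<dots> = (\<integral>\<^sup>+x. ?f x * (G (?L x + h) * ennreal (exp (- (h * ?L x) / s' - h\<^sup>2 / (2 * s')))) \<partial>?P)"
    proof (intro nn_integral_cong)
      fix x
      have "?L (\<lambda>i\<in>{..<p}. x i + h * v i) = (\<Sum>i<p. w i * (x i - vec_index \<mu> i) + h * (w i * v i))"
        by (intro sum.cong refl) (simp add: algebra_simps)
      also have "\<dots> = ?L x + h * (\<Sum>i<p. w i * v i)" by (simp only: sum.distrib sum_distrib_left)
      finally have L: "?L (\<lambda>i\<in>{..<p}. x i + h * v i) = ?L x + h" unfolding wv by simp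
      have f: "mvn_density p \<mu> Sig (\<lambda>i\<in>{..<p}. x i + h * v i)
         = mvn_density p \<mu> Sig x * exp (- (h * ?L x) / s' - h\<^sup>2 / (2 * s'))"
        unfolding v_def by (rule mvn_density_shift[OF mu Sig spd s'_def]) (use s in \<open>simp add: s'_def\<close>)
      have f0: "0 \<le> mvn_density p \<mu> Sig x"
        unfolding mvn_density_def using sym_pos_def_det_pos[OF spd Sig] by simp
      show "?f (\<lambda>i\<in>{..<p}. x i + h * v i) * G (?L (\<lambda>i\<in>{..<p}. x i + h * v i))
        = ?f x * (G (?L x + h) * ennreal (exp (- (h * ?L x) / s' - h\<^sup>2 / (2 * s'))))"
        unfolding L f using f0 by (simp add: ennreal_mult mult_ac)
    qed
    also have "\<dots> = (\<integral>\<^sup>+\<omega>. G (proj w l \<omega> + h) * ennreal (exp (- (h * proj w l \<omega>) / s' - h\<^sup>2 / (2 * s'))) \<partial>M)"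
      by (rule push[symmetric]) measurable
    finally show ?thesis .
  qed
  have "(\<integral>\<^sup>+x. g x \<partial>(distr M borel (proj w l))) = (\<integral>\<^sup>+x. ennreal (normal_density 0 (sqrt s') x) * g x \<partial>lborel)"
  proof (rule gaussian_by_shift)
    show "prob_space (distr M borel (proj w l))" by (rule prob_space_distr) measurable
    show "0 < s'" using s by (simp add: s'_def)
    fix G :: "real \<Rightarrow> ennreal" and h assume G[measurable]: "G \<in> borel_measurable borel"
    show "(\<integral>\<^sup>+x. G x \<partial>(distr M borel (proj w l)))
      = (\<integral>\<^sup>+x. G (x + h) * ennreal (exp (- (h * x) / s' - h\<^sup>2 / (2 * s'))) \<partial>(distr M borel (proj w l)))"
      by (subst (1 2) nn_integral_distr) (measurable, rule shift[OF G])
  qed (use g in auto)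
  then show ?thesis using g by (subst (asm) nn_integral_distr) (auto simp: s'_def)
qed

lemma nn_integral_proj_prod:
  assumes s: "0 < quad Sig w" and g[measurable]: "g \<in> borel_measurable borel"
  shows "(\<integral>\<^sup>+\<omega>. (\<Prod>l\<in>{1..n}. g (proj w l \<omega>)) \<partial>M)
    = (\<integral>\<^sup>+x. ennreal (normal_density 0 (sqrt (quad Sig w)) x) * g x \<partial>lborel) ^ n"
proof -
  have ind: "indep_vars (\<lambda>_. \<Pi>\<^sub>M i\<in>{..<p}. (lborel :: real measure)) X {1..n}"
    using iid unfolding iid_mvn_def by blast
  note lm[measurable] = lin_measurable[of w]
  have "indep_vars (\<lambda>_. borel) (\<lambda>l \<omega>. g (\<Sum>i<p. w i * (X l \<omega> i - vec_index \<mu> i))) {1..n}"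
    by (rule indep_vars_compose2[OF ind]) measurable
  then have "indep_vars (\<lambda>_. borel) (\<lambda>l \<omega>. g (proj w l \<omega>)) {1..n}" unfolding proj_def .
  then have "(\<integral>\<^sup>+\<omega>. (\<Prod>l\<in>{1..n}. g (proj w l \<omega>)) \<partial>M) = (\<Prod>l\<in>{1..n}. \<integral>\<^sup>+\<omega>. g (proj w l \<omega>) \<partial>M)"
    by (intro indep_vars_nn_integral) auto
  also have "\<dots> = (\<Prod>l\<in>{1..n}. \<integral>\<^sup>+x. ennreal (normal_density 0 (sqrt (quad Sig w)) x) * g x \<partial>lborel)"
    by (intro prod.cong refl nn_integral_proj s g)
  finally show ?thesis by simp
qed

lemma nn_integral_exp_sum:
  assumes s: "0 < quad Sig w" and f[measurable]: "f \<in> borel_measurable borel"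
  shows "(\<integral>\<^sup>+\<omega>. ennreal (exp (\<Sum>l\<in>{1..n}. f (proj w l \<omega>))) \<partial>M)
    = (\<integral>\<^sup>+x. ennreal (normal_density 0 (sqrt (quad Sig w)) x) * ennreal (exp (f x)) \<partial>lborel) ^ n"
proof -
  have "(\<integral>\<^sup>+\<omega>. ennreal (exp (\<Sum>l\<in>{1..n}. f (proj w l \<omega>))) \<partial>M)
    = (\<integral>\<^sup>+\<omega>. (\<Prod>l\<in>{1..n}. ennreal (exp (f (proj w l \<omega>)))) \<partial>M)"
    by (simp add: exp_sum prod_ennreal)
  also have "\<dots> = (\<integral>\<^sup>+x. ennreal (normal_density 0 (sqrt (quad Sig w)) x) * ennreal (exp (f x)) \<partial>lborel) ^ n"
    by (rule nn_integral_proj_prod[OF s]) measurable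
  finally show ?thesis .
qed

lemma mgf_square:
  assumes s: "0 < quad Sig w" and a: "2 * a * quad Sig w < 1"
  shows "(\<integral>\<^sup>+\<omega>. ennreal (exp (a * (\<Sum>l\<in>{1..n}. (proj w l \<omega>)\<^sup>2))) \<partial>M) = ennreal ((1 / sqrt (1 - 2 * a * quad Sig w)) ^ n)"
proof -
  have "(\<integral>\<^sup>+\<omega>. ennreal (exp (a * (\<Sum>l\<in>{1..n}. (proj w l \<omega>)\<^sup>2))) \<partial>M)
     = (\<integral>\<^sup>+x. ennreal (normal_density 0 (sqrt (quad Sig w)) x) * ennreal (exp (a * x\<^sup>2)) \<partial>lborel) ^ n"
    unfolding sum_distrib_left by (rule nn_integral_exp_sum[OF s]) measurable
  also have "\<dots> = ennreal (1 / sqrt (1 - 2 * a * quad Sig w)) ^ n"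
    using s a by (subst nn_integral_normal_exp_square) auto
  also have "\<dots> = ennreal ((1 / sqrt (1 - 2 * a * quad Sig w)) ^ n)"
    using a by (intro ennreal_power) simp
  finally show ?thesis .
qed

lemma mgf_linear:
  assumes s: "0 < quad Sig w"
  shows "(\<integral>\<^sup>+\<omega>. ennreal (exp (t * (\<Sum>l\<in>{1..n}. proj w l \<omega>))) \<partial>M) = ennreal (exp (real n * (t\<^sup>2 * quad Sig w / 2)))"
proof -
  have "(\<integral>\<^sup>+\<omega>. ennreal (exp (t * (\<Sum>l\<in>{1..n}. proj w l \<omega>))) \<partial>M)
     = (\<integral>\<^sup>+x. ennreal (normal_density 0 (sqrt (quad Sig w)) x) * ennreal (exp (t * x)) \<partial>lborel) ^ n"
    unfolding sum_distrib_left by (rule nn_integral_exp_sum[OF s]) measurable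
  also have "\<dots> = ennreal (exp (t\<^sup>2 * quad Sig w / 2)) ^ n"
    using s by (subst nn_integral_normal_exp_linear) auto
  also have "\<dots> = ennreal (exp (t\<^sup>2 * quad Sig w / 2) ^ n)"
    by (intro ennreal_power) simp
  finally show ?thesis by (simp flip: exp_of_nat_mult)
qed

lemma mgf_small_ball:
  assumes s: "0 < quad Sig w" and th: "0 < \<theta>"
  shows "(\<integral>\<^sup>+\<omega>. ennreal (exp (- \<theta> * (\<Sum>l\<in>{1..n}. (proj w l \<omega> - c)\<^sup>2))) \<partial>M)
    \<le> ennreal ((1 / (sqrt (quad Sig w) * sqrt (2 * \<theta>))) ^ n)"
proof -
  have "(\<integral>\<^sup>+\<omega>. ennreal (exp (- \<theta> * (\<Sum>l\<in>{1..n}. (proj w l \<omega> - c)\<^sup>2))) \<partial>M)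
     = (\<integral>\<^sup>+x. ennreal (normal_density 0 (sqrt (quad Sig w)) x) * ennreal (exp (- \<theta> * (x - c)\<^sup>2)) \<partial>lborel) ^ n"
    unfolding sum_distrib_left by (rule nn_integral_exp_sum[OF s]) measurable
  also have "\<dots> \<le> ennreal (1 / (sqrt (quad Sig w) * sqrt (2 * \<theta>))) ^ n"
    using s th by (intro power_mono nn_integral_normal_small_ball) auto
  also have "\<dots> = ennreal ((1 / (sqrt (quad Sig w) * sqrt (2 * \<theta>))) ^ n)"
    using s th by (intro ennreal_power) simp
  finally show ?thesis .
qed

end

section \<open>Concentration of the sample covariance\<close>

text \<open>
  Chernoff's bound, from a bound on the exponential moment.
\<close>
lemma (in prob_space) prob_exp_le:
  assumes f[measurable]: "f \<in> borel_measurable M" and c: "0 \<le> c"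
    and le: "(\<integral>\<^sup>+\<omega>. ennreal (exp (f \<omega>)) \<partial>M) \<le> ennreal c"
  shows "prob {\<omega> \<in> space M. b \<le> f \<omega>} \<le> c * exp (- b)"
proof -
  have "ennreal (prob {\<omega> \<in> space M. b \<le> f \<omega>}) = (\<integral>\<^sup>+\<omega>. indicator {\<omega> \<in> space M. b \<le> f \<omega>} \<omega> \<partial>M)"
    by (simp add: emeasure_eq_measure)
  also have "\<dots> \<le> (\<integral>\<^sup>+\<omega>. ennreal (exp (- b)) * ennreal (exp (f \<omega>)) \<partial>M)"
    by (intro nn_integral_mono) (auto simp: indicator_def simp flip: ennreal_mult exp_add)
  also have "\<dots> = ennreal (exp (- b)) * (\<integral>\<^sup>+\<omega>. ennreal (exp (f \<omega>)) \<partial>M)"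
    by (rule nn_integral_cmult) measurable
  also have "\<dots> \<le> ennreal (exp (- b)) * ennreal c" by (rule mult_left_mono[OF le]) simp
  also have "\<dots> = ennreal (c * exp (- b))" using c by (simp add: mult.commute flip: ennreal_mult)
  finally show ?thesis using c by (subst (asm) ennreal_le_iff) auto
qed

definition axis2 :: "nat \<Rightarrow> nat \<Rightarrow> nat \<Rightarrow> real" where
  "axis2 i j = (\<lambda>k. (if k = i then 1 else 0) + (if k = j then 1 else 0))"

definition axis1 :: "nat \<Rightarrow> nat \<Rightarrow> real" where
  "axis1 i = (\<lambda>k. if k = i then 1 else 0)"

text \<open>
  The entries of \<open>S\<close> are controlled through its quadratic form, that is, through empirical
  variances of projections.
\<close>
lemma quad_polarize:
  assumes A: "A \<in> carrier_mat n n" and sym: "A $$ (i, j) = A $$ (j, i)" and ij: "i < n" "j < n"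
  shows "A $$ (i, j) = (quad A (axis2 i j) - quad A (axis1 i) - quad A (axis1 j)) / 2"
proof -
  have d: "(\<Sum>l<n. axis1 k l * f l) = f k" if "k < n" for k and f :: "nat \<Rightarrow> real"
    using that by (simp add: axis1_def if_distrib[of "\<lambda>x. x * _"] sum.delta cong: if_cong)
  have b: "(\<Sum>k<n. \<Sum>l<n. axis1 a k * A $$ (k, l) * axis1 b l) = A $$ (a, b)" if "a < n" "b < n" for a b
  proof -
    have "(\<Sum>k<n. \<Sum>l<n. axis1 a k * A $$ (k, l) * axis1 b l) = (\<Sum>k<n. axis1 a k * (\<Sum>l<n. axis1 b l * A $$ (k, l)))"
      by (simp add: sum_distrib_left mult_ac)
    then show ?thesis using d that by simp
  qed
  have "quad A (axis2 i j) = (\<Sum>k<n. \<Sum>l<n. axis1 i k * A $$ (k, l) * axis1 i l + axis1 i k * A $$ (k, l) * axis1 j l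
     + axis1 j k * A $$ (k, l) * axis1 i l + axis1 j k * A $$ (k, l) * axis1 j l)"
    unfolding quad_carrier[OF A] by (intro sum.cong refl) (simp add: axis2_def axis1_def)
  also have "\<dots> = A $$ (i, i) + A $$ (i, j) + A $$ (j, i) + A $$ (j, j)"
    by (simp only: sum.distrib b ij)
  finally show ?thesis using quad_unit[OF A ij(1)] quad_unit[OF A ij(2)] sym by (simp add: axis1_def)
qed

lemma sum_axis1_sq: "i < p \<Longrightarrow> (\<Sum>k<p. (axis1 i k)\<^sup>2) = 1"
  by (subst sum.remove[of _ i]) (auto simp: axis1_def)

lemma sum_axis2_sq_le:
  assumes "i < p" "j < p"
  shows "(\<Sum>k<p. (axis2 i j k)\<^sup>2) \<le> 4"
proof -
  have "(\<Sum>k<p. (axis2 i j k)\<^sup>2) \<le> (\<Sum>k<p. 2 * (axis1 i k)\<^sup>2 + 2 * (axis1 j k)\<^sup>2)"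
    by (intro sum_mono) (simp add: axis2_def axis1_def)
  also have "\<dots> = 4" using sum_axis1_sq assms by (simp add: sum.distrib flip: sum_distrib_left)
  finally show ?thesis .
qed

context gauss_sample begin

definition Smat :: "'w \<Rightarrow> real Matrix.mat" where
  "Smat \<omega> = sample_cov p n (\<lambda>l. X l \<omega>)"

definition mean :: "(nat \<Rightarrow> real) \<Rightarrow> 'w \<Rightarrow> real" where
  "mean w \<omega> = (\<Sum>l\<in>{1..n}. proj w l \<omega>) / real n"

text \<open>
  The relative error of the empirical variance in direction \<open>w\<close> when the true mean \<open>\<mu>\<close> is
  used for centring. Its law does not depend on \<open>w\<close>.
\<close>
definition dev :: "(nat \<Rightarrow> real) \<Rightarrow> 'w \<Rightarrow> real" where
  "dev w \<omega> = (\<Sum>l\<in>{1..n}. (proj w l \<omega>)\<^sup>2) / (real n * quad Sig w) - 1"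

lemma hi_pos: "0 < hi"
proof -
  have "lo \<le> hi" using quad_lower[of "axis1 0"] quad_upper[of "axis1 0"] p by (simp add: sum_axis1_sq)
  then show ?thesis using lo by simp
qed

lemma Smat_carrier: "Smat \<omega> \<in> carrier_mat p p"
  by (simp add: Smat_def sample_cov_def)

lemma Smat_sym: "i < p \<Longrightarrow> j < p \<Longrightarrow> Smat \<omega> $$ (i, j) = Smat \<omega> $$ (j, i)"
  by (simp add: Smat_def sample_cov_def mult.commute)

lemma sum_proj_measurable: "(\<lambda>\<omega>. \<Sum>l\<in>{1..n}. proj w l \<omega>) \<in> borel_measurable M"
  by (intro borel_measurable_sum proj_measurable)

lemma sum_proj_sq_measurable: "(\<lambda>\<omega>. \<Sum>l\<in>{1..n}. (proj w l \<omega> - c)\<^sup>2) \<in> borel_measurable M"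
  by (intro borel_measurable_sum borel_measurable_power borel_measurable_diff) (auto intro: proj_measurable)

lemma mean_measurable: "mean w \<in> borel_measurable M"
  unfolding mean_def using sum_proj_measurable[of w] by measurable

lemma dev_measurable: "dev w \<in> borel_measurable M"
  unfolding dev_def using sum_proj_sq_measurable[of w 0] by simp

lemma quad_Smat_centered:
  "quad (Smat \<omega>) w = (\<Sum>l\<in>{1..n}. (proj w l \<omega> - mean w \<omega>)\<^sup>2) / real n"
proof -
  define m where "m = sample_mean n (\<lambda>l. X l \<omega>)"
  have c: "proj w l \<omega> - mean w \<omega> = (\<Sum>i<p. w i * (X l \<omega> i - m i))" for l
  proof -
    have "mean w \<omega> = (\<Sum>i<p. \<Sum>l\<in>{1..n}. w i * (X l \<omega> i - vec_index \<mu> i)) / real n"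
      unfolding mean_def proj_def by (subst sum.swap) simp
    also have "\<dots> = (\<Sum>i<p. (\<Sum>l\<in>{1..n}. w i * (X l \<omega> i - vec_index \<mu> i)) / real n)"
      by (rule sum_divide_distrib)
    also have "\<dots> = (\<Sum>i<p. w i * (m i - vec_index \<mu> i))"
      using n by (intro sum.cong refl) (simp add: m_def sample_mean_def sum_subtractf sum_distrib_left[symmetric] field_simps)
    finally show ?thesis unfolding proj_def by (simp add: sum_subtractf[symmetric] algebra_simps)
  qed
  have "quad (Smat \<omega>) w = (\<Sum>i<p. \<Sum>j<p. \<Sum>l\<in>{1..n}. (w i * (X l \<omega> i - m i)) * (w j * (X l \<omega> j - m j)) / real n)"
    unfolding quad_carrier[OF Smat_carrier]
    by (intro sum.cong refl) (simp add: Smat_def sample_cov_def m_def sum_distrib_left sum_distrib_right sum_divide_distrib mult_ac)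
  also have "\<dots> = (\<Sum>i<p. \<Sum>l\<in>{1..n}. \<Sum>j<p. (w i * (X l \<omega> i - m i)) * (w j * (X l \<omega> j - m j)) / real n)"
    by (rule sum.cong[OF refl], rule sum.swap)
  also have "\<dots> = (\<Sum>l\<in>{1..n}. \<Sum>i<p. \<Sum>j<p. (w i * (X l \<omega> i - m i)) * (w j * (X l \<omega> j - m j)) / real n)"
    by (rule sum.swap)
  also have "\<dots> = (\<Sum>l\<in>{1..n}. (\<Sum>i<p. w i * (X l \<omega> i - m i))\<^sup>2 / real n)"
    by (intro sum.cong refl) (simp only: power2_eq_square sum_product sum_divide_distrib)
  also have "\<dots> = (\<Sum>l\<in>{1..n}. (proj w l \<omega> - mean w \<omega>)\<^sup>2) / real n"
    by (simp only: c sum_divide_distrib)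
  finally show ?thesis .
qed

lemma quad_Smat:
  "quad (Smat \<omega>) w = (\<Sum>l\<in>{1..n}. (proj w l \<omega>)\<^sup>2) / real n - (mean w \<omega>)\<^sup>2"
proof -
  let ?m = "mean w \<omega>"
  have e: "(\<Sum>l\<in>{1..n}. proj w l \<omega>) = real n * ?m" using n by (simp add: mean_def)
  have "(\<Sum>l\<in>{1..n}. (proj w l \<omega> - ?m)\<^sup>2) = (\<Sum>l\<in>{1..n}. (proj w l \<omega>)\<^sup>2 - 2 * ?m * proj w l \<omega> + ?m\<^sup>2)"
    by (intro sum.cong refl) (simp add: power2_diff algebra_simps)
  also have "\<dots> = (\<Sum>l\<in>{1..n}. (proj w l \<omega>)\<^sup>2) - 2 * ?m * (\<Sum>l\<in>{1..n}. proj w l \<omega>) + real n * ?m\<^sup>2"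
    by (simp add: sum.distrib sum_subtractf sum_distrib_left)
  also have "\<dots> = (\<Sum>l\<in>{1..n}. (proj w l \<omega>)\<^sup>2) - real n * ?m\<^sup>2"
    unfolding e by (simp add: power2_eq_square algebra_simps)
  finally show ?thesis unfolding quad_Smat_centered using n by (simp add: diff_divide_distrib)
qed

lemma quad_dev: "0 < quad Sig w \<Longrightarrow> quad (Smat \<omega>) w - quad Sig w = quad Sig w * dev w \<omega> - (mean w \<omega>)\<^sup>2"
  using n by (simp add: quad_Smat dev_def field_simps)

lemma mgf_dev:
  assumes s: "0 < quad Sig w" and t: "2 * t < 1"
  shows "(\<integral>\<^sup>+\<omega>. ennreal (exp (t * real n * dev w \<omega>)) \<partial>M) = ennreal (exp (real n * ((- ln (1 - 2 * t) - 2 * t) / 2)))"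
proof -
  let ?s = "quad Sig w"
  define T where "T = (\<lambda>\<omega>. \<Sum>l\<in>{1..n}. (proj w l \<omega>)\<^sup>2)"
  have [measurable]: "T \<in> borel_measurable M"
    unfolding T_def using sum_proj_sq_measurable[of w 0] by simp
  have e: "t * real n * dev w \<omega> = - t * real n + (t / ?s) * T \<omega>" for \<omega>
    using n s by (simp add: dev_def T_def field_simps)
  have "(\<integral>\<^sup>+\<omega>. ennreal (exp (t * real n * dev w \<omega>)) \<partial>M)
    = (\<integral>\<^sup>+\<omega>. ennreal (exp (- t * real n)) * ennreal (exp ((t / ?s) * T \<omega>)) \<partial>M)"
    unfolding e exp_add by (simp add: ennreal_mult)
  also have "\<dots> = ennreal (exp (- t * real n)) * (\<integral>\<^sup>+\<omega>. ennreal (exp ((t / ?s) * T \<omega>)) \<partial>M)"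
    by (rule nn_integral_cmult) measurable
  also have "(\<integral>\<^sup>+\<omega>. ennreal (exp ((t / ?s) * T \<omega>)) \<partial>M) = ennreal ((1 / sqrt (1 - 2 * (t / ?s) * ?s)) ^ n)"
    unfolding T_def by (rule mgf_square[OF s]) (use s t in simp)
  also have "1 - 2 * (t / ?s) * ?s = 1 - 2 * t" using s by simp
  also have "1 / sqrt (1 - 2 * t) = exp (- ln (1 - 2 * t) / 2)"
  proof -
    have "exp (- ln (1 - 2 * t) / 2) = 1 / exp (ln (1 - 2 * t) / 2)" by (simp add: exp_minus field_simps)
    also have "exp (ln (1 - 2 * t) / 2) = sqrt (1 - 2 * t)" using t by (simp add: ln_sqrt[symmetric])
    finally show ?thesis by simp
  qed
  also have "exp (- ln (1 - 2 * t) / 2) ^ n = exp (real n * (- ln (1 - 2 * t) / 2))"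
    by (rule exp_of_nat_mult[symmetric])
  also have "ennreal (exp (- t * real n)) * ennreal (exp (real n * (- ln (1 - 2 * t) / 2)))
     = ennreal (exp (real n * ((- ln (1 - 2 * t) - 2 * t) / 2)))"
    by (simp add: algebra_simps diff_divide_distrib flip: ennreal_mult exp_add)
  finally show ?thesis .
qed

lemma mgf_dev_upper:
  assumes s: "0 < quad Sig w" and t: "\<bar>t\<bar> \<le> 1 / 4"
  shows "(\<integral>\<^sup>+\<omega>. ennreal (exp (t * real n * dev w \<omega>)) \<partial>M) \<le> ennreal (exp (4 * t\<^sup>2 * real n))"
proof -
  have "- ln (1 - 2 * t) - 2 * t \<le> 2 * (2 * t)\<^sup>2"
    by (rule neg_ln_one_minus_upper) (use t in auto)
  then have "(- ln (1 - 2 * t) - 2 * t) / 2 \<le> 4 * t\<^sup>2" by (simp add: power2_eq_square)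
  then have "real n * ((- ln (1 - 2 * t) - 2 * t) / 2) \<le> real n * (4 * t\<^sup>2)" by (rule mult_left_mono) simp
  then show ?thesis using t by (subst mgf_dev[OF s]) (auto simp: ennreal_leI mult_ac)
qed

lemma mgf_dev_lower:
  assumes s: "0 < quad Sig w" and t: "0 \<le> t" "t \<le> 1 / 4"
  shows "ennreal (exp (t\<^sup>2 * real n)) \<le> (\<integral>\<^sup>+\<omega>. ennreal (exp (t * real n * dev w \<omega>)) \<partial>M)"
proof -
  have "(2 * t)\<^sup>2 / 2 \<le> - ln (1 - 2 * t) - 2 * t"
    by (rule neg_ln_one_minus_lower) (use t in auto)
  then have "t\<^sup>2 \<le> (- ln (1 - 2 * t) - 2 * t) / 2" by (simp add: power2_eq_square)
  then have "real n * t\<^sup>2 \<le> real n * ((- ln (1 - 2 * t) - 2 * t) / 2)" by (rule mult_left_mono) simp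
  then show ?thesis using t by (subst mgf_dev[OF s]) (auto simp: ennreal_leI mult_ac)
qed

text \<open>
  With \<open>t = \<plusminus>v/8\<close>, which minimises \<open>4 t\<^sup>2 - |t| v\<close>, Chernoff's bound has the exponent
  \<open>-n v\<^sup>2/16\<close>.
\<close>
lemma dev_tail:
  assumes s: "0 < quad Sig w" and v: "0 \<le> v" "v \<le> 1"
  shows "prob {\<omega> \<in> space M. v \<le> \<bar>dev w \<omega>\<bar>} \<le> 2 * exp (- real n * v\<^sup>2 / 16)"
proof -
  note [measurable] = dev_measurable[of w]
  have one: "prob {\<omega> \<in> space M. real n * v\<^sup>2 / 8 \<le> t * real n * dev w \<omega>} \<le> exp (- real n * v\<^sup>2 / 16)"
    if t: "\<bar>t\<bar> = v / 8" for t
  proof -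
    have t2: "t\<^sup>2 = v\<^sup>2 / 64" using arg_cong[OF t, of "\<lambda>x. x\<^sup>2"] by (simp add: power_divide)
    have "prob {\<omega> \<in> space M. real n * v\<^sup>2 / 8 \<le> t * real n * dev w \<omega>}
       \<le> exp (4 * t\<^sup>2 * real n) * exp (- (real n * v\<^sup>2 / 8))"
      by (rule prob_exp_le) (measurable, use mgf_dev_upper[OF s, of t] t v in auto)
    also have "\<dots> = exp (- real n * v\<^sup>2 / 16)" unfolding t2 exp_add[symmetric] by simp
    finally show ?thesis .
  qed
  have "{\<omega> \<in> space M. v \<le> \<bar>dev w \<omega>\<bar>} \<subseteq> {\<omega> \<in> space M. real n * v\<^sup>2 / 8 \<le> (v / 8) * real n * dev w \<omega>}
    \<union> {\<omega> \<in> space M. real n * v\<^sup>2 / 8 \<le> (- v / 8) * real n * dev w \<omega>}"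
  proof
    fix \<omega> assume w: "\<omega> \<in> {\<omega> \<in> space M. v \<le> \<bar>dev w \<omega>\<bar>}"
    then have "v * v \<le> v * \<bar>dev w \<omega>\<bar>" using v by (intro mult_left_mono) auto
    then have "real n * (v * v) \<le> real n * (v * \<bar>dev w \<omega>\<bar>)" by (rule mult_left_mono) simp
    then show "\<omega> \<in> {\<omega> \<in> space M. real n * v\<^sup>2 / 8 \<le> (v / 8) * real n * dev w \<omega>}
    \<union> {\<omega> \<in> space M. real n * v\<^sup>2 / 8 \<le> (- v / 8) * real n * dev w \<omega>}"
      using w by (cases "0 \<le> dev w \<omega>") (auto simp: power2_eq_square mult_ac)
  qed
  then have "prob {\<omega> \<in> space M. v \<le> \<bar>dev w \<omega>\<bar>} \<le> prob ({\<omega> \<in> space M. real n * v\<^sup>2 / 8 \<le> (v / 8) * real n * dev w \<omega>}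
    \<union> {\<omega> \<in> space M. real n * v\<^sup>2 / 8 \<le> (- v / 8) * real n * dev w \<omega>})"
    by (rule finite_measure_mono) measurable
  also have "\<dots> \<le> prob {\<omega> \<in> space M. real n * v\<^sup>2 / 8 \<le> (v / 8) * real n * dev w \<omega>}
    + prob {\<omega> \<in> space M. real n * v\<^sup>2 / 8 \<le> (- v / 8) * real n * dev w \<omega>}"
    by (rule measure_Un_le) measurable
  also have "\<dots> \<le> 2 * exp (- real n * v\<^sup>2 / 16)" using one[of "v / 8"] one[of "- v / 8"] v by simp
  finally show ?thesis .
qed

lemma mean_tail:
  assumes s: "0 < quad Sig w" and r: "0 \<le> r"
  shows "prob {\<omega> \<in> space M. sqrt (quad Sig w) * r \<le> \<bar>mean w \<omega>\<bar>} \<le> 2 * exp (- real n * r\<^sup>2 / 2)"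
proof -
  let ?s = "quad Sig w"
  note [measurable] = mean_measurable[of w]
  have em: "real n * mean w \<omega> = (\<Sum>l\<in>{1..n}. proj w l \<omega>)" for \<omega> using n by (simp add: mean_def)
  have one: "prob {\<omega> \<in> space M. real n * r\<^sup>2 \<le> t * (real n * mean w \<omega>)} \<le> exp (- real n * r\<^sup>2 / 2)"
    if t: "\<bar>t\<bar> = r / sqrt ?s" for t
  proof -
    have t2: "t\<^sup>2 * ?s = r\<^sup>2" using arg_cong[OF t, of "\<lambda>x. x\<^sup>2"] s by (simp add: power_divide)
    have "prob {\<omega> \<in> space M. real n * r\<^sup>2 \<le> t * (real n * mean w \<omega>)}
       \<le> exp (real n * (t\<^sup>2 * ?s / 2)) * exp (- (real n * r\<^sup>2))"
      by (rule prob_exp_le) (measurable, use mgf_linear[OF s, of t] in \<open>auto simp: em\<close>)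
    also have "\<dots> = exp (- real n * r\<^sup>2 / 2)" unfolding t2 exp_add[symmetric] by simp
    finally show ?thesis .
  qed
  let ?t = "r / sqrt ?s"
  have "{\<omega> \<in> space M. sqrt ?s * r \<le> \<bar>mean w \<omega>\<bar>} \<subseteq> {\<omega> \<in> space M. real n * r\<^sup>2 \<le> ?t * (real n * mean w \<omega>)}
    \<union> {\<omega> \<in> space M. real n * r\<^sup>2 \<le> (- ?t) * (real n * mean w \<omega>)}"
  proof
    fix \<omega> assume w: "\<omega> \<in> {\<omega> \<in> space M. sqrt ?s * r \<le> \<bar>mean w \<omega>\<bar>}"
    then have "?t * (sqrt ?s * r) \<le> ?t * \<bar>mean w \<omega>\<bar>" using r s by (intro mult_left_mono) auto
    then have "r\<^sup>2 \<le> ?t * \<bar>mean w \<omega>\<bar>" using s by (simp add: power2_eq_square)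
    then have "real n * r\<^sup>2 \<le> real n * (?t * \<bar>mean w \<omega>\<bar>)" by (rule mult_left_mono) simp
    then have "real n * r\<^sup>2 \<le> ?t * (real n * \<bar>mean w \<omega>\<bar>)" by (simp only: mult.left_commute)
    then show "\<omega> \<in> {\<omega> \<in> space M. real n * r\<^sup>2 \<le> ?t * (real n * mean w \<omega>)}
      \<union> {\<omega> \<in> space M. real n * r\<^sup>2 \<le> (- ?t) * (real n * mean w \<omega>)}"
      using w by (cases "0 \<le> mean w \<omega>") auto
  qed
  then have "prob {\<omega> \<in> space M. sqrt ?s * r \<le> \<bar>mean w \<omega>\<bar>} \<le> prob ({\<omega> \<in> space M. real n * r\<^sup>2 \<le> ?t * (real n * mean w \<omega>)}
    \<union> {\<omega> \<in> space M. real n * r\<^sup>2 \<le> (- ?t) * (real n * mean w \<omega>)})"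
    by (rule finite_measure_mono) measurable
  also have "\<dots> \<le> prob {\<omega> \<in> space M. real n * r\<^sup>2 \<le> ?t * (real n * mean w \<omega>)}
    + prob {\<omega> \<in> space M. real n * r\<^sup>2 \<le> (- ?t) * (real n * mean w \<omega>)}"
    by (rule measure_Un_le) measurable
  also have "\<dots> \<le> 2 * exp (- real n * r\<^sup>2 / 2)" using one[of ?t] one[of "- ?t"] r s by simp
  finally show ?thesis .
qed

text \<open>
  The two error terms of \<open>w\<^sup>T S w\<close>, from the fluctuation of the squares and from the sample
  mean.
\<close>
definition bad :: "real \<Rightarrow> (nat \<Rightarrow> real) \<Rightarrow> 'w set" where
  "bad v w = {\<omega> \<in> space M. v \<le> \<bar>dev w \<omega>\<bar>} \<union> {\<omega> \<in> space M. sqrt (quad Sig w) * v \<le> \<bar>mean w \<omega>\<bar>}"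

lemma bad_events: "bad v w \<in> events"
  unfolding bad_def using dev_measurable[of w] mean_measurable[of w] by measurable

lemma prob_bad:
  assumes s: "0 < quad Sig w" and v: "0 \<le> v" "v \<le> 1"
  shows "prob (bad v w) \<le> 4 * exp (- real n * v\<^sup>2 / 16)"
proof -
  note [measurable] = mean_measurable[of w] dev_measurable[of w]
  have "prob (bad v w) \<le> prob {\<omega> \<in> space M. v \<le> \<bar>dev w \<omega>\<bar>} + prob {\<omega> \<in> space M. sqrt (quad Sig w) * v \<le> \<bar>mean w \<omega>\<bar>}"
    unfolding bad_def by (rule measure_Un_le) measurable
  moreover have "exp (- real n * v\<^sup>2 / 2) \<le> exp (- real n * v\<^sup>2 / 16)" by simp
  ultimately show ?thesis using dev_tail[OF s v] mean_tail[OF s v(1)] by linarith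
qed

lemma not_bad:
  assumes s: "0 < quad Sig w" and v: "0 \<le> v" "v \<le> 1" and w: "\<omega> \<in> space M - bad v w"
  shows "\<bar>quad (Smat \<omega>) w - quad Sig w\<bar> \<le> 2 * quad Sig w * v"
proof -
  let ?s = "quad Sig w"
  have d: "\<bar>dev w \<omega>\<bar> < v" and m: "\<bar>mean w \<omega>\<bar> < sqrt ?s * v" using w by (auto simp: bad_def)
  have "(mean w \<omega>)\<^sup>2 \<le> (sqrt ?s * v)\<^sup>2" using m by (intro power2_le_iff_abs_le[THEN iffD2]) auto
  also have "\<dots> = ?s * (v * v)" using s by (simp add: power_mult_distrib power2_eq_square)
  also have "\<dots> \<le> ?s * v" using s v by (intro mult_left_mono) (auto intro: mult_left_le)
  finally have m2: "(mean w \<omega>)\<^sup>2 \<le> ?s * v" .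
  have "\<bar>?s * dev w \<omega>\<bar> \<le> ?s * v" using d s by (simp add: abs_mult)
  then have "\<bar>?s * dev w \<omega> - (mean w \<omega>)\<^sup>2\<bar> \<le> 2 * (?s * v)" using m2 zero_le_power2[of "mean w \<omega>"] by linarith
  then show ?thesis unfolding quad_dev[OF s] by (simp add: mult.assoc)
qed

lemma quad_axis_pos:
  assumes "i < p" "j < p"
  shows "0 < quad Sig (axis1 i)" "0 < quad Sig (axis2 i j)"
  using assms by (auto intro!: quad_pos[of i] simp: axis1_def axis2_def split: if_splits)

lemma quad_axis_le:
  assumes "i < p" "j < p"
  shows "quad Sig (axis1 i) \<le> hi" "quad Sig (axis2 i j) \<le> 4 * hi"
proof -
  show "quad Sig (axis1 i) \<le> hi" using quad_upper[of "axis1 i"] assms by (simp add: sum_axis1_sq)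
  have "hi * (\<Sum>k<p. (axis2 i j k)\<^sup>2) \<le> hi * 4" using sum_axis2_sq_le[OF assms] hi_pos by (intro mult_left_mono) auto
  then show "quad Sig (axis2 i j) \<le> 4 * hi" using quad_upper[of "axis2 i j"] by simp
qed

lemma entry_diff:
  assumes ij: "i < p" "j < p"
  shows "Smat \<omega> $$ (i, j) - Sig $$ (i, j) = ((quad (Smat \<omega>) (axis2 i j) - quad Sig (axis2 i j))
    - (quad (Smat \<omega>) (axis1 i) - quad Sig (axis1 i)) - (quad (Smat \<omega>) (axis1 j) - quad Sig (axis1 j))) / 2"
  using quad_polarize[OF Smat_carrier Smat_sym[OF ij] ij] quad_polarize[OF Sig sym_pos_def_symD[OF spd Sig ij] ij]
  by (simp add: field_simps)

text \<open>
  A union bound over the directions \<open>e\<^sub>i\<close> and \<open>e\<^sub>i + e\<^sub>j\<close>. Their variances are at most \<open>hi\<close> and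
  \<open>4 hi\<close>, so polarisation gives \<open>(2 \<cdot> 4 + 2 + 2)/2 = 6\<close>.
\<close>
lemma entries_close:
  assumes v: "0 \<le> v" "v \<le> 1"
  shows "\<exists>F\<in>events. prob F \<le> 8 * (real p)\<^sup>2 * exp (- real n * v\<^sup>2 / 16) \<and>
    (\<forall>\<omega>\<in>space M - F. \<forall>i<p. \<forall>j<p. \<bar>Smat \<omega> $$ (i, j) - Sig $$ (i, j)\<bar> \<le> 6 * hi * v)"
proof -
  define F1 where "F1 = (\<Union>i\<in>{..<p}. bad v (axis1 i))"
  define F2 where "F2 = (\<Union>x\<in>{..<p} \<times> {..<p}. bad v (axis2 (fst x) (snd x)))"
  let ?e = "exp (- real n * v\<^sup>2 / 16)"
  have m: "F1 \<in> events" "F2 \<in> events" unfolding F1_def F2_def using bad_events by auto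
  have "prob F1 \<le> (\<Sum>i\<in>{..<p}. prob (bad v (axis1 i)))"
    unfolding F1_def by (rule finite_measure_subadditive_finite) (auto simp: bad_events)
  also have "\<dots> \<le> (\<Sum>i\<in>{..<p}. 4 * ?e)" by (intro sum_mono prob_bad v quad_axis_pos) auto
  also have "\<dots> = real p * (4 * ?e)" by simp
  also have "\<dots> \<le> (real p)\<^sup>2 * (4 * ?e)" using p by (intro mult_right_mono) (auto simp: power2_eq_square)
  finally have p1: "prob F1 \<le> (real p)\<^sup>2 * (4 * ?e)" .
  have "prob F2 \<le> (\<Sum>x\<in>{..<p} \<times> {..<p}. prob (bad v (axis2 (fst x) (snd x))))"
    unfolding F2_def by (rule finite_measure_subadditive_finite) (auto simp: bad_events)
  also have "\<dots> \<le> (\<Sum>x\<in>{..<p} \<times> {..<p}. 4 * ?e)" by (intro sum_mono prob_bad v quad_axis_pos) auto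
  also have "\<dots> = (real p)\<^sup>2 * (4 * ?e)" by (simp add: power2_eq_square)
  finally have p2: "prob F2 \<le> (real p)\<^sup>2 * (4 * ?e)" .
  have "prob (F1 \<union> F2) \<le> prob F1 + prob F2" by (rule measure_Un_le[OF m])
  then have pF: "prob (F1 \<union> F2) \<le> 8 * (real p)\<^sup>2 * ?e" using p1 p2 by simp
  have "\<bar>Smat \<omega> $$ (i, j) - Sig $$ (i, j)\<bar> \<le> 6 * hi * v"
    if w: "\<omega> \<in> space M - (F1 \<union> F2)" and ij: "i < p" "j < p" for \<omega> i j
  proof -
    have nb: "\<omega> \<in> space M - bad v (axis1 i)" "\<omega> \<in> space M - bad v (axis1 j)" "\<omega> \<in> space M - bad v (axis2 i j)"
      using w ij by (auto simp: F1_def F2_def)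
    have "2 * quad Sig (axis1 i) * v \<le> 2 * hi * v"
      using quad_axis_le(1)[OF ij] v by (intro mult_right_mono mult_left_mono) auto
    moreover have "2 * quad Sig (axis1 j) * v \<le> 2 * hi * v"
      using quad_axis_le(1)[OF ij(2,1)] v by (intro mult_right_mono mult_left_mono) auto
    moreover have "2 * quad Sig (axis2 i j) * v \<le> 2 * (4 * hi) * v"
      using quad_axis_le(2)[OF ij] v by (intro mult_right_mono mult_left_mono) auto
    ultimately have "\<bar>quad (Smat \<omega>) (axis1 i) - quad Sig (axis1 i)\<bar> \<le> 2 * hi * v"
      "\<bar>quad (Smat \<omega>) (axis1 j) - quad Sig (axis1 j)\<bar> \<le> 2 * hi * v"
      "\<bar>quad (Smat \<omega>) (axis2 i j) - quad Sig (axis2 i j)\<bar> \<le> 8 * hi * v"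
      using not_bad[OF quad_axis_pos(1)[OF ij] v nb(1)] not_bad[OF quad_axis_pos(1)[OF ij(2,1)] v nb(2)]
        not_bad[OF quad_axis_pos(2)[OF ij] v nb(3)] by linarith+
    then show ?thesis unfolding entry_diff[OF ij] by (simp add: abs_le_iff)
  qed
  then show ?thesis using pF m by (intro bexI[of _ "F1 \<union> F2"]) auto
qed

end

section \<open>Second moments and fluctuations of the entries\<close>

lemma sq_le_exp_sum: "(x::real)\<^sup>2 \<le> 4 * (exp x + exp (- x))"
proof -
  have "\<bar>x\<bar> / 2 \<le> exp (\<bar>x\<bar> / 2)" using exp_ge_add_one_self[of "\<bar>x\<bar> / 2"] by linarith
  then have "(\<bar>x\<bar> / 2)\<^sup>2 \<le> (exp (\<bar>x\<bar> / 2))\<^sup>2" by (rule power_mono) simp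
  also have "\<dots> = exp \<bar>x\<bar>" by (simp flip: exp_double)
  also have "\<dots> \<le> exp x + exp (- x)" by (simp add: abs_if add_nonneg_nonneg)
  finally show ?thesis by (simp add: power_divide)
qed

lemma power4_le_exp_sum: "(x::real) ^ 4 \<le> 256 * (exp x + exp (- x))"
proof -
  have "\<bar>x\<bar> / 4 \<le> exp (\<bar>x\<bar> / 4)" using exp_ge_add_one_self[of "\<bar>x\<bar> / 4"] by linarith
  then have "(\<bar>x\<bar> / 4) ^ 4 \<le> exp (\<bar>x\<bar> / 4) ^ 4" by (rule power_mono) simp
  also have "\<dots> = exp \<bar>x\<bar>" by (simp flip: exp_of_nat_mult)
  also have "\<dots> \<le> exp x + exp (- x)" by (simp add: abs_if add_nonneg_nonneg)
  finally show ?thesis by (simp add: power_divide)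
qed

text \<open>
  Collects the exponential moments and numerical factors that occur in \<open>quad_second_moment\<close>.
\<close>
definition mom_const :: real where "mom_const = 16 * exp 4 + 1024 * exp (1 / 2)"

lemma mom_const_pos: "0 < mom_const" by (simp add: mom_const_def add_pos_pos)

lemma diff3_sq_le: "((a - b - c) / 2)\<^sup>2 \<le> 3 / 4 * (a\<^sup>2 + b\<^sup>2 + (c::real)\<^sup>2)"
proof -
  have "3 * (a\<^sup>2 + b\<^sup>2 + c\<^sup>2) - (a - b - c)\<^sup>2 = (a + b)\<^sup>2 + (a + c)\<^sup>2 + (b - c)\<^sup>2"
    by (simp add: power2_eq_square algebra_simps)
  then have "(a - b - c)\<^sup>2 \<le> 3 * (a\<^sup>2 + b\<^sup>2 + c\<^sup>2)"
    by (metis add_nonneg_nonneg diff_ge_0_iff_ge zero_le_power2)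
  then show ?thesis by (simp add: power_divide)
qed

lemma ennreal_plus_mult:
  "0 \<le> a \<Longrightarrow> 0 \<le> b \<Longrightarrow> 0 \<le> c \<Longrightarrow> ennreal (a + b * c) = ennreal a + ennreal b * ennreal c"
  by (simp add: ennreal_mult ennreal_plus)

lemma ennreal_lin2:
  "0 \<le> a \<Longrightarrow> 0 \<le> b \<Longrightarrow> 0 \<le> x \<Longrightarrow> 0 \<le> y \<Longrightarrow> 0 \<le> z \<Longrightarrow> 0 \<le> w \<Longrightarrow>
    ennreal (a * (x + y) + b * (z + w))
      = ennreal a * (ennreal x + ennreal y) + ennreal b * (ennreal z + ennreal w)"
  by (simp add: ennreal_mult ennreal_plus)

lemma ennreal_scaled_sum3:
  "0 \<le> a \<Longrightarrow> 0 \<le> x \<Longrightarrow> 0 \<le> y \<Longrightarrow> 0 \<le> z \<Longrightarrow>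
    ennreal a * (ennreal x + ennreal y + ennreal z) = ennreal (a * (x + y + z))"
  by (simp add: ennreal_mult ennreal_plus)

context gauss_sample begin

lemma quad_Smat_measurable: "(\<lambda>\<omega>. quad (Smat \<omega>) w) \<in> borel_measurable M"
proof -
  define T where "T = (\<lambda>\<omega>. \<Sum>l\<in>{1..n}. (proj w l \<omega>)\<^sup>2)"
  have [measurable]: "T \<in> borel_measurable M"
    unfolding T_def using sum_proj_sq_measurable[of w 0] by simp
  have [measurable]: "mean w \<in> borel_measurable M" by (rule mean_measurable)
  have "(\<lambda>\<omega>. T \<omega> / real n - (mean w \<omega>)\<^sup>2) \<in> borel_measurable M" by measurable
  then show ?thesis unfolding quad_Smat T_def .
qed

lemma Smat_entry_measurable:
  assumes ij: "i < p" "j < p"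
  shows "(\<lambda>\<omega>. Smat \<omega> $$ (i, j)) \<in> borel_measurable M"
proof -
  have "Smat \<omega> $$ (i, j) = (quad (Smat \<omega>) (axis2 i j) - quad (Smat \<omega>) (axis1 i) - quad (Smat \<omega>) (axis1 j)) / 2" for \<omega>
    by (rule quad_polarize[OF Smat_carrier Smat_sym[OF ij] ij])
  then have e: "(\<lambda>\<omega>. Smat \<omega> $$ (i, j))
      = (\<lambda>\<omega>. (quad (Smat \<omega>) (axis2 i j) - quad (Smat \<omega>) (axis1 i) - quad (Smat \<omega>) (axis1 j)) / 2)"
    by (rule ext)
  note [measurable] = quad_Smat_measurable
  show ?thesis unfolding e by measurable
qed

text \<open>
  The error is \<open>s dev - mean\<^sup>2\<close>, with \<open>dev\<close> and \<open>mean\<close> of order \<open>n\<^sup>-\<^sup>1\<^sup>/\<^sup>2\<close>. After scaling to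
  order one, their powers are dominated by exponentials, whose moments are bounded uniformly
  in \<open>n\<close>.
\<close>
lemma quad_second_moment:
  assumes s: "0 < quad Sig w" and n16: "16 \<le> n"
  shows "(\<integral>\<^sup>+\<omega>. ennreal ((quad (Smat \<omega>) w - quad Sig w)\<^sup>2) \<partial>M) \<le> ennreal (mom_const * (quad Sig w)\<^sup>2 / real n)"
proof -
  define s' where "s' = quad Sig w"
  have s': "0 < s'" using s by (simp add: s'_def)
  define t where "t = 1 / sqrt (real n)"
  \<comment> \<open>the scales at which the exponential moments of \<open>dev\<close> and of \<open>mean\<close> stay bounded\<close>
  define r where "r = 1 / (sqrt (real n) * sqrt s')"
  have n0: "0 < real n" using n by simp
  have sn: "4 \<le> sqrt (real n)" using n16 by (simp add: real_le_rsqrt)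
  have t14: "\<bar>t\<bar> \<le> 1 / 4" unfolding t_def using sn n0 by (simp add: divide_le_eq)
  have t2: "t\<^sup>2 * real n = 1" using n0 by (simp add: t_def power_divide)
  have r2: "r\<^sup>2 * s' * real n = 1" using n0 s' by (simp add: r_def power_divide power_mult_distrib)
  define E :: "real \<Rightarrow> 'w \<Rightarrow> ennreal" where "E = (\<lambda>a \<omega>. ennreal (exp (a * real n * dev w \<omega>)))"
  define G :: "real \<Rightarrow> 'w \<Rightarrow> ennreal" where "G = (\<lambda>a \<omega>. ennreal (exp (a * (\<Sum>l\<in>{1..n}. proj w l \<omega>))))"
  have [measurable]: "E a \<in> borel_measurable M" for a
    unfolding E_def using dev_measurable[of w] by measurable
  have [measurable]: "G a \<in> borel_measurable M" for a
    unfolding G_def using sum_proj_measurable[of w] by (intro measurable_compose[OF _ measurable_ennreal] borel_measurable_exp borel_measurable_times) simp_all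
  have IE: "(\<integral>\<^sup>+\<omega>. E a \<omega> \<partial>M) \<le> ennreal (exp 4)" if a: "\<bar>a\<bar> = t" for a
  proof -
    have "a\<^sup>2 * real n = 1" using t2 a by (metis power2_abs)
    moreover have "\<bar>a\<bar> \<le> 1 / 4" using a t14 by simp
    ultimately show ?thesis using mgf_dev_upper[OF s, of a] by (simp add: E_def mult.assoc)
  qed
  have IG: "(\<integral>\<^sup>+\<omega>. G a \<omega> \<partial>M) = ennreal (exp (1 / 2))" if a: "\<bar>a\<bar> = r" for a
  proof -
    have "a\<^sup>2 * s' * real n = 1" using r2 a by (metis power2_abs)
    then show ?thesis using mgf_linear[OF s, of a] by (simp add: G_def s'_def mult_ac)
  qed
  have pw: "ennreal ((quad (Smat \<omega>) w - quad Sig w)\<^sup>2)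
     \<le> ennreal (8 * s'\<^sup>2 / real n) * (E t \<omega> + E (- t) \<omega>) + ennreal (512 * s'\<^sup>2 / (real n)\<^sup>2) * (G r \<omega> + G (- r) \<omega>)" for \<omega>
  proof -
    define m where "m = mean w \<omega>"
    define d where "d = dev w \<omega>"
    define q where "q = r * (\<Sum>l\<in>{1..n}. proj w l \<omega>)"
    have q: "q = r * (real n * m)" using n0 by (simp add: q_def m_def mean_def)
    have "(s' * d - m\<^sup>2)\<^sup>2 \<le> 2 * s'\<^sup>2 * d\<^sup>2 + 2 * m ^ 4"
    proof -
      have "2 * s'\<^sup>2 * d\<^sup>2 + 2 * m ^ 4 - (s' * d - m\<^sup>2)\<^sup>2 = (s' * d + m\<^sup>2)\<^sup>2"
        by (simp add: power2_eq_square power4_eq_xxxx algebra_simps)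
      then show ?thesis by (metis diff_ge_0_iff_ge zero_le_power2)
    qed
    moreover have "2 * s'\<^sup>2 * d\<^sup>2 \<le> 8 * s'\<^sup>2 / real n * (exp (t * real n * d) + exp (- t * real n * d))"
    proof -
      have "(t * real n * d)\<^sup>2 = (t\<^sup>2 * real n) * real n * d\<^sup>2" by (simp add: power2_eq_square)
      then have "real n * d\<^sup>2 \<le> 4 * (exp (t * real n * d) + exp (- (t * real n * d)))"
        using sq_le_exp_sum[of "t * real n * d"] by (simp add: t2)
      from mult_left_mono[OF this, of "2 * s'\<^sup>2 / real n"]
      have "(2 * s'\<^sup>2 / real n) * (real n * d\<^sup>2) \<le> (2 * s'\<^sup>2 / real n) * (4 * (exp (t * real n * d) + exp (- (t * real n * d))))"
        by simp
      also have "\<dots> = 8 * s'\<^sup>2 / real n * (exp (t * real n * d) + exp (- t * real n * d))"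
        by (simp add: algebra_simps add_divide_distrib)
      also have "(2 * s'\<^sup>2 / real n) * (real n * d\<^sup>2) = 2 * s'\<^sup>2 * d\<^sup>2" using n0 by simp
      finally show ?thesis .
    qed
    moreover have "2 * m ^ 4 \<le> 512 * s'\<^sup>2 / (real n)\<^sup>2 * (exp q + exp (- q))"
    proof -
      have "q ^ 4 = (r\<^sup>2 * s' * real n)\<^sup>2 * (real n)\<^sup>2 * m ^ 4 / s'\<^sup>2"
        unfolding q using s' by (simp add: power2_eq_square power4_eq_xxxx field_simps)
      then have "q ^ 4 = (real n)\<^sup>2 * m ^ 4 / s'\<^sup>2" unfolding r2 by simp
      then have "(real n)\<^sup>2 * m ^ 4 / s'\<^sup>2 \<le> 256 * (exp q + exp (- q))"
        using power4_le_exp_sum[of q] by simp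
      from mult_left_mono[OF this, of "2 * s'\<^sup>2 / (real n)\<^sup>2"]
      have "(2 * s'\<^sup>2 / (real n)\<^sup>2) * ((real n)\<^sup>2 * m ^ 4 / s'\<^sup>2) \<le> (2 * s'\<^sup>2 / (real n)\<^sup>2) * (256 * (exp q + exp (- q)))"
        by simp
      also have "\<dots> = 512 * s'\<^sup>2 / (real n)\<^sup>2 * (exp q + exp (- q))"
        by (simp add: algebra_simps add_divide_distrib)
      also have "(2 * s'\<^sup>2 / (real n)\<^sup>2) * ((real n)\<^sup>2 * m ^ 4 / s'\<^sup>2) = 2 * m ^ 4" using n0 s' by simp
      finally show ?thesis .
    qed
    ultimately have "(quad (Smat \<omega>) w - quad Sig w)\<^sup>2 \<le> 8 * s'\<^sup>2 / real n * (exp (t * real n * d) + exp (- t * real n * d))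
       + 512 * s'\<^sup>2 / (real n)\<^sup>2 * (exp q + exp (- q))"
      unfolding quad_dev[OF s] by (simp add: s'_def m_def d_def)
    then have "ennreal ((quad (Smat \<omega>) w - quad Sig w)\<^sup>2) \<le> ennreal (8 * s'\<^sup>2 / real n * (exp (t * real n * d) + exp (- t * real n * d))
       + 512 * s'\<^sup>2 / (real n)\<^sup>2 * (exp q + exp (- q)))" by (rule ennreal_leI)
    also have "\<dots> = ennreal (8 * s'\<^sup>2 / real n) * (E t \<omega> + E (- t) \<omega>) + ennreal (512 * s'\<^sup>2 / (real n)\<^sup>2) * (G r \<omega> + G (- r) \<omega>)"
      unfolding E_def G_def q_def d_def mult_minus_left by (rule ennreal_lin2) auto
    finally show ?thesis .
  qed
  have "(\<integral>\<^sup>+\<omega>. ennreal ((quad (Smat \<omega>) w - quad Sig w)\<^sup>2) \<partial>M)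
    \<le> (\<integral>\<^sup>+\<omega>. ennreal (8 * s'\<^sup>2 / real n) * (E t \<omega> + E (- t) \<omega>) + ennreal (512 * s'\<^sup>2 / (real n)\<^sup>2) * (G r \<omega> + G (- r) \<omega>) \<partial>M)"
    by (intro nn_integral_mono pw)
  also have "\<dots> = ennreal (8 * s'\<^sup>2 / real n) * ((\<integral>\<^sup>+\<omega>. E t \<omega> \<partial>M) + (\<integral>\<^sup>+\<omega>. E (- t) \<omega> \<partial>M))
      + ennreal (512 * s'\<^sup>2 / (real n)\<^sup>2) * ((\<integral>\<^sup>+\<omega>. G r \<omega> \<partial>M) + (\<integral>\<^sup>+\<omega>. G (- r) \<omega> \<partial>M))"
    by (simp add: nn_integral_add nn_integral_cmult)
  also have "\<dots> \<le> ennreal (8 * s'\<^sup>2 / real n) * (ennreal (exp 4) + ennreal (exp 4))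
      + ennreal (512 * s'\<^sup>2 / (real n)\<^sup>2) * (ennreal (exp (1 / 2)) + ennreal (exp (1 / 2)))"
  proof -
    have t0: "0 \<le> t" and r0: "0 \<le> r" using s' by (simp_all add: t_def r_def)
    show ?thesis
      using t0 r0 by (intro add_mono mult_left_mono IE) (simp_all add: IG)
  qed
  also have "\<dots> = ennreal (8 * s'\<^sup>2 / real n * (exp 4 + exp 4) + 512 * s'\<^sup>2 / (real n)\<^sup>2 * (exp (1 / 2) + exp (1 / 2)))"
    by (rule ennreal_lin2[symmetric]) auto
  also have "\<dots> \<le> ennreal (mom_const * (quad Sig w)\<^sup>2 / real n)"
  proof (rule ennreal_leI)
    have "1 / (real n)\<^sup>2 \<le> 1 / real n" using n by (simp add: field_simps power2_eq_square)
    then have "1024 * exp (1 / 2) * s'\<^sup>2 * (1 / (real n)\<^sup>2) \<le> 1024 * exp (1 / 2) * s'\<^sup>2 * (1 / real n)"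
      by (rule mult_left_mono) simp
    then show "8 * s'\<^sup>2 / real n * (exp 4 + exp 4) + 512 * s'\<^sup>2 / (real n)\<^sup>2 * (exp (1 / 2) + exp (1 / 2)) \<le> mom_const * (quad Sig w)\<^sup>2 / real n"
      unfolding mom_const_def s'_def[symmetric] by (simp add: algebra_simps add_divide_distrib)
  qed
  finally show ?thesis .
qed

lemma entry_second_moment:
  assumes ij: "i < p" "j < p" and n16: "16 \<le> n"
  shows "(\<integral>\<^sup>+\<omega>. ennreal ((Smat \<omega> $$ (i, j) - Sig $$ (i, j))\<^sup>2) \<partial>M) \<le> ennreal (14 * mom_const * hi\<^sup>2 / real n)"
proof -
  let ?D = "\<lambda>w \<omega>. quad (Smat \<omega>) w - quad Sig w"
  have [measurable]: "?D w \<in> borel_measurable M" for w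
    using quad_Smat_measurable[of w] by measurable
  have m1: "(\<integral>\<^sup>+\<omega>. ennreal ((?D w \<omega>)\<^sup>2) \<partial>M) \<le> ennreal (mom_const * h\<^sup>2 / real n)"
    if "0 < quad Sig w" "quad Sig w \<le> h" for w h
  proof -
    have "(quad Sig w)\<^sup>2 \<le> h\<^sup>2" using that by (intro power_mono) auto
    then have "mom_const * (quad Sig w)\<^sup>2 / real n \<le> mom_const * h\<^sup>2 / real n"
      using mom_const_pos by (intro divide_right_mono mult_left_mono) auto
    then show ?thesis using quad_second_moment[OF that(1) n16] ennreal_leI order_trans by blast
  qed
  have "(\<integral>\<^sup>+\<omega>. ennreal ((Smat \<omega> $$ (i, j) - Sig $$ (i, j))\<^sup>2) \<partial>M)
    \<le> (\<integral>\<^sup>+\<omega>. ennreal (3 / 4) * (ennreal ((?D (axis2 i j) \<omega>)\<^sup>2) + ennreal ((?D (axis1 i) \<omega>)\<^sup>2) + ennreal ((?D (axis1 j) \<omega>)\<^sup>2)) \<partial>M)"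
  proof (rule nn_integral_mono)
    fix \<omega>
    have "(Smat \<omega> $$ (i, j) - Sig $$ (i, j))\<^sup>2 \<le> 3 / 4 * ((?D (axis2 i j) \<omega>)\<^sup>2 + (?D (axis1 i) \<omega>)\<^sup>2 + (?D (axis1 j) \<omega>)\<^sup>2)"
      unfolding entry_diff[OF ij] by (rule diff3_sq_le)
    then have "ennreal ((Smat \<omega> $$ (i, j) - Sig $$ (i, j))\<^sup>2) \<le> ennreal (3 / 4 * ((?D (axis2 i j) \<omega>)\<^sup>2 + (?D (axis1 i) \<omega>)\<^sup>2 + (?D (axis1 j) \<omega>)\<^sup>2))"
      by (rule ennreal_leI)
    also have "\<dots> = ennreal (3 / 4) * ennreal ((?D (axis2 i j) \<omega>)\<^sup>2 + (?D (axis1 i) \<omega>)\<^sup>2 + (?D (axis1 j) \<omega>)\<^sup>2)"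
      by (rule ennreal_mult) auto
    also have "\<dots> = ennreal (3 / 4) * (ennreal ((?D (axis2 i j) \<omega>)\<^sup>2) + ennreal ((?D (axis1 i) \<omega>)\<^sup>2) + ennreal ((?D (axis1 j) \<omega>)\<^sup>2))"
      by (simp add: ennreal_plus)
    finally show "ennreal ((Smat \<omega> $$ (i, j) - Sig $$ (i, j))\<^sup>2) \<le> ennreal (3 / 4) * (ennreal ((?D (axis2 i j) \<omega>)\<^sup>2) + ennreal ((?D (axis1 i) \<omega>)\<^sup>2) + ennreal ((?D (axis1 j) \<omega>)\<^sup>2))" .
  qed
  also have "\<dots> = ennreal (3 / 4) * ((\<integral>\<^sup>+\<omega>. ennreal ((?D (axis2 i j) \<omega>)\<^sup>2) \<partial>M) + (\<integral>\<^sup>+\<omega>. ennreal ((?D (axis1 i) \<omega>)\<^sup>2) \<partial>M) + (\<integral>\<^sup>+\<omega>. ennreal ((?D (axis1 j) \<omega>)\<^sup>2) \<partial>M))"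
    by (simp only: nn_integral_add nn_integral_cmult borel_measurable_add measurable_compose[OF _ measurable_ennreal] borel_measurable_power \<open>\<And>w. ?D w \<in> borel_measurable M\<close>)
  also have "\<dots> \<le> ennreal (3 / 4) * (ennreal (mom_const * (4 * hi)\<^sup>2 / real n) + ennreal (mom_const * hi\<^sup>2 / real n) + ennreal (mom_const * hi\<^sup>2 / real n))"
    by (intro mult_left_mono add_mono m1 quad_axis_pos[OF ij] quad_axis_le[OF ij] quad_axis_pos(1)[OF ij(2,1)] quad_axis_le(1)[OF ij(2,1)]) simp
  also have "\<dots> = ennreal (3 / 4 * (mom_const * (4 * hi)\<^sup>2 / real n + mom_const * hi\<^sup>2 / real n + mom_const * hi\<^sup>2 / real n))"
    using mom_const_pos by (intro ennreal_scaled_sum3) auto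
  also have "\<dots> \<le> ennreal (14 * mom_const * hi\<^sup>2 / real n)"
  proof (rule ennreal_leI)
    have "3 / 4 * (mom_const * (4 * hi)\<^sup>2 / real n + mom_const * hi\<^sup>2 / real n + mom_const * hi\<^sup>2 / real n) = 27 / 2 * (mom_const * hi\<^sup>2 / real n)"
      by (simp add: power_mult_distrib field_simps)
    also have "\<dots> \<le> 14 * (mom_const * hi\<^sup>2 / real n)"
      using mom_const_pos by (intro mult_right_mono) auto
    finally show "3 / 4 * (mom_const * (4 * hi)\<^sup>2 / real n + mom_const * hi\<^sup>2 / real n + mom_const * hi\<^sup>2 / real n) \<le> 14 * mom_const * hi\<^sup>2 / real n" by simp
  qed
  finally show ?thesis .
qed

text \<open>
  Anti-concentration from exponential moments. For \<open>V = \<surd>n dev\<close> the first moment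
  \<open>E exp V \<ge> e \<ge> 5/2\<close> exceeds what the event \<open>exp V \<le> 3/2\<close> can contribute, and
  \<open>E exp (2V) \<le> e\<^sup>1\<^sup>6\<close> prevents the rest from living on an event of tiny probability.
\<close>
lemma prob_dev_large:
  assumes s: "0 < quad Sig w" and n64: "64 \<le> n"
  shows "exp (- 16) \<le> prob {\<omega> \<in> space M. ln (3 / 2) < sqrt (real n) * dev w \<omega>}"
proof -
  define t where "t = 1 / sqrt (real n)"
  define A where "A = {\<omega> \<in> space M. ln (3 / 2) < sqrt (real n) * dev w \<omega>}"
  have n0: "0 < real n" using n by simp
  have sn: "8 \<le> sqrt (real n)" using n64 by (simp add: real_le_rsqrt)
  have t0: "0 \<le> t" and t18: "t \<le> 1 / 8" unfolding t_def using sn n0 by (simp_all add: divide_le_eq)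
  have t2: "t\<^sup>2 * real n = 1" using n0 by (simp add: t_def power_divide)
  have tn: "t * real n = sqrt (real n)" using n0 by (simp add: t_def real_div_sqrt)
  have [measurable]: "dev w \<in> borel_measurable M" by (rule dev_measurable)
  have A[measurable]: "A \<in> events" unfolding A_def by measurable
  let ?V = "\<lambda>\<omega>. t * real n * dev w \<omega>"
  have "ennreal (5 / 2) \<le> ennreal (exp (t\<^sup>2 * real n))"
    unfolding t2 using exp_lower_Taylor_quadratic[of 1] by (intro ennreal_leI) simp
  also have "\<dots> \<le> (\<integral>\<^sup>+\<omega>. ennreal (exp (?V \<omega>)) \<partial>M)"
    by (rule mgf_dev_lower[OF s t0]) (use t18 in simp)
  also have "\<dots> \<le> (\<integral>\<^sup>+\<omega>. (ennreal (3 / 2) + ennreal (exp 16 / 2) * indicator A \<omega>) + ennreal (exp (- 16) / 2) * ennreal (exp ((2 * t) * real n * dev w \<omega>)) \<partial>M)"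
  proof (rule nn_integral_mono)
    fix \<omega> assume sp: "\<omega> \<in> space M"
    define V where "V = ?V \<omega>"
    have e2: "(2 * t) * real n * dev w \<omega> = 2 * V" by (simp add: V_def)
    show "ennreal (exp (?V \<omega>)) \<le> (ennreal (3 / 2) + ennreal (exp 16 / 2) * indicator A \<omega>) + ennreal (exp (- 16) / 2) * ennreal (exp ((2 * t) * real n * dev w \<omega>))"
    proof (cases "\<omega> \<in> A")
      case False
      then have "V \<le> ln (3 / 2)" using sp by (simp add: A_def V_def tn)
      then have "exp V \<le> exp (ln (3 / 2))" by (simp only: exp_le_cancel_iff)
      then have "ennreal (exp V) \<le> ennreal (3 / 2)" by (intro ennreal_leI) simp
      also have "\<dots> \<le> ennreal (3 / 2) + ennreal (exp 16 / 2) * indicator A \<omega> + ennreal (exp (- 16) / 2) * ennreal (exp ((2 * t) * real n * dev w \<omega>))"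
        by (simp add: add_increasing2)
      finally show ?thesis by (simp add: V_def)
    next
      case True
      \<comment> \<open>the weights are such that the term with \<open>exp (2V)\<close> integrates to at most \<open>1/2\<close>\<close>
      have "0 \<le> (exp 8 - exp (- 8) * exp V)\<^sup>2" by simp
      also have "\<dots> = exp 16 - 2 * exp V + exp (- 16) * exp (2 * V)"
        by (simp add: power2_eq_square algebra_simps flip: exp_add)
      finally have "exp V \<le> exp 16 / 2 + exp (- 16) / 2 * exp (2 * V)" by simp
      then have "ennreal (exp V) \<le> ennreal (exp 16 / 2 + exp (- 16) / 2 * exp (2 * V))" by (rule ennreal_leI)
      also have "\<dots> = ennreal (exp 16 / 2) + ennreal (exp (- 16) / 2) * ennreal (exp (2 * V))"
        by (rule ennreal_plus_mult) auto
      also have "\<dots> \<le> ennreal (3 / 2) + ennreal (exp 16 / 2) * indicator A \<omega> + ennreal (exp (- 16) / 2) * ennreal (exp ((2 * t) * real n * dev w \<omega>))"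
        unfolding e2 using True by (intro add_mono) (simp_all add: add_increasing)
      finally show ?thesis by (simp add: V_def)
    qed
  qed
  also have "\<dots> = ennreal (3 / 2) + ennreal (exp 16 / 2) * emeasure M A
     + ennreal (exp (- 16) / 2) * (\<integral>\<^sup>+\<omega>. ennreal (exp ((2 * t) * real n * dev w \<omega>)) \<partial>M)"
    by (simp add: nn_integral_add nn_integral_cmult emeasure_space_1 A)
  also have "\<dots> \<le> ennreal (3 / 2) + ennreal (exp 16 / 2) * ennreal (prob A) + ennreal (exp (- 16) / 2) * ennreal (exp 16)"
  proof -
    have "(\<integral>\<^sup>+\<omega>. ennreal (exp ((2 * t) * real n * dev w \<omega>)) \<partial>M) \<le> ennreal (exp (4 * (2 * t)\<^sup>2 * real n))"
      by (rule mgf_dev_upper[OF s]) (use t0 t18 in simp)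
    also have "4 * (2 * t)\<^sup>2 * real n = 16" using t2 by (simp add: power_mult_distrib mult.assoc)
    finally show ?thesis by (intro add_mono mult_left_mono) (simp_all add: emeasure_eq_measure)
  qed
  also have "\<dots> = ennreal (3 / 2 + exp 16 / 2 * prob A + exp (- 16) / 2 * exp 16)"
  proof -
    have "ennreal (3 / 2) + ennreal (exp 16 / 2) * ennreal (prob A) = ennreal (3 / 2 + exp 16 / 2 * prob A)"
      by (rule ennreal_plus_mult[symmetric]) auto
    moreover have "ennreal (3 / 2 + exp 16 / 2 * prob A) + ennreal (exp (- 16) / 2) * ennreal (exp 16)
        = ennreal (3 / 2 + exp 16 / 2 * prob A + exp (- 16) / 2 * exp 16)"
      by (rule ennreal_plus_mult[symmetric]) auto
    ultimately show ?thesis by (simp only:)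
  qed
  finally have "5 / 2 \<le> 3 / 2 + exp 16 / 2 * prob A + exp (- 16) / 2 * exp 16"
    by (subst (asm) ennreal_le_iff) (auto intro!: add_nonneg_nonneg)
  moreover have "exp (- 16) / 2 * exp 16 = (1/2::real)" by (simp flip: exp_add)
  ultimately have "1 \<le> exp 16 * prob A" by simp
  then have "exp (- 16) * 1 \<le> exp (- 16) * (exp 16 * prob A)" by (intro mult_left_mono) auto
  also have "\<dots> = prob A" by (simp flip: exp_add mult.assoc)
  finally show ?thesis by (simp add: A_def)
qed

text \<open>
  By \<open>S\<^sub>i\<^sub>i - \<Sigma>\<^sub>i\<^sub>i = \<Sigma>\<^sub>i\<^sub>i dev - mean\<^sup>2\<close>, the correction from the sample mean is of order \<open>1/n\<close>
  and takes away half of the deviation only with vanishing probability.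
\<close>
lemma prob_diag_large:
  assumes i: "i < p" and n64: "64 \<le> n"
  shows "exp (- 16) - 2 * exp (- sqrt (real n) * ln (3 / 2) / 4)
    \<le> prob {\<omega> \<in> space M. ln (3 / 2) / 2 * lo \<le> sqrt (real n) * (Smat \<omega> $$ (i, i) - Sig $$ (i, i))}"
proof -
  define s where "s = quad Sig (axis1 i)"
  have s: "0 < s" using quad_axis_pos[OF i i] by (simp add: s_def)
  have slo: "lo \<le> s" using quad_lower[of "axis1 i"] i by (simp add: s_def sum_axis1_sq)
  have ln0: "0 < ln (3 / 2 :: real)" by simp
  \<comment> \<open>if \<open>mean\<^sup>2 < s r\<^sup>2\<close>, the correction costs at most half of \<open>s ln (3/2) / \<surd>n\<close>\<close>
  define r where "r = sqrt (ln (3 / 2) / (2 * sqrt (real n)))"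
  have sn0: "0 < sqrt (real n)" using n by simp
  have r0: "0 \<le> r" using ln0 sn0 by (simp add: r_def)
  have r2: "r\<^sup>2 = ln (3 / 2) / (2 * sqrt (real n))" using ln0 sn0 by (simp add: r_def)
  define A where "A = {\<omega> \<in> space M. ln (3 / 2) < sqrt (real n) * dev (axis1 i) \<omega>}"
  define B where "B = {\<omega> \<in> space M. sqrt s * r \<le> \<bar>mean (axis1 i) \<omega>\<bar>}"
  define G where "G = {\<omega> \<in> space M. ln (3 / 2) / 2 * lo \<le> sqrt (real n) * (Smat \<omega> $$ (i, i) - Sig $$ (i, i))}"
  have [measurable]: "dev (axis1 i) \<in> borel_measurable M" "mean (axis1 i) \<in> borel_measurable M"
    "(\<lambda>\<omega>. Smat \<omega> $$ (i, i)) \<in> borel_measurable M"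
    using dev_measurable mean_measurable Smat_entry_measurable[OF i i] by auto
  have m[measurable]: "A \<in> events" "B \<in> events" "G \<in> events" unfolding A_def B_def G_def by measurable
  have "A \<subseteq> G \<union> B"
  proof
    fix \<omega> assume a: "\<omega> \<in> A"
    show "\<omega> \<in> G \<union> B"
    proof (cases "\<omega> \<in> B")
      case False
      have sp: "\<omega> \<in> space M" using a by (simp add: A_def)
      have "\<bar>mean (axis1 i) \<omega>\<bar> < sqrt s * r" using False sp by (simp add: B_def)
      then have "(mean (axis1 i) \<omega>)\<^sup>2 \<le> (sqrt s * r)\<^sup>2" by (intro power2_le_iff_abs_le[THEN iffD2]) auto
      also have "\<dots> = s * r\<^sup>2" using s by (simp add: power_mult_distrib)
      finally have m2: "sqrt (real n) * (mean (axis1 i) \<omega>)\<^sup>2 \<le> sqrt (real n) * (s * r\<^sup>2)" using sn0 by (intro mult_left_mono) auto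
      have e: "sqrt (real n) * (s * r\<^sup>2) = s * (ln (3 / 2) / 2)" unfolding r2 using sn0 by simp
      have d: "s * ln (3 / 2) \<le> s * (sqrt (real n) * dev (axis1 i) \<omega>)"
        using a s by (intro mult_left_mono) (auto simp: A_def)
      have diag: "Smat \<omega> $$ (i, i) - Sig $$ (i, i) = s * dev (axis1 i) \<omega> - (mean (axis1 i) \<omega>)\<^sup>2"
        using quad_dev[of "axis1 i" \<omega>] s quad_unit[OF Smat_carrier i] quad_unit[OF Sig i] by (simp add: s_def axis1_def)
      have "ln (3 / 2) / 2 * lo \<le> ln (3 / 2) / 2 * s" using slo ln0 by (intro mult_left_mono) auto
      also have "\<dots> = s * ln (3 / 2) - s * (ln (3 / 2) / 2)" by (simp add: algebra_simps)
      also have "\<dots> \<le> s * (sqrt (real n) * dev (axis1 i) \<omega>) - sqrt (real n) * (mean (axis1 i) \<omega>)\<^sup>2"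
        using d m2 e by linarith
      also have "\<dots> = sqrt (real n) * (Smat \<omega> $$ (i, i) - Sig $$ (i, i))" unfolding diag by (simp add: algebra_simps)
      finally show ?thesis using sp by (simp add: G_def)
    qed simp
  qed
  then have "prob A \<le> prob (G \<union> B)" by (rule finite_measure_mono) measurable
  also have "\<dots> \<le> prob G + prob B" by (rule measure_Un_le) measurable
  finally have "prob A \<le> prob G + prob B" .
  moreover have "exp (- 16) \<le> prob A" unfolding A_def by (rule prob_dev_large) (use s n64 in \<open>auto simp: s_def\<close>)
  moreover have "prob B \<le> 2 * exp (- sqrt (real n) * ln (3 / 2) / 4)"
  proof -
    have "real n / sqrt (real n) = sqrt (real n)" using sn0 by (simp add: real_div_sqrt)
    moreover have "real n * r\<^sup>2 = (real n / sqrt (real n)) * ln (3 / 2) / 2" unfolding r2 by simp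
    ultimately have "- real n * r\<^sup>2 / 2 = - sqrt (real n) * ln (3 / 2) / 4" by simp
    moreover have "prob B \<le> 2 * exp (- real n * r\<^sup>2 / 2)"
      unfolding B_def s_def by (rule mean_tail[OF _ r0]) (use s in \<open>simp add: s_def\<close>)
    ultimately show ?thesis by (simp only:)
  qed
  ultimately show ?thesis unfolding G_def[symmetric] by linarith
qed

end

section \<open>Nets of the sphere\<close>

lemma sum_exp_abs_int_le:
  fixes \<epsilon> :: real assumes e: "0 < \<epsilon>" "\<epsilon> \<le> 1"
  shows "(\<Sum>j\<in>{- int R..int R}. exp (- \<epsilon> * real_of_int \<bar>j\<bar>)) \<le> 3 / \<epsilon>"
proof -
  have geo: "(\<Sum>j<m. exp (- \<epsilon>) ^ j) \<le> 1 / (1 - exp (- \<epsilon>))" for m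
  proof -
    have q: "exp (- \<epsilon>) < 1" using e by simp
    have "(\<Sum>j<m. exp (- \<epsilon>) ^ j) = (1 - exp (- \<epsilon>) ^ m) / (1 - exp (- \<epsilon>))"
      using q by (subst sum_gp_strict) auto
    also have "\<dots> \<le> 1 / (1 - exp (- \<epsilon>))" using q by (intro divide_right_mono) auto
    finally show ?thesis .
  qed
  have ind: "(\<Sum>j\<in>{- int R..int R}. exp (- \<epsilon> * real_of_int \<bar>j\<bar>)) = 1 + 2 * (\<Sum>j<R. exp (- \<epsilon>) ^ Suc j)" for R
  proof (induction R)
    case (Suc R)
    have "{- int (Suc R)..int (Suc R)} = insert (- int (Suc R)) (insert (int (Suc R)) {- int R..int R})" by auto
    then have "(\<Sum>j\<in>{- int (Suc R)..int (Suc R)}. exp (- \<epsilon> * real_of_int \<bar>j\<bar>))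
      = 2 * exp (- \<epsilon> * real (Suc R)) + (\<Sum>j\<in>{- int R..int R}. exp (- \<epsilon> * real_of_int \<bar>j\<bar>))"
      by simp
    moreover have "exp (- \<epsilon> * real (Suc R)) = exp (- \<epsilon>) ^ Suc R"
      by (metis exp_of_nat_mult mult.commute)
    ultimately show ?case unfolding Suc by simp
  qed simp
  have "(\<Sum>j<R. exp (- \<epsilon>) ^ Suc j) = exp (- \<epsilon>) * (\<Sum>j<R. exp (- \<epsilon>) ^ j)" by (simp add: sum_distrib_left)
  also have "\<dots> \<le> exp (- \<epsilon>) * (1 / (1 - exp (- \<epsilon>)))" by (intro mult_left_mono geo) simp
  also have "\<dots> = 1 / (exp \<epsilon> - 1)"
  proof -
    have "exp (- \<epsilon>) = 1 / exp \<epsilon>" by (simp add: exp_minus inverse_eq_divide)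
    then show ?thesis using e by (simp add: field_simps)
  qed
  also have "\<dots> \<le> 1 / \<epsilon>"
  proof -
    have "\<epsilon> \<le> exp \<epsilon> - 1" using exp_ge_add_one_self[of \<epsilon>] by linarith
    then show ?thesis using e by (intro divide_left_mono) auto
  qed
  finally have "1 + 2 * (\<Sum>j<R. exp (- \<epsilon>) ^ Suc j) \<le> 1 + 2 / \<epsilon>" by simp
  also have "\<dots> \<le> 3 / \<epsilon>" using e by (simp add: field_simps)
  finally show ?thesis unfolding ind .
qed

text \<open>
  Weight each point by \<open>exp (\<epsilon> (L - |k|\<^sub>1))\<close>, which is at least one on the points that are
  counted, and sum over the whole cube, where the weight factorises. The bound is
  independent of the side of the cube.
\<close>
lemma card_lattice_points_le:
  fixes \<epsilon> :: real assumes e: "0 < \<epsilon>" "\<epsilon> \<le> 1"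
  shows "real (card {k \<in> {..<p} \<rightarrow>\<^sub>E {- int R..int R}. (\<Sum>i<p. \<bar>real_of_int (k i)\<bar>) \<le> real p * (1 / \<epsilon> + 1)})
    \<le> (3 * exp 2 / \<epsilon>) ^ p"
proof -
  let ?P = "{..<p} \<rightarrow>\<^sub>E {- int R..int R}"
  let ?L = "real p * (1 / \<epsilon> + 1)"
  let ?K = "{k \<in> ?P. (\<Sum>i<p. \<bar>real_of_int (k i)\<bar>) \<le> ?L}"
  have finP: "finite ?P" by (intro finite_PiE) auto
  have "real (card ?K) = (\<Sum>k\<in>?K. 1)" by simp
  also have "\<dots> \<le> (\<Sum>k\<in>?K. exp (\<epsilon> * (?L - (\<Sum>i<p. \<bar>real_of_int (k i)\<bar>))))"
    using e by (intro sum_mono) auto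
  also have "\<dots> \<le> (\<Sum>k\<in>?P. exp (\<epsilon> * (?L - (\<Sum>i<p. \<bar>real_of_int (k i)\<bar>))))"
    using finP by (intro sum_mono2) auto
  also have "\<dots> = (\<Sum>k\<in>?P. exp (\<epsilon> * ?L) * (\<Prod>i<p. exp (- \<epsilon> * real_of_int \<bar>k i\<bar>)))"
  proof (rule sum.cong[OF refl])
    fix k :: "nat \<Rightarrow> int"
    have "(\<Prod>i<p. exp (- \<epsilon> * real_of_int \<bar>k i\<bar>)) = exp (\<Sum>i<p. - \<epsilon> * real_of_int \<bar>k i\<bar>)"
      by (rule exp_sum[symmetric]) simp
    also have "(\<Sum>i<p. - \<epsilon> * real_of_int \<bar>k i\<bar>) = - \<epsilon> * (\<Sum>i<p. \<bar>real_of_int (k i)\<bar>)"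
      by (simp only: sum_distrib_left of_int_abs)
    finally show "exp (\<epsilon> * (?L - (\<Sum>i<p. \<bar>real_of_int (k i)\<bar>))) = exp (\<epsilon> * ?L) * (\<Prod>i<p. exp (- \<epsilon> * real_of_int \<bar>k i\<bar>))"
      by (simp add: algebra_simps flip: exp_add)
  qed
  also have "\<dots> = exp (\<epsilon> * ?L) * (\<Prod>i<p. \<Sum>j\<in>{- int R..int R}. exp (- \<epsilon> * real_of_int \<bar>j\<bar>))"
    by (subst prod_sum_PiE) (auto simp: sum_distrib_left)
  also have "\<dots> \<le> exp (\<epsilon> * ?L) * (\<Prod>i<p. 3 / \<epsilon>)"
    by (intro mult_left_mono prod_mono conjI sum_exp_abs_int_le[OF e] sum_nonneg) auto
  also have "\<dots> \<le> exp (2 * real p) * (3 / \<epsilon>) ^ p"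
  proof -
    have "\<epsilon> * ?L = real p * (1 + \<epsilon>)" using e by (simp add: field_simps)
    also have "\<dots> \<le> real p * 2" using e by (intro mult_left_mono) auto
    finally have "exp (\<epsilon> * ?L) \<le> exp (2 * real p)" by (simp add: mult.commute)
    then show ?thesis using e by (auto intro!: mult_right_mono)
  qed
  also have "\<dots> = (3 * exp 2 / \<epsilon>) ^ p"
    by (simp add: power_mult_distrib power_divide mult.commute flip: exp_of_nat_mult)
  finally show ?thesis .
qed

text \<open>
  Round the coordinates of a unit vector down to multiples of \<open>h = \<epsilon>/\<surd>p\<close>. The error is at
  most \<open>\<epsilon>\<close>, and the vector \<open>k\<close> of multiples satisfies \<open>|k|\<^sub>1 \<le> \<surd>p/h + p = p (1/\<epsilon> + 1)\<close> by the
  Cauchy-Schwarz inequality. The points of the net need not be unit vectors.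
\<close>
lemma ex_sphere_net:
  fixes \<epsilon> :: real
  assumes p: "0 < p" and e: "0 < \<epsilon>" "\<epsilon> \<le> 1 / 2"
  shows "\<exists>N :: (nat \<Rightarrow> real) set. finite N \<and> real (card N) \<le> (3 * exp 2 / \<epsilon>) ^ p \<and>
    (\<forall>w\<in>N. 1 / 2 \<le> L2_set w {..<p} \<and> L2_set w {..<p} \<le> 3 / 2) \<and>
    (\<forall>v. L2_set v {..<p} = 1 \<longrightarrow> (\<exists>w\<in>N. L2_set (\<lambda>i. v i - w i) {..<p} \<le> \<epsilon>))"
proof -
  define h where "h = \<epsilon> / sqrt (real p)"
  have sp: "0 < sqrt (real p)" using p by simp
  have h: "0 < h" using e sp by (simp add: h_def)
  define R where "R = nat \<lceil>1 / h + 1\<rceil>"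
  define K where "K = {k \<in> {..<p} \<rightarrow>\<^sub>E {- int R..int R}. (\<Sum>i<p. \<bar>real_of_int (k i)\<bar>) \<le> real p * (1 / \<epsilon> + 1)}"
  have finK: "finite K" unfolding K_def by (intro finite_subset[OF _ finite_PiE[of "{..<p}" "\<lambda>_. {- int R..int R}"]]) auto
  define N where "N = {w \<in> (\<lambda>k i. h * real_of_int (k i)) ` K. 1 / 2 \<le> L2_set w {..<p} \<and> L2_set w {..<p} \<le> 3 / 2}"
  have finN: "finite N" unfolding N_def using finK by simp
  have "card N \<le> card ((\<lambda>k i. h * real_of_int (k i)) ` K)" unfolding N_def using finK by (intro card_mono) auto
  also have "\<dots> \<le> card K" using finK by (rule card_image_le)
  finally have "real (card N) \<le> real (card K)" by simp
  also have "\<dots> \<le> (3 * exp 2 / \<epsilon>) ^ p" unfolding K_def by (rule card_lattice_points_le) (use e in auto)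
  finally have cardN: "real (card N) \<le> (3 * exp 2 / \<epsilon>) ^ p" .
  have cover: "\<exists>w\<in>N. L2_set (\<lambda>i. v i - w i) {..<p} \<le> \<epsilon>" if v: "L2_set v {..<p} = 1" for v
  proof -
    define k where "k = (\<lambda>i\<in>{..<p}. \<lfloor>v i / h\<rfloor>)"
    define w where "w = (\<lambda>i. h * real_of_int (k i))"
    have fl: "real_of_int \<lfloor>x\<rfloor> \<le> x" "x - 1 \<le> real_of_int \<lfloor>x\<rfloor>" for x :: real by linarith+
    have ki: "\<bar>real_of_int (k i)\<bar> \<le> \<bar>v i\<bar> / h + 1" if "i < p" for i
    proof -
      have "\<bar>v i\<bar> / h = \<bar>v i / h\<bar>" using h by simp
      moreover have "\<bar>real_of_int \<lfloor>v i / h\<rfloor>\<bar> \<le> \<bar>v i / h\<bar> + 1" using fl[of "v i / h"] by linarith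
      ultimately have "\<bar>real_of_int \<lfloor>v i / h\<rfloor>\<bar> \<le> \<bar>v i\<bar> / h + 1" by (simp only:)
      then show ?thesis using that by (simp add: k_def)
    qed
    have close: "\<bar>v i - w i\<bar> \<le> h" if "i < p" for i
    proof -
      have "v i - w i = h * (v i / h - real_of_int \<lfloor>v i / h\<rfloor>)" using h that by (simp add: w_def k_def field_simps)
      moreover have "\<bar>v i / h - real_of_int \<lfloor>v i / h\<rfloor>\<bar> \<le> 1" using fl[of "v i / h"] by linarith
      ultimately show ?thesis using h by (simp add: abs_mult)
    qed
    have "L2_set (\<lambda>i. v i - w i) {..<p} \<le> sqrt (\<Sum>i<p. h\<^sup>2)"
      unfolding L2_set_def
    proof (intro real_sqrt_le_mono sum_mono)
      fix i assume "i \<in> {..<p}"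
      then show "(v i - w i)\<^sup>2 \<le> h\<^sup>2" using close[of i] h by (intro power2_le_iff_abs_le[THEN iffD2]) auto
    qed
    also have "\<dots> = \<epsilon>"
      using e sp by (simp add: h_def power_divide real_sqrt_mult)
    finally have d: "L2_set (\<lambda>i. v i - w i) {..<p} \<le> \<epsilon>" .
    have "L2_set v {..<p} \<le> L2_set (\<lambda>i. v i - w i) {..<p} + L2_set w {..<p}"
      using L2_set_triangle_ineq[of "\<lambda>i. v i - w i" w "{..<p}"] by simp
    then have lowN: "1 / 2 \<le> L2_set w {..<p}" using v d e by linarith
    have "L2_set w {..<p} \<le> L2_set (\<lambda>i. w i - v i) {..<p} + L2_set v {..<p}"
      using L2_set_triangle_ineq[of "\<lambda>i. w i - v i" v "{..<p}"] by simp
    moreover have "L2_set (\<lambda>i. w i - v i) {..<p} = L2_set (\<lambda>i. v i - w i) {..<p}"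
      unfolding L2_set_def by (simp add: power2_commute)
    ultimately have upN: "L2_set w {..<p} \<le> 3 / 2" using v d e by linarith
    have kK: "k \<in> K"
    proof -
      have "k i \<in> {- int R..int R}" if i: "i < p" for i
      proof -
        have "\<bar>v i\<bar> \<le> 1"
        proof -
          have "(v i)\<^sup>2 \<le> (\<Sum>i<p. (v i)\<^sup>2)" using i by (intro member_le_sum) auto
          then have "sqrt ((v i)\<^sup>2) \<le> L2_set v {..<p}" unfolding L2_set_def by (rule real_sqrt_le_mono)
          then show ?thesis using v by simp
        qed
        then have "\<bar>v i\<bar> / h + 1 \<le> 1 / h + 1" using h by (simp add: divide_right_mono)
        then have "\<bar>real_of_int (k i)\<bar> \<le> 1 / h + 1" using ki[OF i] by linarith
        also have "\<dots> \<le> real_of_int (int R)"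
        proof -
          have "1 / h + 1 \<le> real R" unfolding R_def by (rule real_nat_ceiling_ge)
          then show ?thesis by simp
        qed
        finally have "\<bar>k i\<bar> \<le> int R" by (simp only: of_int_abs[symmetric] of_int_le_iff)
        then show ?thesis by auto
      qed
      then have "k \<in> {..<p} \<rightarrow>\<^sub>E {- int R..int R}" by (auto simp: PiE_iff k_def)
      moreover have "(\<Sum>i<p. \<bar>real_of_int (k i)\<bar>) \<le> real p * (1 / \<epsilon> + 1)"
      proof -
        have "(\<Sum>i<p. \<bar>real_of_int (k i)\<bar>) \<le> (\<Sum>i<p. \<bar>v i\<bar> / h + 1)" by (intro sum_mono ki) auto
        also have "\<dots> = (\<Sum>i<p. \<bar>v i\<bar>) / h + real p" by (simp add: sum.distrib sum_divide_distrib)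
        also have "(\<Sum>i<p. \<bar>v i\<bar>) \<le> sqrt (real p)"
          using L2_set_mult_ineq[of v "\<lambda>_. 1" "{..<p}"] v by (simp add: L2_set_def)
        finally have "(\<Sum>i<p. \<bar>real_of_int (k i)\<bar>) \<le> sqrt (real p) / h + real p" using h by (simp add: divide_right_mono)
        also have "sqrt (real p) / h = real p / \<epsilon>" using sp by (simp add: h_def)
        finally show ?thesis by (simp add: algebra_simps)
      qed
      ultimately show ?thesis by (simp add: K_def)
    qed
    then have "w \<in> N" unfolding N_def using lowN upN by (auto simp: w_def)
    then show ?thesis using d by blast
  qed
  show ?thesis using finN cardN cover by (intro exI[of _ N]) (auto simp: N_def)
qed

text \<open>
  Split a unit vector into a point of the net and an error of norm at most \<open>1/2\<close>, and bound
  the seminorm of the error in the same way: the bounds sum to \<open>b + b/2 + b/4 + \<dots> = 2b\<close>. The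
  crude bound \<open>F\<close> starts the iteration and disappears in the limit.
\<close>
lemma seminorm_net_bound:
  fixes f :: "(nat \<Rightarrow> real) \<Rightarrow> real"
  assumes sub: "\<And>u v. f u \<le> f v + f (\<lambda>i. u i - v i)"
    and hom: "\<And>c u. f (\<lambda>i. c * u i) = \<bar>c\<bar> * f u"
    and crude: "\<And>u. f u \<le> F * L2_set u {..<p}"
    and net: "\<And>v. L2_set v {..<p} = 1 \<Longrightarrow> \<exists>w\<in>N. L2_set (\<lambda>i. v i - w i) {..<p} \<le> 1 / 2"
    and b: "\<And>w. w \<in> N \<Longrightarrow> f w \<le> b" and b0: "0 \<le> b"
  shows "f u \<le> 2 * b * L2_set u {..<p}"
proof -
  have scale: "f u \<le> c * L2_set u {..<p}" if "\<And>v. L2_set v {..<p} = 1 \<Longrightarrow> f v \<le> c" for c u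
  proof (cases "L2_set u {..<p} = 0")
    case True
    then show ?thesis using crude[of u] by simp
  next
    case False
    define r where "r = L2_set u {..<p}"
    have r: "0 < r" using False by (simp add: r_def order_less_le)
    have "L2_set (\<lambda>i. (1 / r) * u i) {..<p} = (1 / r) * L2_set u {..<p}"
      using r by (intro L2_set_right_distrib[symmetric]) simp
    then have "L2_set (\<lambda>i. (1 / r) * u i) {..<p} = 1" using r by (simp add: r_def)
    from that[OF this] have "(1 / r) * f u \<le> c" unfolding hom using r by simp
    then show ?thesis unfolding r_def[symmetric] using r by (simp add: field_simps)
  qed
  have iter: "f u \<le> (2 * b + \<bar>F\<bar> * (1 / 2) ^ m) * L2_set u {..<p}" for m u
  proof (induction m arbitrary: u)
    case 0
    have "F * L2_set u {..<p} \<le> (2 * b + \<bar>F\<bar>) * L2_set u {..<p}"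
      using b0 by (intro mult_right_mono) auto
    then show ?case using crude[of u] by simp
  next
    case (Suc m)
    let ?c = "2 * b + \<bar>F\<bar> * (1 / 2) ^ m"
    have c0: "0 \<le> ?c" using b0 by simp
    show ?case
    proof (rule scale)
      fix v :: "nat \<Rightarrow> real" assume v: "L2_set v {..<p} = 1"
      obtain w where w: "w \<in> N" "L2_set (\<lambda>i. v i - w i) {..<p} \<le> 1 / 2" using net[OF v] by blast
      have "f v \<le> b + f (\<lambda>i. v i - w i)" using sub[of v w] b[OF w(1)] by linarith
      also have "f (\<lambda>i. v i - w i) \<le> ?c * L2_set (\<lambda>i. v i - w i) {..<p}" by (rule Suc.IH)
      also have "\<dots> \<le> ?c * (1 / 2)" by (rule mult_left_mono[OF w(2) c0])
      also have "b + ?c * (1 / 2) = 2 * b + \<bar>F\<bar> * (1 / 2) ^ Suc m" by simp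
      finally show "f v \<le> 2 * b + \<bar>F\<bar> * (1 / 2) ^ Suc m" by simp
    qed
  qed
  have "(\<lambda>m. (2 * b + \<bar>F\<bar> * (1 / 2) ^ m) * L2_set u {..<p}) \<longlonglongrightarrow> (2 * b + \<bar>F\<bar> * 0) * L2_set u {..<p}"
    by (intro tendsto_intros LIMSEQ_realpow_zero) auto
  then have "f u \<le> (2 * b + \<bar>F\<bar> * 0) * L2_set u {..<p}"
    by (rule LIMSEQ_le_const) (use iter in blast)
  then show ?thesis by simp
qed

section \<open>Extreme eigenvalues of the sample covariance\<close>

lemma L2_set_sq: "(L2_set f A)\<^sup>2 = (\<Sum>i\<in>A. (f i)\<^sup>2)"
  unfolding L2_set_def by (intro real_sqrt_pow2 sum_nonneg) simp

context gauss_sample begin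

lemma proj_diff: "proj (\<lambda>i. u i - v i) l \<omega> = proj u l \<omega> - proj v l \<omega>"
  unfolding proj_def by (simp add: left_diff_distrib sum_subtractf)

lemma proj_scale: "proj (\<lambda>i. c * u i) l \<omega> = c * proj u l \<omega>"
  unfolding proj_def by (simp add: sum_distrib_left mult.assoc)

lemma quad_Sig_net_bounds:
  assumes "1 / 2 \<le> L2_set w {..<p}" "L2_set w {..<p} \<le> 3 / 2"
  shows "lo / 4 \<le> quad Sig w" "quad Sig w \<le> 9 / 4 * hi" "0 < quad Sig w"
proof -
  have "(1 / 2)\<^sup>2 \<le> (L2_set w {..<p})\<^sup>2" using assms by (intro power_mono) auto
  then have a: "1 / 4 \<le> (\<Sum>i<p. (w i)\<^sup>2)" unfolding L2_set_sq by (simp add: power2_eq_square)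
  have "(L2_set w {..<p})\<^sup>2 \<le> (3 / 2)\<^sup>2" using assms by (intro power_mono) auto
  then have b: "(\<Sum>i<p. (w i)\<^sup>2) \<le> 9 / 4" unfolding L2_set_sq by (simp add: power2_eq_square)
  have "lo * (1 / 4) \<le> lo * (\<Sum>i<p. (w i)\<^sup>2)" using a lo by (intro mult_left_mono) auto
  then show l: "lo / 4 \<le> quad Sig w" using quad_lower[of w] by simp
  have "hi * (\<Sum>i<p. (w i)\<^sup>2) \<le> hi * (9 / 4)" using b hi_pos by (intro mult_left_mono) auto
  then show "quad Sig w \<le> 9 / 4 * hi" using quad_upper[of w] by simp
  show "0 < quad Sig w" using l lo by linarith
qed

lemma exp_4_ge: "24 \<le> exp (4 :: real)"
proof -
  have "5 \<le> exp (2 :: real)" using exp_lower_Taylor_quadratic[of 2] by simp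
  then have "5 * 5 \<le> exp (2 :: real) * exp 2" by (intro mult_mono) auto
  then show ?thesis by (simp flip: exp_add)
qed

text \<open>
  The squared length on the left is \<open>n\<close> times the empirical second moment around \<open>\<mu>\<close>, which
  dominates \<open>u\<^sup>T S u\<close>. A union bound controls it on a \<open>1/2\<close>-net, and \<open>seminorm_net_bound\<close>
  extends the bound to all vectors.
\<close>
lemma op_norm_event:
  assumes pn: "p \<le> n"
  shows "\<exists>F\<in>events. prob F \<le> (1 / 2) ^ n \<and>
    (\<forall>\<omega>\<in>space M - F. \<forall>u. L2_set (\<lambda>l. proj u l \<omega>) {1..n} \<le> sqrt (216 * hi * real n) * L2_set u {..<p})"
proof -
  obtain N where finN: "finite N" and cardN: "real (card N) \<le> (3 * exp 2 / (1 / 2)) ^ p"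
    and bdN: "\<And>w. w \<in> N \<Longrightarrow> 1 / 2 \<le> L2_set w {..<p} \<and> L2_set w {..<p} \<le> 3 / 2"
    and net: "\<And>v. L2_set v {..<p} = 1 \<Longrightarrow> \<exists>w\<in>N. L2_set (\<lambda>i. v i - w i) {..<p} \<le> 1 / 2"
    using ex_sphere_net[OF p, of "1 / 2"] by auto
  define T where "T = (\<lambda>w \<omega>. \<Sum>l\<in>{1..n}. (proj w l \<omega>)\<^sup>2)"
  have Tm[measurable]: "T w \<in> borel_measurable M" for w
    unfolding T_def using sum_proj_sq_measurable[of w 0] by simp
  \<comment> \<open>The factor \<open>1/(9 hi)\<close> keeps the exponential moment below \<open>2\<^sup>n\<close> on the net, where the
  variance is at most \<open>9 hi/4\<close>. The level \<open>6 n\<close> beats the size \<open>(6 e\<^sup>2)\<^sup>n\<close> of the net: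
  \<open>6 e\<^sup>2 \<cdot> 2 e\<^sup>-\<^sup>6 = 12 e\<^sup>-\<^sup>4 \<le> 1/2\<close>.\<close>
  define B where "B = (\<lambda>w. {\<omega> \<in> space M. 6 * real n \<le> 1 / (9 * hi) * T w \<omega>})"
  have Bm: "B w \<in> events" for w unfolding B_def by measurable
  have pB: "prob (B w) \<le> (2 * exp (- 6)) ^ n" if w: "w \<in> N" for w
  proof -
    note q = quad_Sig_net_bounds[OF bdN[OF w, THEN conjunct1] bdN[OF w, THEN conjunct2]]
    have le: "2 * (1 / (9 * hi)) * quad Sig w \<le> 1 / 2"
      using q(2) hi_pos by (simp add: field_simps)
    define r where "r = sqrt (1 - 2 * (1 / (9 * hi)) * quad Sig w)"
    have "sqrt ((1 / 2)\<^sup>2) \<le> r" unfolding r_def using le by (intro real_sqrt_le_mono) (simp add: power2_eq_square)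
    then have r: "1 / 2 \<le> r" by simp
    then have r': "1 / r \<le> 2" "0 \<le> 1 / r" by (simp_all add: field_simps)
    have "prob (B w) \<le> (1 / r) ^ n * exp (- (6 * real n))"
      unfolding B_def
    proof (rule prob_exp_le)
      show "(\<integral>\<^sup>+\<omega>. ennreal (exp (1 / (9 * hi) * T w \<omega>)) \<partial>M) \<le> ennreal ((1 / r) ^ n)"
        unfolding T_def r_def using mgf_square[OF q(3), of "1 / (9 * hi)"] le by simp
    qed (use r' in auto)
    also have "\<dots> \<le> 2 ^ n * exp (- (6 * real n))" using r' by (intro mult_right_mono power_mono) auto
    also have "\<dots> = (2 * exp (- 6)) ^ n" by (simp add: power_mult_distrib mult.commute flip: exp_of_nat_mult)
    finally show ?thesis .
  qed
  define F where "F = (\<Union>w\<in>N. B w)"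
  have Fm: "F \<in> events" unfolding F_def using finN Bm by auto
  have "prob F \<le> (\<Sum>w\<in>N. prob (B w))"
    unfolding F_def by (rule finite_measure_subadditive_finite) (use finN Bm in auto)
  also have "\<dots> \<le> (\<Sum>w\<in>N. (2 * exp (- 6)) ^ n)" by (intro sum_mono pB)
  also have "\<dots> = real (card N) * (2 * exp (- 6)) ^ n" by simp
  also have "\<dots> \<le> (6 * exp 2) ^ p * (2 * exp (- 6)) ^ n" using cardN by (intro mult_right_mono) auto
  also have "\<dots> \<le> (6 * exp 2) ^ n * (2 * exp (- 6)) ^ n"
  proof -
    have "1 \<le> exp (2::real)" by simp
    then have "1 \<le> 6 * exp (2 :: real)" by linarith
    then show ?thesis using pn by (intro mult_right_mono power_increasing) auto
  qed
  also have "\<dots> = (12 * exp (- 4)) ^ n"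
  proof -
    have "exp 2 * exp (- 6) = exp (- 4 :: real)" unfolding exp_add[symmetric] by simp
    then have "6 * exp 2 * (2 * exp (- 6)) = 12 * exp (- 4 :: real)" by simp
    then show ?thesis unfolding power_mult_distrib[symmetric] by (simp only:)
  qed
  also have "\<dots> \<le> (1 / 2) ^ n"
  proof (rule power_mono)
    show "12 * exp (- 4) \<le> (1 / 2 :: real)" using exp_4_ge by (simp add: exp_minus field_simps)
  qed simp
  finally have pF: "prob F \<le> (1 / 2) ^ n" .
  have "L2_set (\<lambda>l. proj u l \<omega>) {1..n} \<le> sqrt (216 * hi * real n) * L2_set u {..<p}"
    if \<omega>: "\<omega> \<in> space M - F" for \<omega> u
  proof -
    let ?f = "\<lambda>u. L2_set (\<lambda>l. proj u l \<omega>) {1..n}"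
    \<comment> \<open>\<open>54 = 6 \<cdot> 9\<close>; the passage from the net to all vectors doubles the bound, whence
    \<open>216 = 2\<^sup>2 \<cdot> 54\<close>\<close>
    let ?b = "sqrt (54 * hi * real n)"
    let ?F = "\<Sum>l\<in>{1..n}. L2_set (\<lambda>i. X l \<omega> i - vec_index \<mu> i) {..<p}"
    have "?f u \<le> 2 * ?b * L2_set u {..<p}"
    proof (rule seminorm_net_bound[where N = N and F = ?F])
      fix u v :: "nat \<Rightarrow> real"
      show "?f u \<le> ?f v + ?f (\<lambda>i. u i - v i)"
        using L2_set_triangle_ineq[of "\<lambda>l. proj v l \<omega>" "\<lambda>l. proj (\<lambda>i. u i - v i) l \<omega>" "{1..n}"]
        by (simp add: proj_diff)
    next
      fix c :: real and u :: "nat \<Rightarrow> real"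
      show "?f (\<lambda>i. c * u i) = \<bar>c\<bar> * ?f u"
        unfolding proj_scale L2_set_def by (simp add: power_mult_distrib real_sqrt_mult flip: sum_distrib_left)
    next
      fix u :: "nat \<Rightarrow> real"
      have "?f u \<le> (\<Sum>l\<in>{1..n}. \<bar>proj u l \<omega>\<bar>)" by (rule L2_set_le_sum_abs)
      also have "\<dots> \<le> (\<Sum>l\<in>{1..n}. L2_set (\<lambda>i. X l \<omega> i - vec_index \<mu> i) {..<p} * L2_set u {..<p})"
      proof (rule sum_mono)
        fix l
        have "\<bar>proj u l \<omega>\<bar> \<le> (\<Sum>i<p. \<bar>X l \<omega> i - vec_index \<mu> i\<bar> * \<bar>u i\<bar>)"
          unfolding proj_def by (rule order_trans[OF sum_abs]) (simp add: abs_mult mult.commute)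
        also have "\<dots> \<le> L2_set (\<lambda>i. X l \<omega> i - vec_index \<mu> i) {..<p} * L2_set u {..<p}"
          by (rule L2_set_mult_ineq)
        finally show "\<bar>proj u l \<omega>\<bar> \<le> L2_set (\<lambda>i. X l \<omega> i - vec_index \<mu> i) {..<p} * L2_set u {..<p}" .
      qed
      finally show "?f u \<le> ?F * L2_set u {..<p}" by (simp only: sum_distrib_right)
    next
      fix w assume w: "w \<in> N"
      then have "\<omega> \<notin> B w" using \<omega> by (auto simp: F_def)
      then have "1 / (9 * hi) * T w \<omega> < 6 * real n" using \<omega> by (simp add: B_def not_le)
      then have "T w \<omega> \<le> 54 * hi * real n" using hi_pos by (simp add: field_simps)
      then show "?f w \<le> ?b" unfolding T_def L2_set_def by (rule real_sqrt_le_mono)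
    qed (use net hi_pos in auto)
    also have "2 * ?b = sqrt (216 * hi * real n)"
    proof -
      have "sqrt (216 * hi * real n) = sqrt (2\<^sup>2 * (54 * hi * real n))" by simp
      also have "\<dots> = 2 * ?b" by (subst real_sqrt_mult) simp
      finally show ?thesis by simp
    qed
    finally show ?thesis .
  qed
  then show ?thesis using Fm pF by (intro bexI[of _ F]) auto
qed

lemma quad_Smat_nonneg: "0 \<le> quad (Smat \<omega>) w"
  unfolding quad_Smat_centered by (intro divide_nonneg_nonneg sum_nonneg) auto

lemma exp_half_le_2: "exp (1 / 2 :: real) \<le> 2"
proof (rule power2_le_imp_le)
  have "(exp (1 / 2 :: real))\<^sup>2 = exp 1" by (simp flip: exp_double)
  also have "\<dots> \<le> 3" by (rule exp_le)
  finally show "(exp (1 / 2 :: real))\<^sup>2 \<le> 2\<^sup>2" by simp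
qed simp

text \<open>
  A direction \<open>v\<close> with small \<open>v\<^sup>T S v\<close> has all \<open>\<langle>v, X\<^sub>l - \<mu>\<rangle>\<close> close, in the mean square, to
  one constant, their average. Move \<open>v\<close> to a point of an \<open>\<epsilon>\<close>-net and the constant to a grid
  covering \<open>[-\<surd>K, \<surd>K]\<close> with mesh \<open>\<epsilon>\<surd>K\<close>; the operator norm bound controls the error. For
  fixed direction and constant the event has probability of order \<open>\<epsilon>\<^sup>n\<close> by the boundedness of
  the normal density.
\<close>
lemma lower_event:
  assumes e: "0 < \<epsilon>" "\<epsilon> \<le> 1 / 2" and K: "K = 216 * hi"
  shows "\<exists>F\<in>events. prob F \<le> (3 * exp 2 / \<epsilon>) ^ p * (4 / \<epsilon>) * (16 * \<epsilon> * sqrt K / sqrt lo) ^ n \<and>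
    (\<forall>\<omega>\<in>space M - F. (\<forall>u. L2_set (\<lambda>l. proj u l \<omega>) {1..n} \<le> sqrt (K * real n) * L2_set u {..<p})
       \<longrightarrow> (\<forall>u. 4 * \<epsilon>\<^sup>2 * K * (\<Sum>i<p. (u i)\<^sup>2) \<le> quad (Smat \<omega>) u))"
proof -
  have K0: "0 < K" using hi_pos by (simp add: K)
  have sK: "0 < sqrt K" using K0 by simp
  obtain N where finN: "finite N" and cardN: "real (card N) \<le> (3 * exp 2 / \<epsilon>) ^ p"
    and bdN: "\<And>w. w \<in> N \<Longrightarrow> 1 / 2 \<le> L2_set w {..<p} \<and> L2_set w {..<p} \<le> 3 / 2"
    and net: "\<And>v. L2_set v {..<p} = 1 \<Longrightarrow> \<exists>w\<in>N. L2_set (\<lambda>i. v i - w i) {..<p} \<le> \<epsilon>"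
    using ex_sphere_net[OF p e] by auto
  define h where "h = \<epsilon> * sqrt K"
  have h: "0 < h" using e sK by (simp add: h_def)
  define J where "J = nat \<lceil>1 / \<epsilon>\<rceil>"
  have J1: "1 / \<epsilon> \<le> real J" unfolding J_def by (rule real_nat_ceiling_ge)
  have iJ: "int J = \<lceil>1 / \<epsilon>\<rceil>"
  proof -
    have "0 < 1 / \<epsilon>" using e by simp
    then have "0 \<le> \<lceil>1 / \<epsilon>\<rceil>" by linarith
    then show ?thesis unfolding J_def by (rule nat_0_le)
  qed
  have J2: "real J \<le> 1 / \<epsilon> + 1"
  proof -
    have "real J = real_of_int \<lceil>1 / \<epsilon>\<rceil>" using iJ by (metis of_int_of_nat_eq)
    then show ?thesis by linarith
  qed
  define C where "C = (\<lambda>j. h * real_of_int j) ` {- int J..int J}"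
  have finC: "finite C" by (simp add: C_def)
  have cardC: "real (card C) \<le> 4 / \<epsilon>"
  proof -
    have "card C \<le> card {- int J..int J}" unfolding C_def by (rule card_image_le) simp
    then have "real (card C) \<le> 2 * real J + 1" by simp
    also have "\<dots> \<le> 2 / \<epsilon> + 3" using J2 by simp
    also have "\<dots> \<le> 4 / \<epsilon>" using e by (simp add: field_simps)
    finally show ?thesis .
  qed
  \<comment> \<open>rounding the direction and rounding the constant cost \<open>h\<close> each, so that \<open>2 h\<close> is left of
  \<open>4 h\<close>\<close>
  define r where "r = 4 * h"
  have r: "0 < r" using h by (simp add: r_def)
  \<comment> \<open>then \<open>\<theta> T \<le> n/2\<close> says that the mean square of the residuals is at most \<open>r\<^sup>2\<close>\<close>
  define \<theta> where "\<theta> = 1 / (2 * r\<^sup>2)"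
  have th: "0 < \<theta>" using r by (simp add: \<theta>_def)
  define T where "T = (\<lambda>w c \<omega>. \<Sum>l\<in>{1..n}. (proj w l \<omega> - c)\<^sup>2)"
  have Tm[measurable]: "T w c \<in> borel_measurable M" for w c
    unfolding T_def by (rule sum_proj_sq_measurable)
  define B where "B = (\<lambda>w c. {\<omega> \<in> space M. - (real n / 2) \<le> - \<theta> * T w c \<omega>})"
  have Bm: "B w c \<in> events" for w c unfolding B_def by measurable
  have pB: "prob (B w c) \<le> (16 * \<epsilon> * sqrt K / sqrt lo) ^ n" if w: "w \<in> N" for w c
  proof -
    note q = quad_Sig_net_bounds[OF bdN[OF w, THEN conjunct1] bdN[OF w, THEN conjunct2]]
    let ?s = "quad Sig w"
    have "sqrt (2 * \<theta>) = 1 / r" using r by (simp add: \<theta>_def real_sqrt_divide)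
    then have e1: "1 / (sqrt ?s * sqrt (2 * \<theta>)) = r / sqrt ?s" by simp
    have "prob (B w c) \<le> (r / sqrt ?s) ^ n * exp (- (- (real n / 2)))"
      unfolding B_def
    proof (rule prob_exp_le)
      show "(\<integral>\<^sup>+\<omega>. ennreal (exp (- \<theta> * T w c \<omega>)) \<partial>M) \<le> ennreal ((r / sqrt ?s) ^ n)"
        using mgf_small_ball[OF q(3) th, of c] unfolding e1 T_def .
    qed (use r q in auto)
    also have "\<dots> = (r / sqrt ?s * exp (1 / 2)) ^ n"
    proof -
      have "exp (1 / 2 :: real) ^ n = exp (real n / 2)" using exp_of_nat_mult[of n "1 / 2 :: real"] by simp
      then show ?thesis by (simp only: power_mult_distrib minus_minus)
    qed
    also have "\<dots> \<le> (16 * \<epsilon> * sqrt K / sqrt lo) ^ n"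
    proof (rule power_mono)
      have "sqrt (lo / 4) \<le> sqrt ?s" by (rule real_sqrt_le_mono[OF q(1)])
      then have sl: "sqrt lo / 2 \<le> sqrt ?s" by (simp add: real_sqrt_divide)
      have sl0: "0 < sqrt lo / 2" using lo by simp
      have "r / sqrt ?s \<le> r / (sqrt lo / 2)"
        by (rule divide_left_mono[OF sl _ mult_pos_pos[OF _ sl0]]) (use r q(3) in auto)
      then have "r / sqrt ?s * exp (1 / 2) \<le> r / (sqrt lo / 2) * 2"
        using exp_half_le_2 r lo q(3) by (intro mult_mono) auto
      also have "\<dots> = 16 * \<epsilon> * sqrt K / sqrt lo" by (simp add: r_def h_def)
      finally show "r / sqrt ?s * exp (1 / 2) \<le> 16 * \<epsilon> * sqrt K / sqrt lo" .
    qed (use r q in auto)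
    finally show ?thesis .
  qed
  define F where "F = (\<Union>x\<in>N \<times> C. B (fst x) (snd x))"
  have Fm: "F \<in> events" unfolding F_def using finN finC Bm by auto
  let ?q = "(16 * \<epsilon> * sqrt K / sqrt lo) ^ n"
  have q0: "0 \<le> ?q" using e K0 lo by simp
  have "prob F \<le> (\<Sum>x\<in>N \<times> C. prob (B (fst x) (snd x)))"
    unfolding F_def by (rule finite_measure_subadditive_finite) (use finN finC Bm in auto)
  also have "\<dots> \<le> (\<Sum>x\<in>N \<times> C. ?q)" by (intro sum_mono pB) auto
  also have "\<dots> = real (card N) * real (card C) * ?q" by (simp add: card_cartesian_product)
  also have "\<dots> \<le> (3 * exp 2 / \<epsilon>) ^ p * (4 / \<epsilon>) * ?q"
    using cardN cardC q0 e by (intro mult_right_mono mult_mono) auto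
  finally have pF: "prob F \<le> (3 * exp 2 / \<epsilon>) ^ p * (4 / \<epsilon>) * ?q" .
  have "4 * \<epsilon>\<^sup>2 * K * (\<Sum>i<p. (u i)\<^sup>2) \<le> quad (Smat \<omega>) u"
    if \<omega>: "\<omega> \<in> space M - F" and op: "\<And>u. L2_set (\<lambda>l. proj u l \<omega>) {1..n} \<le> sqrt (K * real n) * L2_set u {..<p}" for \<omega> u
  proof -
    have unit: "4 * \<epsilon>\<^sup>2 * K \<le> quad (Smat \<omega>) v" if v: "L2_set v {..<p} = 1" for v
    proof -
      define c where "c = mean v \<omega>"
      have sn: "0 < sqrt (real n)" using n by simp
      have "c\<^sup>2 \<le> (\<Sum>l\<in>{1..n}. (proj v l \<omega>)\<^sup>2) / real n"
        using quad_Smat_nonneg[of \<omega> v] unfolding quad_Smat c_def by simp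
      also have "\<dots> \<le> K"
      proof -
        have "(L2_set (\<lambda>l. proj v l \<omega>) {1..n})\<^sup>2 \<le> (sqrt (K * real n))\<^sup>2"
          using op[of v] v by (intro power_mono) auto
        then have "(\<Sum>l\<in>{1..n}. (proj v l \<omega>)\<^sup>2) \<le> K * real n" unfolding L2_set_sq using K0 by simp
        then show ?thesis using n by (simp add: divide_le_eq)
      qed
      finally have "sqrt (c\<^sup>2) \<le> sqrt K" by (rule real_sqrt_le_mono)
      then have cK: "\<bar>c\<bar> \<le> sqrt K" by simp
      define j where "j = \<lfloor>c / h\<rfloor>"
      have ch: "\<bar>c / h\<bar> \<le> 1 / \<epsilon>"
      proof -
        have "\<bar>c / h\<bar> = \<bar>c\<bar> / h" using h by simp
        also have "\<dots> \<le> sqrt K / h" using cK h by (simp add: divide_right_mono)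
        also have "\<dots> = 1 / \<epsilon>" using sK by (simp add: h_def)
        finally show ?thesis .
      qed
      have ch': "c / h \<le> 1 / \<epsilon>" "- (1 / \<epsilon>) \<le> c / h" using ch by linarith+
      have "j \<le> \<lfloor>1 / \<epsilon>\<rfloor>" unfolding j_def by (rule floor_mono[OF ch'(1)])
      also have "\<dots> \<le> int J" unfolding iJ by (rule floor_le_ceiling)
      finally have jJ: "j \<le> int J" .
      have "\<lfloor>- (1 / \<epsilon>)\<rfloor> \<le> j" unfolding j_def by (rule floor_mono[OF ch'(2)])
      then have jJ': "- int J \<le> j" unfolding iJ ceiling_def by simp
      define c' where "c' = h * real_of_int j"
      have c'C: "c' \<in> C" using jJ jJ' by (auto simp: C_def c'_def)
      have cc: "\<bar>c - c'\<bar> \<le> h"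
      proof -
        have "c - c' = h * (c / h - real_of_int \<lfloor>c / h\<rfloor>)" using h by (simp add: c'_def j_def field_simps)
        moreover have "\<bar>c / h - real_of_int \<lfloor>c / h\<rfloor>\<bar> \<le> 1" by linarith
        ultimately show ?thesis using h by (simp add: abs_mult)
      qed
      obtain w where w: "w \<in> N" "L2_set (\<lambda>i. v i - w i) {..<p} \<le> \<epsilon>" using net[OF v] by blast
      have wv: "L2_set (\<lambda>i. w i - v i) {..<p} \<le> \<epsilon>"
        using w(2) unfolding L2_set_def by (simp add: power2_commute)
      have "\<omega> \<notin> B w c'" using \<omega> w(1) c'C by (auto simp: F_def)
      then have "\<theta> * T w c' \<omega> > real n / 2" using \<omega> by (simp add: B_def not_le)
      then have "r\<^sup>2 * real n < T w c' \<omega>" using r by (simp add: \<theta>_def field_simps)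
      then have "sqrt (r\<^sup>2 * real n) < sqrt (T w c' \<omega>)" by (rule real_sqrt_less_mono)
      then have g1: "r * sqrt (real n) < L2_set (\<lambda>l. proj w l \<omega> - c') {1..n}"
        using r by (simp add: T_def L2_set_def real_sqrt_mult)
      have "L2_set (\<lambda>l. proj w l \<omega> - c') {1..n}
        = L2_set (\<lambda>l. (proj v l \<omega> - c) + (proj (\<lambda>i. w i - v i) l \<omega> + (c - c'))) {1..n}"
        by (simp add: proj_diff)
      also have "\<dots> \<le> L2_set (\<lambda>l. proj v l \<omega> - c) {1..n} + L2_set (\<lambda>l. proj (\<lambda>i. w i - v i) l \<omega> + (c - c')) {1..n}"
        by (rule L2_set_triangle_ineq)
      also have "L2_set (\<lambda>l. proj (\<lambda>i. w i - v i) l \<omega> + (c - c')) {1..n}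
        \<le> L2_set (\<lambda>l. proj (\<lambda>i. w i - v i) l \<omega>) {1..n} + L2_set (\<lambda>l. c - c') {1..n}"
        by (rule L2_set_triangle_ineq)
      also have "L2_set (\<lambda>l. proj (\<lambda>i. w i - v i) l \<omega>) {1..n} \<le> sqrt (real n) * h"
      proof -
        have "sqrt (K * real n) * L2_set (\<lambda>i. w i - v i) {..<p} \<le> sqrt (K * real n) * \<epsilon>"
          using wv K0 by (intro mult_left_mono) auto
        also have "\<dots> = sqrt (real n) * h" by (simp add: h_def real_sqrt_mult)
        finally show ?thesis using op[of "\<lambda>i. w i - v i"] by linarith
      qed
      also have "L2_set (\<lambda>l. c - c') {1..n} \<le> sqrt (real n) * h"
        using cc sn by (simp add: L2_set_constant)
      finally have "r * sqrt (real n) < L2_set (\<lambda>l. proj v l \<omega> - c) {1..n} + (sqrt (real n) * h + sqrt (real n) * h)"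
        using g1 by linarith
      then have "2 * h * sqrt (real n) \<le> L2_set (\<lambda>l. proj v l \<omega> - c) {1..n}"
        unfolding r_def by (simp add: algebra_simps)
      then have "(2 * h * sqrt (real n))\<^sup>2 \<le> (L2_set (\<lambda>l. proj v l \<omega> - c) {1..n})\<^sup>2"
        using h by (intro power_mono) auto
      then have "4 * h\<^sup>2 * real n \<le> (\<Sum>l\<in>{1..n}. (proj v l \<omega> - c)\<^sup>2)"
        unfolding L2_set_sq by (simp add: power_mult_distrib)
      then have "4 * h\<^sup>2 \<le> (\<Sum>l\<in>{1..n}. (proj v l \<omega> - c)\<^sup>2) / real n"
        using n by (simp add: le_divide_eq)
      moreover have "h\<^sup>2 = \<epsilon>\<^sup>2 * K" using K0 by (simp add: h_def power_mult_distrib)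
      ultimately show ?thesis unfolding quad_Smat_centered c_def by simp
    qed
    show ?thesis
    proof (cases "L2_set u {..<p} = 0")
      case True
      then have "(\<Sum>i<p. (u i)\<^sup>2) = 0" using L2_set_sq[of u "{..<p}"] by simp
      then show ?thesis using quad_Smat_nonneg by simp
    next
      case False
      define a where "a = L2_set u {..<p}"
      have a: "0 < a" using False by (simp add: a_def order_less_le)
      have "L2_set (\<lambda>i. (1 / a) * u i) {..<p} = (1 / a) * L2_set u {..<p}"
        using a by (intro L2_set_right_distrib[symmetric]) simp
      then have "L2_set (\<lambda>i. (1 / a) * u i) {..<p} = 1" using a by (simp add: a_def)
      from unit[OF this] have "4 * \<epsilon>\<^sup>2 * K \<le> quad (Smat \<omega>) (\<lambda>i. (1 / a) * u i)" .
      also have "\<dots> = (1 / a)\<^sup>2 * quad (Smat \<omega>) u"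
        unfolding quad_carrier[OF Smat_carrier] sum_distrib_left
        by (intro sum.cong refl) (simp add: power2_eq_square)
      finally have "a\<^sup>2 * (4 * \<epsilon>\<^sup>2 * K) \<le> a\<^sup>2 * ((1 / a)\<^sup>2 * quad (Smat \<omega>) u)" by (intro mult_left_mono) auto
      also have "\<dots> = quad (Smat \<omega>) u" using a by (simp add: power_divide)
      finally show ?thesis unfolding a_def L2_set_sq by (simp add: mult.commute)
    qed
  qed
  then show ?thesis using Fm pF by (intro bexI[of _ F]) auto
qed

end

section \<open>Selection of the true partition\<close>

lemma eventually_powr_less:
  fixes A B \<alpha> \<gamma> :: real
  assumes "\<gamma> < \<alpha>" "0 < B"
  shows "\<forall>\<^sub>F n in sequentially. A * real n powr (- \<alpha>) < B * real n powr (- \<gamma>)"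
proof -
  have "(\<lambda>n. A * real n powr (\<gamma> - \<alpha>)) \<longlonglongrightarrow> A * 0"
    by (intro tendsto_mult tendsto_const tendsto_neg_powr filterlim_real_sequentially) (use assms in auto)
  then have "\<forall>\<^sub>F n in sequentially. A * real n powr (\<gamma> - \<alpha>) < B"
    using order_tendstoD(2) assms(2) by fastforce
  then show ?thesis using eventually_gt_at_top[of 0]
  proof eventually_elim
    case (elim n)
    have "A * real n powr (\<gamma> - \<alpha>) * real n powr (- \<gamma>) < B * real n powr (- \<gamma>)"
      using elim by (intro mult_strict_right_mono) auto
    then show ?case by (simp add: mult.assoc flip: powr_add)
  qed
qed

lemma sq_exp_decay:
  fixes e :: real assumes "0 < e"
  shows "(\<lambda>n. 8 * (real n)\<^sup>2 * exp (- (real n powr e) / 16)) \<longlonglongrightarrow> 0"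
  using assms by real_asymp

text \<open>
  The left-hand side is a multiple of \<open>\<epsilon>\<close> to the power \<open>1 - y > 0\<close>. Its \<open>n\<close>-th power is the
  union bound over \<open>(A/\<epsilon>)\<^sup>y\<^sup>n\<close> points with probability \<open>(B \<epsilon>)\<^sup>n\<close> each.
\<close>
lemma ex_small_scale:
  fixes A B y :: real
  assumes A: "1 \<le> A" and B: "0 < B" and y: "y < 1"
  shows "\<exists>\<epsilon>>0. \<epsilon> \<le> 1 / 2 \<and> (A / \<epsilon>) powr y * (B * \<epsilon>) \<le> 1 / 2"
proof -
  define z where "z = 1 / (2 * (A powr y * B))"
  have z: "0 < z" using A B by (simp add: z_def)
  define \<epsilon> where "\<epsilon> = min (1 / 2) (z powr (1 / (1 - y)))"
  have e: "0 < \<epsilon>" "\<epsilon> \<le> 1 / 2" using z by (auto simp: \<epsilon>_def)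
  have "\<epsilon> powr (1 - y) \<le> (z powr (1 / (1 - y))) powr (1 - y)"
    using y e by (intro powr_mono2) (auto simp: \<epsilon>_def)
  also have "\<dots> = z" using y z by (simp add: powr_powr)
  finally have ez: "\<epsilon> powr (1 - y) \<le> z" .
  have "\<epsilon> powr (1 - y) = \<epsilon> / \<epsilon> powr y" using e by (simp add: powr_diff)
  then have "(A / \<epsilon>) powr y * (B * \<epsilon>) = A powr y * B * \<epsilon> powr (1 - y)"
    using A e by (simp add: powr_divide)
  also have "\<dots> \<le> A powr y * B * z" using ez A B by (intro mult_left_mono) auto
  also have "\<dots> = 1 / 2" using A B by (simp add: z_def)
  finally show ?thesis using e by blast
qed

locale block_model =
  fixes M :: "nat \<Rightarrow> 'w measure"
    and p :: "nat \<Rightarrow> nat"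
    and \<mu> :: "nat \<Rightarrow> real Matrix.vec"
    and Sig :: "nat \<Rightarrow> real Matrix.mat"
    and X :: "nat \<Rightarrow> nat \<Rightarrow> 'w \<Rightarrow> nat \<Rightarrow> real"
    and S :: "nat \<Rightarrow> 'w \<Rightarrow> real Matrix.mat"
    and Bstar :: "nat \<Rightarrow> nat set set"
    and \<kappa> :: "nat \<Rightarrow> real"
    and y lam_inf lam_sup a \<delta> :: real
    and m :: nat
  assumes prob: "\<And>n. prob_space (M n)"
    and mu_dim: "\<And>n. \<mu> n \<in> carrier_vec (p n)"
    and Sig_dim: "\<And>n. Sig n \<in> carrier_mat (p n) (p n)"
    and Sig_spd: "\<And>n. sym_pos_def (Sig n)"
    and sample: "\<And>n. iid_mvn (M n) (p n) n (\<mu> n) (Sig n) (X n)"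
    and S_def: "S = (\<lambda>n \<omega>. sample_cov (p n) n (\<lambda>l. X n l \<omega>))"
    and Bstar_def: "Bstar = (\<lambda>n. block_partition (Sig n))"
    and p_lim: "filterlim p at_top sequentially"
    and ratio: "(\<lambda>n. real (p n) / real n) \<longlonglongrightarrow> y" "0 < y" "y < 1"
    and eigen: "0 < lam_inf"
      "\<And>n k. eigenvalue (Sig n) k \<Longrightarrow> lam_inf \<le> k \<and> k \<le> lam_sup"
    and blocks: "1 \<le> m" "\<And>n A. A \<in> Bstar n \<Longrightarrow> card A \<le> m"
    and gap: "0 < a"
      "\<And>n B. refines {..<p n} B (Bstar n) \<Longrightarrow> B \<noteq> Bstar n \<Longrightarrow>
         max_norm (restrict_blocks B (Sig n) - Sig n) \<ge> a * real n powr (- 1 / 4)"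
    and delta: "1 / 2 < \<delta>" "\<delta> < 1"
    and kappa_def: "\<kappa> = (\<lambda>n. 1 / (real (p n) * real n powr \<delta>))"
begin

lemma Sig_transpose: "transpose_mat (Sig n) = Sig n"
  using Sig_spd unfolding sym_pos_def_def by blast

lemma gauss_sample_n:
  assumes "0 < n" "0 < p n"
  shows "gauss_sample (M n) (p n) n (\<mu> n) (Sig n) (X n) lam_inf lam_sup"
proof -
  interpret prob_space "M n" by (rule prob)
  have sym: "Sig n $$ (i, j) = Sig n $$ (j, i)" if "i < p n" "j < p n" for i j
    by (rule sym_pos_def_symD[OF Sig_spd Sig_dim that])
  show ?thesis
  proof (unfold_locales)
    show "lam_inf * (\<Sum>i<p n. (u i)\<^sup>2) \<le> quad (Sig n) u" for u
      by (rule eigenvalue_bounds_quad(1)[OF Sig_dim sym eigen(2)])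
    show "quad (Sig n) u \<le> lam_sup * (\<Sum>i<p n. (u i)\<^sup>2)" for u
      by (rule eigenvalue_bounds_quad(2)[OF Sig_dim sym eigen(2)])
  qed (use assms mu_dim Sig_dim Sig_spd sample eigen in auto)
qed

lemma eventually_p_gt: "\<forall>\<^sub>F n in sequentially. k < p n"
  using p_lim[unfolded filterlim_at_top, THEN spec, of "Suc k"] by eventually_elim simp

lemma eventually_gauss: "\<forall>\<^sub>F n in sequentially. 0 < n \<and> 0 < p n"
  using eventually_gt_at_top[of 0] eventually_p_gt[of 0]
  by eventually_elim auto

lemma lam_sup_pos: "0 < lam_sup"
proof -
  obtain n where "0 < n" "0 < p n" using eventually_gauss by (auto simp: eventually_sequentially)
  then interpret gauss_sample "M n" "p n" n "\<mu> n" "Sig n" "X n" lam_inf lam_sup by (rule gauss_sample_n)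
  show ?thesis by (rule hi_pos)
qed

lemma eventually_p_le:
  assumes "y < y'"
  shows "\<forall>\<^sub>F n in sequentially. real (p n) \<le> y' * real n"
  using order_tendstoD(2)[OF ratio(1) assms] eventually_gt_at_top[of 0]
  by eventually_elim (auto simp: field_simps)

lemma eventually_p_ge: "\<forall>\<^sub>F n in sequentially. y / 2 * real n \<le> real (p n)"
proof -
  have "y / 2 < y" using ratio(2) by simp
  from order_tendstoD(1)[OF ratio(1) this] show ?thesis using eventually_gt_at_top[of 0]
    by eventually_elim (auto simp: field_simps)
qed

text \<open>
  The exceptional event collects the failures of the upper spectral bound, of the lower one
  and of the entrywise approximation. Off this event the data form an instance of
  \<open>block_approx\<close>, and the partition may be chosen after \<open>\<omega>\<close> is known.
\<close>
lemma selects_true_partition: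
  assumes e: "0 < e"
  shows "\<forall>\<^sub>F n in sequentially. \<exists>F\<in>sets (M n). measure (M n) F \<le> e \<and>
    (\<forall>\<omega>\<in>space (M n) - F. \<forall>B. is_B_tot (\<kappa> n) (S n \<omega>) B \<or> is_B_corr (\<kappa> n) (S n \<omega>) B \<or>
       B = B_thr (S n \<omega>) (real n powr (- 1 / 3)) \<or> is_B_s m (\<kappa> n) (S n \<omega>) B
       \<longrightarrow> restrict_blocks B (S n \<omega>) = restrict_blocks (Bstar n) (S n \<omega>))"
proof -
  define K where "K = 216 * lam_sup"
  have K: "0 < K" using lam_sup_pos by (simp add: K_def)
  define A where "A = 3 * exp (2::real)"
  have A1: "1 \<le> A" unfolding A_def using one_le_exp_iff[of "2::real"] by linarith
  define B where "B = 16 * sqrt K / sqrt lam_inf"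
  have B0: "0 < B" using K eigen(1) by (simp add: B_def)
  \<comment> \<open>the dimension is at most \<open>y' n\<close> for large \<open>n\<close>\<close>
  define y' where "y' = (1 + y) / 2"
  have y': "y < y'" "y' < 1" "0 < y'" using ratio by (simp_all add: y'_def)
  obtain \<epsilon> where eps: "0 < \<epsilon>" "\<epsilon> \<le> 1 / 2" and epsAB: "(A / \<epsilon>) powr y' * (B * \<epsilon>) \<le> 1 / 2"
    using ex_small_scale[OF A1 B0 y'(2)] by blast
  define c where "c = 4 * \<epsilon>\<^sup>2 * K"
  have c: "0 < c" using eps K by (simp add: c_def)
  \<comment> \<open>The entries are approximated up to a multiple of \<open>n\<^sup>-\<^sup>\<beta>\<close>. For the union bound over the
  entries \<open>\<beta> < 1/2\<close> is needed; \<open>2\<beta> > \<delta>\<close> makes the squared error smaller than the penalty, and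
  \<open>\<beta> > 1/3\<close> puts the error below the threshold \<open>n\<^sup>-\<^sup>1\<^sup>/\<^sup>3\<close> and hence below the gap \<open>n\<^sup>-\<^sup>1\<^sup>/\<^sup>4\<close>.\<close>
  define \<beta> where "\<beta> = (1 + \<delta>) / 4"
  have beta: "1 / 4 < \<beta>" "1 / 3 < \<beta>" "\<delta> < 2 * \<beta>" "2 * \<beta> < 1" "0 < \<beta>" using delta by (simp_all add: \<beta>_def)
  define v where "v = (\<lambda>n. real n powr (- \<beta>))"
  define \<tau> where "\<tau> = (\<lambda>n. 6 * lam_sup * v n)"
  define g where "g = (\<lambda>n. a * real n powr (- 1 / 4))"
  define k0 where "k0 = (\<lambda>n. real n powr (- \<delta>))"
  have ev1: "\<forall>\<^sub>F n in sequentially. 6 * lam_sup * real n powr (- \<beta>) < a / 2 * real n powr (- (1 / 4))"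
    by (rule eventually_powr_less) (use beta gap(1) in auto)
  have ev2: "\<forall>\<^sub>F n in sequentially. (6 * lam_sup)\<^sup>2 / c\<^sup>2 * real n powr (- (2 * \<beta>)) < 1 * real n powr (- \<delta>)"
    by (rule eventually_powr_less) (use beta in auto)
  have ev3: "\<forall>\<^sub>F n in sequentially. (real m)\<^sup>2 * real n powr (- \<delta>) < (a / 2)\<^sup>2 / K\<^sup>2 * real n powr (- (1 / 2))"
    by (rule eventually_powr_less) (use delta gap(1) K in auto)
  have ev5: "\<forall>\<^sub>F n in sequentially. 6 * lam_sup / c * real n powr (- \<beta>) < a / (4 * K) * real n powr (- (1 / 4))"
    by (rule eventually_powr_less) (use beta gap(1) K in auto)
  have ev5': "\<forall>\<^sub>F n in sequentially. 2 / y * real n powr (- 1) < a / (4 * K) * real n powr (- (1 / 4))"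
    by (rule eventually_powr_less) (use gap(1) K in auto)
  have ev6: "\<forall>\<^sub>F n in sequentially. a / K * real n powr (- (1 / 4)) < 1 * real n powr (- 0)"
    by (rule eventually_powr_less) auto
  have ev7: "\<forall>\<^sub>F n in sequentially. 6 * lam_sup / c * real n powr (- \<beta>) < 1 * real n powr (- (1 / 3))"
    by (rule eventually_powr_less) (use beta in auto)
  have ev8: "\<forall>\<^sub>F n in sequentially. 1 * real n powr (- (1 / 3)) < a / (2 * K) * real n powr (- (1 / 4))"
    by (rule eventually_powr_less) (use gap(1) K in auto)
  have evm: "\<forall>\<^sub>F n in sequentially. m < p n" by (rule eventually_p_gt)
  have e4: "0 < e / 4" using e by simp
  have lim1: "\<forall>\<^sub>F n in sequentially. (1 / 2 :: real) ^ n < e / 4"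
    by (rule order_tendstoD(2)[OF LIMSEQ_realpow_zero e4]) auto
  have "(\<lambda>n. 4 / \<epsilon> * (1 / 2 :: real) ^ n) \<longlonglongrightarrow> 4 / \<epsilon> * 0"
    by (intro tendsto_mult tendsto_const LIMSEQ_realpow_zero) auto
  then have lim2: "\<forall>\<^sub>F n in sequentially. 4 / \<epsilon> * (1 / 2 :: real) ^ n < e / 4"
    by (rule order_tendstoD(2)) (use e4 in simp)
  have lim3: "\<forall>\<^sub>F n in sequentially. 8 * (real n)\<^sup>2 * exp (- (real n powr (1 - 2 * \<beta>)) / 16) < e / 4"
    by (rule order_tendstoD(2)[OF sq_exp_decay e4]) (use beta in simp)
  show ?thesis
    using ev1 ev2 ev3 ev5 ev5' ev6 ev7 ev8 evm lim1 lim2 lim3 eventually_gauss eventually_p_le[OF y'(1)] eventually_p_ge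
  proof eventually_elim
    case (elim n)
    note h1 = elim(1) and h2 = elim(2) and h3 = elim(3) and h5 = elim(4) and h5' = elim(5) and h6 = elim(6)
      and h7 = elim(7) and h8 = elim(8) and hm = elim(9) and l1 = elim(10) and l2 = elim(11) and l3 = elim(12)
      and pos = elim(13) and ple = elim(14) and pge = elim(15)
    interpret G: gauss_sample "M n" "p n" n "\<mu> n" "Sig n" "X n" lam_inf lam_sup
      by (rule gauss_sample_n) (use pos in auto)
    have n: "0 < real n" using pos by simp
    have S_eq: "S n \<omega> = G.Smat \<omega>" for \<omega> by (simp add: S_def G.Smat_def)
    have pn: "p n \<le> n"
    proof -
      have "y' * real n \<le> 1 * real n" using y' n by (intro mult_right_mono) auto
      then show ?thesis using ple by simp
    qed
    have v01: "0 \<le> v n" "v n \<le> 1"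
    proof -
      show "0 \<le> v n" by (simp add: v_def)
      have "real n powr (- \<beta>) \<le> real n powr 0" using pos beta by (intro powr_mono) auto
      then show "v n \<le> 1" using n by (simp add: v_def)
    qed
    obtain F1 where F1: "F1 \<in> sets (M n)" "measure (M n) F1 \<le> (1 / 2) ^ n"
      and op: "\<And>\<omega> u. \<omega> \<in> space (M n) - F1 \<Longrightarrow>
         L2_set (\<lambda>l. G.proj u l \<omega>) {1..n} \<le> sqrt (216 * lam_sup * real n) * L2_set u {..<p n}"
      using G.op_norm_event[OF pn] by blast
    obtain F2 where F2: "F2 \<in> sets (M n)"
        "measure (M n) F2 \<le> (3 * exp 2 / \<epsilon>) ^ p n * (4 / \<epsilon>) * (16 * \<epsilon> * sqrt K / sqrt lam_inf) ^ n"
      and low: "\<And>\<omega> u. \<omega> \<in> space (M n) - F2 \<Longrightarrow>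
         (\<forall>u. L2_set (\<lambda>l. G.proj u l \<omega>) {1..n} \<le> sqrt (K * real n) * L2_set u {..<p n}) \<Longrightarrow>
         4 * \<epsilon>\<^sup>2 * K * (\<Sum>i<p n. (u i)\<^sup>2) \<le> quad (G.Smat \<omega>) u"
      using G.lower_event[OF eps K_def] by blast
    obtain F3 where F3: "F3 \<in> sets (M n)" "measure (M n) F3 \<le> 8 * (real (p n))\<^sup>2 * exp (- real n * (v n)\<^sup>2 / 16)"
      and ent: "\<And>\<omega> i j. \<omega> \<in> space (M n) - F3 \<Longrightarrow> i < p n \<Longrightarrow> j < p n \<Longrightarrow>
         \<bar>G.Smat \<omega> $$ (i, j) - Sig n $$ (i, j)\<bar> \<le> 6 * lam_sup * v n"
      using G.entries_close[OF v01] by blast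
    have p1: "measure (M n) F1 \<le> e / 4" using F1(2) l1 by linarith
    have p2: "measure (M n) F2 \<le> e / 4"
    proof -
      have Ae: "1 \<le> A / \<epsilon>" using A1 eps by (simp add: le_divide_eq)
      have "(A / \<epsilon>) ^ p n = (A / \<epsilon>) powr real (p n)" using Ae by (simp add: powr_realpow)
      also have "\<dots> \<le> (A / \<epsilon>) powr (y' * real n)" using Ae ple by (intro powr_mono) auto
      also have "\<dots> = ((A / \<epsilon>) powr y') ^ n"
      proof -
        have "0 < (A / \<epsilon>) powr y'" using A1 eps by simp
        then show ?thesis by (simp only: powr_powr[symmetric] powr_realpow)
      qed
      finally have pw: "(A / \<epsilon>) ^ p n \<le> ((A / \<epsilon>) powr y') ^ n" .
      have "measure (M n) F2 \<le> (A / \<epsilon>) ^ p n * (4 / \<epsilon>) * (B * \<epsilon>) ^ n"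
        using F2(2) by (simp add: A_def B_def mult_ac)
      also have "\<dots> \<le> ((A / \<epsilon>) powr y') ^ n * (4 / \<epsilon>) * (B * \<epsilon>) ^ n"
        using pw eps B0 by (intro mult_right_mono) auto
      also have "\<dots> = 4 / \<epsilon> * ((A / \<epsilon>) powr y' * (B * \<epsilon>)) ^ n" by (simp add: power_mult_distrib)
      also have "\<dots> \<le> 4 / \<epsilon> * (1 / 2) ^ n"
        using epsAB eps B0 by (intro mult_left_mono power_mono) auto
      finally show ?thesis using l2 by linarith
    qed
    have p3: "measure (M n) F3 \<le> e / 4"
    proof -
      have "(v n)\<^sup>2 = real n powr (- (2 * \<beta>))" using n by (simp add: v_def power2_eq_square flip: powr_add)
      then have "real n * (v n)\<^sup>2 = real n powr 1 * real n powr (- (2 * \<beta>))" using n by simp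
      also have "\<dots> = real n powr (1 - 2 * \<beta>)" unfolding powr_add[symmetric] by simp
      finally have nv: "real n * (v n)\<^sup>2 = real n powr (1 - 2 * \<beta>)" .
      have "measure (M n) F3 \<le> 8 * (real (p n))\<^sup>2 * exp (- (real n powr (1 - 2 * \<beta>)) / 16)"
        using F3(2) nv by simp
      also have "\<dots> \<le> 8 * (real n)\<^sup>2 * exp (- (real n powr (1 - 2 * \<beta>)) / 16)"
        using pn by (intro mult_right_mono mult_left_mono power_mono) auto
      finally show ?thesis using l3 by linarith
    qed
    let ?F = "F1 \<union> F2 \<union> F3"
    have Fm: "?F \<in> sets (M n)" using F1 F2 F3 by auto
    have "measure (M n) ?F \<le> measure (M n) (F1 \<union> F2) + measure (M n) F3"
      by (rule measure_Un_le) (use F1 F2 F3 in auto)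
    also have "measure (M n) (F1 \<union> F2) \<le> measure (M n) F1 + measure (M n) F2"
      by (rule measure_Un_le[OF F1(1) F2(1)])
    finally have pF: "measure (M n) ?F \<le> e" using p1 p2 p3 e by linarith
    have sel: "restrict_blocks B (S n \<omega>) = restrict_blocks (Bstar n) (S n \<omega>)"
      if \<omega>: "\<omega> \<in> space (M n) - ?F"
        and est: "is_B_tot (\<kappa> n) (S n \<omega>) B \<or> is_B_corr (\<kappa> n) (S n \<omega>) B \<or>
       B = B_thr (S n \<omega>) (real n powr (- 1 / 3)) \<or> is_B_s m (\<kappa> n) (S n \<omega>) B" for \<omega> B
    proof -
      have \<omega>s: "\<omega> \<in> space (M n) - F1" "\<omega> \<in> space (M n) - F2" "\<omega> \<in> space (M n) - F3" using \<omega> by auto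
      have opK: "L2_set (\<lambda>l. G.proj u l \<omega>) {1..n} \<le> sqrt (K * real n) * L2_set u {..<p n}" for u
        using op[OF \<omega>s(1)] by (simp add: K_def)
      have q4: "real n powr (- (1 / 4)) = real n powr (- 1 / 4)" by simp
      have gt: "a / 2 * real n powr (- 1 / 4) \<le> g n - \<tau> n"
        using h1 unfolding g_def \<tau>_def v_def q4 by (simp add: algebra_simps)
      have r4: "0 < real n powr (- 1 / 4)" using n by simp
      have gt0: "0 < a / 2 * real n powr (- 1 / 4)" using r4 gap(1) by simp
      have gK: "a / (2 * K) * real n powr (- 1 / 4) \<le> (g n - \<tau> n) / K"
        using divide_right_mono[OF gt, of K] K by simp
      interpret block_approx "p n" m "S n \<omega>" "Sig n" "Bstar n" c K "\<tau> n" "g n" "k0 n"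
      proof
        show "0 < p n" using pos by simp
        show "S n \<omega> \<in> carrier_mat (p n) (p n)" unfolding S_eq by (rule G.Smat_carrier)
        show "transpose_mat (S n \<omega>) = S n \<omega>"
          unfolding S_eq by (rule eq_matI) (use G.Smat_carrier[of \<omega>] G.Smat_sym in auto)
        show "c * (\<Sum>i<p n. (u i)\<^sup>2) \<le> quad (S n \<omega>) u" for u
          unfolding S_eq c_def by (rule low[OF \<omega>s(2)]) (use opK in blast)
        show "quad (S n \<omega>) u \<le> K * (\<Sum>i<p n. (u i)\<^sup>2)" for u
        proof -
          have "(L2_set (\<lambda>l. G.proj u l \<omega>) {1..n})\<^sup>2 \<le> (sqrt (K * real n) * L2_set u {..<p n})\<^sup>2"
            by (rule power_mono[OF opK]) simp
          then have "(\<Sum>l\<in>{1..n}. (G.proj u l \<omega>)\<^sup>2) \<le> K * real n * (\<Sum>i<p n. (u i)\<^sup>2)"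
            unfolding L2_set_sq power_mult_distrib using K by simp
          then have "(\<Sum>l\<in>{1..n}. (G.proj u l \<omega>)\<^sup>2) / real n \<le> K * (\<Sum>i<p n. (u i)\<^sup>2)"
            using n by (simp add: divide_le_eq mult_ac)
          then show ?thesis unfolding S_eq G.quad_Smat using zero_le_power2[of "G.mean u \<omega>"] by linarith
        qed
        show "\<bar>S n \<omega> $$ (i, j) - Sig n $$ (i, j)\<bar> \<le> \<tau> n" if "i < p n" "j < p n" for i j
          unfolding S_eq \<tau>_def by (rule ent[OF \<omega>s(3) that])
        show "0 \<le> \<tau> n" using lam_sup_pos v01 by (simp add: \<tau>_def)
        show "\<tau> n < g n" using gt gt0 by linarith
        show "(\<tau> n)\<^sup>2 / c\<^sup>2 < k0 n"
        proof -
          have "(v n)\<^sup>2 = real n powr (- (2 * \<beta>))" using n by (simp add: v_def power2_eq_square flip: powr_add)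
          then show ?thesis using h2 by (simp add: \<tau>_def k0_def power_mult_distrib)
        qed
        show "k0 n * (real m)\<^sup>2 < (g n - \<tau> n)\<^sup>2 / K\<^sup>2"
        proof -
          have "(a / 2 * real n powr (- 1 / 4))\<^sup>2 \<le> (g n - \<tau> n)\<^sup>2" using gt gt0 by (intro power_mono) auto
          then have le: "(a / 2 * real n powr (- 1 / 4))\<^sup>2 / K\<^sup>2 \<le> (g n - \<tau> n)\<^sup>2 / K\<^sup>2" by (rule divide_right_mono) simp
          have sq: "(real n powr (- 1 / 4))\<^sup>2 = real n powr (- (1 / 2))" using n by (simp add: power2_eq_square flip: powr_add)
          have "k0 n * (real m)\<^sup>2 = (real m)\<^sup>2 * real n powr (- \<delta>)" by (simp add: k0_def)
          also have "\<dots> < (a / 2)\<^sup>2 / K\<^sup>2 * real n powr (- (1 / 2))" by (rule h3)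
          also have "\<dots> = (a / 2 * real n powr (- 1 / 4))\<^sup>2 / K\<^sup>2"
            unfolding sq[symmetric] power_mult_distrib by (rule times_divide_eq_left)
          also note le
          finally show ?thesis .
        qed
        show "g n \<le> max_norm (restrict_blocks B (Sig n) - Sig n)" if "refines {..<p n} B (Bstar n)" "B \<noteq> Bstar n" for B
          unfolding g_def by (rule gap(2)[OF that])
        show "card A \<le> m" if "A \<in> Bstar n" for A by (rule blocks(2)[OF that])
      qed (use Sig_dim Sig_transpose Bstar_def c K in auto)
      have tc: "\<tau> n / c = 6 * lam_sup / c * real n powr (- \<beta>)" by (simp add: \<tau>_def v_def)
      show ?thesis
      proof (rule estimators_restrict[OF _ hm])
        show "\<kappa> n = k0 n / real (p n)" using n by (simp add: kappa_def k0_def powr_minus field_simps)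
        show "\<tau> n / c + 1 / real (p n) < (g n - \<tau> n) / K"
        proof -
          have "1 / real (p n) \<le> 1 / (y / 2 * real n)"
            using pge ratio(2) n pos by (intro divide_left_mono) auto
          also have "\<dots> = 2 / y * real n powr (- 1)" using n by (simp add: powr_minus field_simps)
          finally have "\<tau> n / c + 1 / real (p n) < a / (4 * K) * real n powr (- 1 / 4) + a / (4 * K) * real n powr (- 1 / 4)"
            unfolding tc using h5 h5' unfolding q4 by linarith
          also have "\<dots> = a / (2 * K) * real n powr (- 1 / 4)" by simp
          finally show ?thesis using gK by linarith
        qed
        show "(g n - \<tau> n) / K \<le> 1"
        proof -
          have "g n - \<tau> n \<le> g n" using lam_sup_pos v01 by (simp add: \<tau>_def)
          then have "(g n - \<tau> n) / K \<le> g n / K" using K by (intro divide_right_mono) auto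
          also have "\<dots> = a / K * real n powr (- 1 / 4)" by (simp add: g_def)
          also have "\<dots> \<le> 1" using h6 n unfolding q4 by simp
          finally show ?thesis .
        qed
        show "\<tau> n / c \<le> real n powr (- 1 / 3)" unfolding tc using h7 by simp
        show "real n powr (- 1 / 3) < (g n - \<tau> n) / K" using h8 gK unfolding q4 by simp
        show "is_B_tot (\<kappa> n) (S n \<omega>) B \<or> is_B_corr (\<kappa> n) (S n \<omega>) B \<or> B = B_thr (S n \<omega>) (real n powr (- 1 / 3)) \<or> is_B_s m (\<kappa> n) (S n \<omega>) B"
          by (rule est)
      qed
    qed
    show ?case using Fm pF sel by (intro bexI[of _ ?F]) auto
  qed
qed

end

section \<open>Rates in probability\<close>

context block_model begin

lemma Bstar_partition: "partition_on {..<p n} (Bstar n)"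
  unfolding Bstar_def by (rule block_partition_props(1)[OF Sig_dim Sig_transpose])

lemma card_block_pairs_Bstar: "real (card (block_pairs (Bstar n))) \<le> real (p n) * real m"
proof -
  note part = Bstar_partition[of n]
  have fA: "finite A" if "A \<in> Bstar n" for A
  proof -
    have "A \<subseteq> {..<p n}" unfolding partition_onD1[OF part] using that by blast
    then show ?thesis by (rule finite_subset) simp
  qed
  have "real (card (block_pairs (Bstar n))) = (\<Sum>A\<in>Bstar n. (real (card A))\<^sup>2)"
    by (rule sum_card_sq_eq_card_pairs[OF part, symmetric])
  also have "\<dots> \<le> (\<Sum>A\<in>Bstar n. real (card A) * real m)"
    unfolding power2_eq_square using blocks(2) by (intro sum_mono mult_left_mono) auto
  also have "\<dots> = real (\<Sum>A\<in>Bstar n. card A) * real m" by (simp add: sum_distrib_right)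
  also have "(\<Sum>A\<in>Bstar n. card A) = p n" using product_partition[OF part fA] by simp
  finally show ?thesis .
qed

text \<open>
  Outside the blocks both matrices vanish.
\<close>
lemma frob_Bstar_eq:
  "frob_sq (restrict_blocks (Bstar n) (S n \<omega>) - Sig n)
     = (\<Sum>(i, j)\<in>block_pairs (Bstar n). (S n \<omega> $$ (i, j) - Sig n $$ (i, j))\<^sup>2)"
proof -
  have Sc: "S n \<omega> \<in> carrier_mat (p n) (p n)" by (simp add: S_def sample_cov_def)
  have Dc: "restrict_blocks (Bstar n) (S n \<omega>) - Sig n \<in> carrier_mat (p n) (p n)"
    by (rule minus_carrier_mat[OF Sig_dim])
  have zero: "Sig n $$ (i, j) = 0" if "i < p n" "j < p n" "\<not> same_block (Bstar n) i j" for i j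
    using block_partition_props(2)[OF Sig_dim Sig_transpose[of n]] that
    unfolding restrict_blocks_fixed_iff[OF Sig_dim] Bstar_def by blast
  have entry: "((restrict_blocks (Bstar n) (S n \<omega>) - Sig n) $$ (i, j))\<^sup>2
     = (if (i, j) \<in> block_pairs (Bstar n) then (S n \<omega> $$ (i, j) - Sig n $$ (i, j))\<^sup>2 else 0)"
    if ij: "i < p n" "j < p n" for i j
  proof -
    have "(restrict_blocks (Bstar n) (S n \<omega>) - Sig n) $$ (i, j) = restrict_blocks (Bstar n) (S n \<omega>) $$ (i, j) - Sig n $$ (i, j)"
      by (rule index_minus_mat) (use ij Sig_dim[of n] in auto)
    then show ?thesis using zero[OF ij] by (simp add: restrict_blocks_index[OF Sc ij] block_pairs_def)
  qed
  have sub: "block_pairs (Bstar n) \<subseteq> {..<p n} \<times> {..<p n}"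
    using same_block_less[OF Bstar_partition] by (auto simp: block_pairs_def)
  have "frob_sq (restrict_blocks (Bstar n) (S n \<omega>) - Sig n)
    = (\<Sum>i<p n. \<Sum>j<p n. if (i, j) \<in> block_pairs (Bstar n) then (S n \<omega> $$ (i, j) - Sig n $$ (i, j))\<^sup>2 else 0)"
    unfolding frob_sq_carrier[OF Dc] by (intro sum.cong refl entry) auto
  also have "\<dots> = (\<Sum>x\<in>{..<p n} \<times> {..<p n}. if x \<in> block_pairs (Bstar n) then (S n \<omega> $$ x - Sig n $$ x)\<^sup>2 else 0)"
    unfolding sum.cartesian_product by (intro sum.cong refl) auto
  also have "\<dots> = (\<Sum>x\<in>block_pairs (Bstar n). (S n \<omega> $$ x - Sig n $$ x)\<^sup>2)"
    using sub by (subst sum.inter_restrict[symmetric]) (auto simp: Int_absorb1)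
  finally show ?thesis by (simp add: case_prod_unfold)
qed

lemma S_entry_measurable:
  assumes "0 < n" "0 < p n" "i < p n" "j < p n"
  shows "(\<lambda>\<omega>. S n \<omega> $$ (i, j)) \<in> borel_measurable (M n)"
proof -
  interpret G: gauss_sample "M n" "p n" n "\<mu> n" "Sig n" "X n" lam_inf lam_sup
    by (rule gauss_sample_n) (use assms in auto)
  show ?thesis using G.Smat_entry_measurable[OF assms(3,4)] by (simp add: S_def G.Smat_def)
qed

lemma frob_Bstar_measurable:
  assumes "0 < n" "0 < p n"
  shows "(\<lambda>\<omega>. frob_sq (restrict_blocks (Bstar n) (S n \<omega>) - Sig n)) \<in> borel_measurable (M n)"
  unfolding frob_Bstar_eq case_prod_unfold
proof (intro borel_measurable_sum borel_measurable_power borel_measurable_diff borel_measurable_const)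
  fix x assume "x \<in> block_pairs (Bstar n)"
  then have "fst x < p n" "snd x < p n"
    using same_block_less[OF Bstar_partition] by (auto simp: block_pairs_def)
  then show "(\<lambda>\<omega>. S n \<omega> $$ (fst x, snd x)) \<in> borel_measurable (M n)"
    by (rule S_entry_measurable[OF assms])
qed

lemma frob_Bstar_expectation:
  assumes n: "16 \<le> n" and p: "0 < p n"
  shows "(\<integral>\<^sup>+\<omega>. ennreal (frob_sq (restrict_blocks (Bstar n) (S n \<omega>) - Sig n)) \<partial>M n)
    \<le> ennreal (real (p n) * real m * (14 * mom_const * lam_sup\<^sup>2 / real n))"
proof -
  interpret G: gauss_sample "M n" "p n" n "\<mu> n" "Sig n" "X n" lam_inf lam_sup
    by (rule gauss_sample_n) (use n p in auto)
  let ?C = "14 * mom_const * lam_sup\<^sup>2 / real n"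
  have C: "0 \<le> ?C" using mom_const_pos by simp
  have S_eq: "S n \<omega> = G.Smat \<omega>" for \<omega> by (simp add: S_def G.Smat_def)
  have lt: "fst x < p n \<and> snd x < p n" if "x \<in> block_pairs (Bstar n)" for x
    using that same_block_less[OF Bstar_partition] by (auto simp: block_pairs_def)
  have "(\<integral>\<^sup>+\<omega>. ennreal (frob_sq (restrict_blocks (Bstar n) (S n \<omega>) - Sig n)) \<partial>M n)
    = (\<integral>\<^sup>+\<omega>. (\<Sum>x\<in>block_pairs (Bstar n). ennreal ((S n \<omega> $$ (fst x, snd x) - Sig n $$ (fst x, snd x))\<^sup>2)) \<partial>M n)"
    unfolding frob_Bstar_eq case_prod_unfold by (subst sum_ennreal) auto
  also have "\<dots> = (\<Sum>x\<in>block_pairs (Bstar n). \<integral>\<^sup>+\<omega>. ennreal ((S n \<omega> $$ (fst x, snd x) - Sig n $$ (fst x, snd x))\<^sup>2) \<partial>M n)"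
  proof (rule nn_integral_sum)
    fix x assume "x \<in> block_pairs (Bstar n)"
    then have "(\<lambda>\<omega>. S n \<omega> $$ (fst x, snd x)) \<in> borel_measurable (M n)"
      using lt n p by (intro S_entry_measurable) auto
    then show "(\<lambda>\<omega>. ennreal ((S n \<omega> $$ (fst x, snd x) - Sig n $$ (fst x, snd x))\<^sup>2)) \<in> borel_measurable (M n)"
      by measurable
  qed
  also have "\<dots> \<le> (\<Sum>x\<in>block_pairs (Bstar n). ennreal ?C)"
    unfolding S_eq using lt n by (intro sum_mono G.entry_second_moment) auto
  also have "\<dots> = ennreal (real (card (block_pairs (Bstar n))) * ?C)"
    using C by (simp add: ennreal_mult ennreal_of_nat_eq_real_of_nat del: times_divide_eq_right)
  also have "\<dots> \<le> ennreal (real (p n) * real m * ?C)"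
    by (intro ennreal_leI mult_right_mono card_block_pairs_Bstar C)
  finally show ?thesis .
qed

lemma bigO_Bstar:
  "bigO_p M (\<lambda>n \<omega>. frob_sq (restrict_blocks (Bstar n) (S n \<omega>) - Sig n) / real (p n)) (\<lambda>n. 1 / real n)"
  unfolding bigO_p_def
proof (intro allI impI)
  fix e :: real assume e: "0 < e"
  define C where "C = real m * (14 * mom_const * lam_sup\<^sup>2)"
  have C: "0 < C" unfolding C_def using blocks(1) mom_const_pos lam_sup_pos by (intro mult_pos_pos) auto
  define K where "K = C / e"
  have K: "0 < K" using C e by (simp add: K_def)
  have "\<forall>\<^sub>F n in sequentially. measure (M n)
       {\<omega> \<in> space (M n). \<bar>frob_sq (restrict_blocks (Bstar n) (S n \<omega>) - Sig n) / real (p n)\<bar> > K * \<bar>1 / real n\<bar>} \<le> e"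
    using eventually_gauss eventually_ge_at_top[of 16]
  proof eventually_elim
    case (elim n)
    then have n: "0 < real n" and p: "0 < real (p n)" by auto
    interpret prob_space "M n" by (rule prob)
    let ?f = "\<lambda>\<omega>. frob_sq (restrict_blocks (Bstar n) (S n \<omega>) - Sig n)"
    have fm[measurable]: "?f \<in> borel_measurable (M n)" by (rule frob_Bstar_measurable) (use elim in auto)
    let ?A = "{\<omega> \<in> space (M n). \<bar>?f \<omega> / real (p n)\<bar> > K * \<bar>1 / real n\<bar>}"
    have A: "?A \<in> sets (M n)" by measurable
    define b where "b = real n / (real (p n) * K)"
    have b: "0 \<le> b" using K by (simp add: b_def)
    have f0: "0 \<le> ?f \<omega>" for \<omega> by (simp add: frob_sq_def sum_nonneg)
    have "ennreal (measure (M n) ?A) = (\<integral>\<^sup>+\<omega>. indicator ?A \<omega> \<partial>M n)"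
      using A by (simp add: emeasure_eq_measure)
    also have "\<dots> \<le> (\<integral>\<^sup>+\<omega>. ennreal b * ennreal (?f \<omega>) \<partial>M n)"
    proof (rule nn_integral_mono)
      fix \<omega>
      show "indicator ?A \<omega> \<le> ennreal b * ennreal (?f \<omega>)"
      proof (cases "\<omega> \<in> ?A")
        case True
        then have "K / real n < ?f \<omega> / real (p n)" using f0[of \<omega>] n p by simp
        then have "1 \<le> b * ?f \<omega>" using n p K by (simp add: b_def field_simps)
        then have "ennreal 1 \<le> ennreal (b * ?f \<omega>)" by (rule ennreal_leI)
        then show ?thesis using True b f0 by (simp add: ennreal_mult)
      qed simp
    qed
    also have "\<dots> = ennreal b * (\<integral>\<^sup>+\<omega>. ennreal (?f \<omega>) \<partial>M n)" by (rule nn_integral_cmult) measurable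
    also have "\<dots> \<le> ennreal b * ennreal (real (p n) * real m * (14 * mom_const * lam_sup\<^sup>2 / real n))"
      by (intro mult_left_mono frob_Bstar_expectation) (use elim in auto)
    also have "\<dots> = ennreal (b * (real (p n) * real m * (14 * mom_const * lam_sup\<^sup>2 / real n)))"
      using b mom_const_pos by (intro ennreal_mult[symmetric]) auto
    also have "b * (real (p n) * real m * (14 * mom_const * lam_sup\<^sup>2 / real n)) = C / K"
      using n p K by (simp add: b_def C_def field_simps)
    also have "C / K = e" using C e by (simp add: K_def)
    finally show ?case using e by (simp add: ennreal_le_iff)
  qed
  then show "\<exists>K. \<forall>\<^sub>F n in sequentially. measure (M n)
       {\<omega> \<in> space (M n). \<bar>frob_sq (restrict_blocks (Bstar n) (S n \<omega>) - Sig n) / real (p n)\<bar> > K * \<bar>1 / real n\<bar>} \<le> e"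
    by blast
qed

text \<open>
  Outside an event of small probability the estimator and \<open>Bstar\<close> restrict \<open>S\<close> to the same
  matrix, so the bound for \<open>Bstar\<close> applies.
\<close>
lemma bigO_estimator:
  assumes est: "\<forall>\<^sub>F n in sequentially. AE \<omega> in M n.
      is_B_tot (\<kappa> n) (S n \<omega>) (Bhat n \<omega>) \<or> is_B_corr (\<kappa> n) (S n \<omega>) (Bhat n \<omega>) \<or>
      Bhat n \<omega> = B_thr (S n \<omega>) (real n powr (- 1 / 3)) \<or> is_B_s m (\<kappa> n) (S n \<omega>) (Bhat n \<omega>)"
  shows "bigO_p M (\<lambda>n \<omega>. frob_sq (restrict_blocks (Bhat n \<omega>) (S n \<omega>) - Sig n) / real (p n)) (\<lambda>n. 1 / real n)"
  unfolding bigO_p_def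
proof (intro allI impI)
  fix e :: real assume e: "0 < e"
  then have e2: "0 < e / 2" by simp
  obtain K where K: "\<forall>\<^sub>F n in sequentially. measure (M n)
       {\<omega> \<in> space (M n). \<bar>frob_sq (restrict_blocks (Bstar n) (S n \<omega>) - Sig n) / real (p n)\<bar> > K * \<bar>1 / real n\<bar>} \<le> e / 2"
    using bigO_Bstar e2 unfolding bigO_p_def by blast
  have "\<forall>\<^sub>F n in sequentially. measure (M n)
       {\<omega> \<in> space (M n). \<bar>frob_sq (restrict_blocks (Bhat n \<omega>) (S n \<omega>) - Sig n) / real (p n)\<bar> > K * \<bar>1 / real n\<bar>} \<le> e"
    using K selects_true_partition[OF e2] est eventually_gauss
  proof eventually_elim
    case (elim n)
    interpret prob_space "M n" by (rule prob)
    let ?A = "{\<omega> \<in> space (M n). \<bar>frob_sq (restrict_blocks (Bstar n) (S n \<omega>) - Sig n) / real (p n)\<bar> > K * \<bar>1 / real n\<bar>}"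
    let ?H = "{\<omega> \<in> space (M n). \<bar>frob_sq (restrict_blocks (Bhat n \<omega>) (S n \<omega>) - Sig n) / real (p n)\<bar> > K * \<bar>1 / real n\<bar>}"
    have [measurable]: "(\<lambda>\<omega>. frob_sq (restrict_blocks (Bstar n) (S n \<omega>) - Sig n)) \<in> borel_measurable (M n)"
      by (rule frob_Bstar_measurable) (use elim in auto)
    have A: "?A \<in> sets (M n)" by measurable
    obtain F where F: "F \<in> sets (M n)" "measure (M n) F \<le> e / 2"
      and sel: "\<And>\<omega> B. \<omega> \<in> space (M n) - F \<Longrightarrow> is_B_tot (\<kappa> n) (S n \<omega>) B \<or> is_B_corr (\<kappa> n) (S n \<omega>) B \<or>
       B = B_thr (S n \<omega>) (real n powr (- 1 / 3)) \<or> is_B_s m (\<kappa> n) (S n \<omega>) B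
       \<Longrightarrow> restrict_blocks B (S n \<omega>) = restrict_blocks (Bstar n) (S n \<omega>)"
      using elim(2) by blast
    obtain Z where Z: "Z \<in> null_sets (M n)" and est': "\<And>\<omega>. \<omega> \<in> space (M n) - Z \<Longrightarrow>
      is_B_tot (\<kappa> n) (S n \<omega>) (Bhat n \<omega>) \<or> is_B_corr (\<kappa> n) (S n \<omega>) (Bhat n \<omega>) \<or>
      Bhat n \<omega> = B_thr (S n \<omega>) (real n powr (- 1 / 3)) \<or> is_B_s m (\<kappa> n) (S n \<omega>) (Bhat n \<omega>)"
      using elim(3) by (auto elim!: AE_E3)
    have Zs: "Z \<in> sets (M n)" and Z0: "measure (M n) Z = 0" using Z by (auto simp: null_sets_def measure_def)
    have "?H \<subseteq> ?A \<union> F \<union> Z"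
    proof
      fix \<omega> assume h: "\<omega> \<in> ?H"
      show "\<omega> \<in> ?A \<union> F \<union> Z"
      proof (cases "\<omega> \<in> F \<or> \<omega> \<in> Z")
        case False
        have sp: "\<omega> \<in> space (M n)" using h by simp
        have "restrict_blocks (Bhat n \<omega>) (S n \<omega>) = restrict_blocks (Bstar n) (S n \<omega>)"
          by (rule sel) (use sp False est' in auto)
        then show ?thesis using h by simp
      qed auto
    qed
    then have "measure (M n) ?H \<le> measure (M n) (?A \<union> F \<union> Z)"
      by (rule finite_measure_mono) (use A F Zs in auto)
    also have "\<dots> \<le> measure (M n) (?A \<union> F) + measure (M n) Z"
      by (rule measure_Un_le) (use A F Zs in auto)
    also have "measure (M n) (?A \<union> F) \<le> measure (M n) ?A + measure (M n) F"
      by (rule measure_Un_le[OF A F(1)])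
    finally show ?case using elim(1) F(2) Z0 by linarith
  qed
  then show "\<exists>K. \<forall>\<^sub>F n in sequentially. measure (M n)
       {\<omega> \<in> space (M n). \<bar>frob_sq (restrict_blocks (Bhat n \<omega>) (S n \<omega>) - Sig n) / real (p n)\<bar> > K * \<bar>1 / real n\<bar>} \<le> e"
    by blast
qed

text \<open>
  Count the diagonal entries with a deviation of at least \<open>h n\<^sup>-\<^sup>1\<^sup>/\<^sup>2\<close>. The expected number is
  at least \<open>p c1\<close>. Each of them contributes \<open>h\<^sup>2/n\<close> to the Frobenius norm, so a norm of at
  most \<open>e p/n\<close> allows only \<open>p c1/2\<close> of them, and the norm exceeds this level with
  probability at least \<open>c1/2\<close>.
\<close>
lemma not_smallo_Bstar:
  "\<not> smallo_p M (\<lambda>n \<omega>. frob_sq (restrict_blocks (Bstar n) (S n \<omega>) - Sig n) / real (p n)) (\<lambda>n. 1 / real n)"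
proof
  assume small: "smallo_p M (\<lambda>n \<omega>. frob_sq (restrict_blocks (Bstar n) (S n \<omega>) - Sig n) / real (p n)) (\<lambda>n. 1 / real n)"
  define c1 where "c1 = exp (- 16) / (2::real)"
  have c1: "0 < c1" by (simp add: c1_def)
  define h where "h = ln (3 / 2) / 2 * lam_inf"
  have h: "0 < h" using eigen(1) by (simp add: h_def)
  define e where "e = h\<^sup>2 * c1 / 2"
  have e: "0 < e" using h c1 by (simp add: e_def)
  let ?A = "\<lambda>n. {\<omega> \<in> space (M n). \<bar>frob_sq (restrict_blocks (Bstar n) (S n \<omega>) - Sig n) / real (p n)\<bar> > e * \<bar>1 / real n\<bar>}"
  have "(\<lambda>n. measure (M n) (?A n)) \<longlonglongrightarrow> 0" using small e unfolding smallo_p_def by blast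
  then have up: "\<forall>\<^sub>F n in sequentially. measure (M n) (?A n) < c1 / 2"
    by (rule order_tendstoD(2)) (use c1 in simp)
  have "(\<lambda>n. 2 * exp (- sqrt (real n) * ln (3 / 2) / 4)) \<longlonglongrightarrow> (0::real)" by real_asymp
  then have tail: "\<forall>\<^sub>F n in sequentially. 2 * exp (- sqrt (real n) * ln (3 / 2) / 4) < c1"
    by (rule order_tendstoD(2)) (use c1 in simp)
  have "\<forall>\<^sub>F n in sequentially. False"
    using up tail eventually_gauss eventually_ge_at_top[of 64]
  proof eventually_elim
    case (elim n)
    then have n: "0 < real n" and p: "0 < real (p n)" by auto
    interpret G: gauss_sample "M n" "p n" n "\<mu> n" "Sig n" "X n" lam_inf lam_sup
      by (rule gauss_sample_n) (use elim in auto)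
    have S_eq: "S n \<omega> = G.Smat \<omega>" for \<omega> by (simp add: S_def G.Smat_def)
    have [measurable]: "(\<lambda>\<omega>. frob_sq (restrict_blocks (Bstar n) (S n \<omega>) - Sig n)) \<in> borel_measurable (M n)"
      by (rule frob_Bstar_measurable) (use elim in auto)
    have A: "?A n \<in> sets (M n)" by measurable
    define E where "E = (\<lambda>i. {\<omega> \<in> space (M n). h \<le> sqrt (real n) * (S n \<omega> $$ (i, i) - Sig n $$ (i, i))})"
    have E: "E i \<in> sets (M n)" if "i < p n" for i
    proof -
      have [measurable]: "(\<lambda>\<omega>. S n \<omega> $$ (i, i)) \<in> borel_measurable (M n)"
        by (rule S_entry_measurable) (use elim that in auto)
      show ?thesis unfolding E_def by measurable
    qed
    have pE: "c1 \<le> measure (M n) (E i)" if i: "i < p n" for i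
    proof -
      have "exp (- 16) - 2 * exp (- sqrt (real n) * ln (3 / 2) / 4) \<le> measure (M n) (E i)"
        unfolding E_def S_eq h_def by (rule G.prob_diag_large[OF i]) (use elim in simp)
      moreover have "c1 = exp (- 16) - c1" by (simp add: c1_def)
      ultimately show ?thesis using elim(2) by linarith
    qed
    have count: "(\<Sum>i<p n. indicator (E i) \<omega>) \<le> real (p n) * c1 / 2 + real (p n) * indicator (?A n) \<omega>"
      if \<omega>: "\<omega> \<in> space (M n)" for \<omega>
    proof (cases "\<omega> \<in> ?A n")
      case True
      have "(\<Sum>i<p n. indicator (E i) \<omega>) \<le> (\<Sum>i<p n. 1 :: real)" by (intro sum_mono) (simp add: indicator_def)
      then have "(\<Sum>i<p n. indicator (E i) \<omega>) \<le> real (p n)" by simp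
      moreover have "0 \<le> real (p n) * c1 / 2" using c1 by simp
      moreover have "real (p n) * indicator (?A n) \<omega> = real (p n)" using True by simp
      ultimately show ?thesis by linarith
    next
      case False
      let ?f = "frob_sq (restrict_blocks (Bstar n) (S n \<omega>) - Sig n)"
      have "\<bar>?f / real (p n)\<bar> \<le> e / real n" using False \<omega> by simp
      then have fle: "?f \<le> e / real n * real (p n)" using p by (simp add: field_simps abs_le_iff)
      have sub: "(\<lambda>i. (i, i)) ` {..<p n} \<subseteq> block_pairs (Bstar n)"
        using same_block_refl[OF Bstar_partition] by (auto simp: block_pairs_def)
      have "(\<Sum>i<p n. h\<^sup>2 / real n * indicator (E i) \<omega>) \<le> (\<Sum>i<p n. (S n \<omega> $$ (i, i) - Sig n $$ (i, i))\<^sup>2)"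
      proof (rule sum_mono)
        fix i
        show "h\<^sup>2 / real n * indicator (E i) \<omega> \<le> (S n \<omega> $$ (i, i) - Sig n $$ (i, i))\<^sup>2"
        proof (cases "\<omega> \<in> E i")
          case True
          then have "h\<^sup>2 \<le> (sqrt (real n) * (S n \<omega> $$ (i, i) - Sig n $$ (i, i)))\<^sup>2"
            using h by (intro power_mono) (auto simp: E_def)
          also have "\<dots> = real n * (S n \<omega> $$ (i, i) - Sig n $$ (i, i))\<^sup>2" by (simp add: power_mult_distrib)
          finally show ?thesis using True n by (simp add: field_simps)
        qed simp
      qed
      also have "\<dots> = (\<Sum>x\<in>(\<lambda>i. (i, i)) ` {..<p n}. (S n \<omega> $$ x - Sig n $$ x)\<^sup>2)"
        by (subst sum.reindex) (auto simp: inj_on_def)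
      also have "\<dots> \<le> (\<Sum>x\<in>block_pairs (Bstar n). (S n \<omega> $$ x - Sig n $$ x)\<^sup>2)"
        by (rule sum_mono2[OF finite_block_pairs[OF Bstar_partition] sub]) simp
      also have "\<dots> = ?f" unfolding frob_Bstar_eq by (simp add: case_prod_unfold)
      also note fle
      finally have "h\<^sup>2 / real n * (\<Sum>i<p n. indicator (E i) \<omega>) \<le> h\<^sup>2 / real n * (real (p n) * c1 / 2)"
        by (simp add: sum_distrib_left e_def mult_ac)
      moreover have "0 < h\<^sup>2 / real n" using h n by simp
      ultimately have "(\<Sum>i<p n. indicator (E i) \<omega>) \<le> real (p n) * c1 / 2" by (simp only: mult_le_cancel_left_pos)
      then show ?thesis using False by simp
    qed
    have "real (p n) * c1 = (\<Sum>i<p n. c1)" by simp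
    also have "\<dots> \<le> (\<Sum>i<p n. measure (M n) (E i))" by (intro sum_mono pE) simp
    also have "\<dots> = (\<Sum>i<p n. \<integral>\<omega>. indicator (E i) \<omega> \<partial>M n)"
      using E by (intro sum.cong refl) (simp add: Int_absorb1 sets.sets_into_space)
    also have "\<dots> = (\<integral>\<omega>. (\<Sum>i<p n. indicator (E i) \<omega>) \<partial>M n)"
      using E by (intro Bochner_Integration.integral_sum[symmetric]) (auto simp: G.emeasure_eq_measure)
    also have "\<dots> \<le> (\<integral>\<omega>. real (p n) * c1 / 2 + real (p n) * indicator (?A n) \<omega> \<partial>M n)"
    proof (rule integral_mono)
      show "integrable (M n) (\<lambda>\<omega>. \<Sum>i<p n. indicator (E i) \<omega> :: real)"
        using E by (intro Bochner_Integration.integrable_sum) (auto simp: G.emeasure_eq_measure)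
      show "integrable (M n) (\<lambda>\<omega>. real (p n) * c1 / 2 + real (p n) * indicator (?A n) \<omega>)"
        using A by (intro Bochner_Integration.integrable_add integrable_mult_right) (auto simp: G.emeasure_eq_measure)
    qed (rule count)
    also have "\<dots> = real (p n) * c1 / 2 + real (p n) * measure (M n) (?A n)"
      using A by (subst Bochner_Integration.integral_add) (auto simp: G.emeasure_eq_measure G.prob_space Int_absorb1 sets.sets_into_space intro!: integrable_mult_right)
    also have "\<dots> < real (p n) * c1 / 2 + real (p n) * (c1 / 2)"
      using elim(1) p by (intro add_strict_left_mono mult_strict_left_mono) auto
    finally show False by simp
  qed
  then show False by simp
qed

end

theorem proposition9:
  fixes M :: "nat \<Rightarrow> 'w measure"
    and p :: "nat \<Rightarrow> nat"
    and \<mu> :: "nat \<Rightarrow> real Matrix.vec"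
    and Sig :: "nat \<Rightarrow> real Matrix.mat"
    and X :: "nat \<Rightarrow> nat \<Rightarrow> 'w \<Rightarrow> nat \<Rightarrow> real"
    and S :: "nat \<Rightarrow> 'w \<Rightarrow> real Matrix.mat"
    and Bstar :: "nat \<Rightarrow> nat set set"
    and \<kappa> :: "nat \<Rightarrow> real"
    and y lam_inf lam_sup a \<delta> :: real
    and m :: nat
  assumes prob: "\<And>n. prob_space (M n)"
    and mu_dim: "\<And>n. \<mu> n \<in> carrier_vec (p n)"
    and Sig_dim: "\<And>n. Sig n \<in> carrier_mat (p n) (p n)"
    and Sig_spd: "\<And>n. sym_pos_def (Sig n)"
    and sample: "\<And>n. iid_mvn (M n) (p n) n (\<mu> n) (Sig n) (X n)"
    and S_def: "S = (\<lambda>n \<omega>. sample_cov (p n) n (\<lambda>l. X n l \<omega>))"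
    and Bstar_def: "Bstar = (\<lambda>n. block_partition (Sig n))"
    and p_lim: "filterlim p at_top sequentially"
    and ratio: "(\<lambda>n. real (p n) / real n) \<longlonglongrightarrow> y" "0 < y" "y < 1"
    and eigen: "0 < lam_inf"
      "\<And>n k. eigenvalue (Sig n) k \<Longrightarrow> lam_inf \<le> k \<and> k \<le> lam_sup"
    and blocks: "1 \<le> m" "\<And>n A. A \<in> Bstar n \<Longrightarrow> card A \<le> m"
    and gap: "0 < a"
      "\<And>n B. refines {..<p n} B (Bstar n) \<Longrightarrow> B \<noteq> Bstar n \<Longrightarrow>
         max_norm (restrict_blocks B (Sig n) - Sig n) \<ge> a * real n powr (- 1 / 4)"
    and delta: "1 / 2 < \<delta>" "\<delta> < 1"
    and kappa_def: "\<kappa> = (\<lambda>n. 1 / (real (p n) * real n powr \<delta>))"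
  shows
    "bigO_p M (\<lambda>n \<omega>. frob_sq (restrict_blocks (Bstar n) (S n \<omega>) - Sig n) / real (p n))
       (\<lambda>n. 1 / real n)
     \<and> (\<forall>Bhat :: nat \<Rightarrow> 'w \<Rightarrow> nat set set.
          (\<forall>n. Bhat n \<in> measurable (M n) (count_space UNIV)) \<and>
          ((\<forall>\<^sub>F n in sequentially. AE \<omega> in M n. is_B_tot (\<kappa> n) (S n \<omega>) (Bhat n \<omega>)) \<or>
           (\<forall>\<^sub>F n in sequentially. AE \<omega> in M n. is_B_corr (\<kappa> n) (S n \<omega>) (Bhat n \<omega>)) \<or>
           (\<forall>\<^sub>F n in sequentially. AE \<omega> in M n. Bhat n \<omega> = B_thr (S n \<omega>) (real n powr (- 1 / 3))) \<or>
           (\<forall>\<^sub>F n in sequentially. AE \<omega> in M n. is_B_s m (\<kappa> n) (S n \<omega>) (Bhat n \<omega>)))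
          \<longrightarrow> bigO_p M (\<lambda>n \<omega>. frob_sq (restrict_blocks (Bhat n \<omega>) (S n \<omega>) - Sig n) / real (p n))
                (\<lambda>n. 1 / real n))
     \<and> \<not> smallo_p M (\<lambda>n \<omega>. frob_sq (restrict_blocks (Bstar n) (S n \<omega>) - Sig n) / real (p n))
           (\<lambda>n. 1 / real n)"
proof -
  interpret block_model M p \<mu> Sig X S Bstar \<kappa> y lam_inf lam_sup a \<delta> m
    by (rule block_model.intro) (fact assms)+
  have AE_mono: "\<forall>\<^sub>F n in sequentially. AE \<omega> in M n. Q n \<omega>"
    if "\<forall>\<^sub>F n in sequentially. AE \<omega> in M n. P n \<omega>" "\<And>n \<omega>. P n \<omega> \<Longrightarrow> Q n \<omega>" for P Q
    using that(1) by (rule eventually_mono) (use that(2) in \<open>auto elim: eventually_mono\<close>)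
  have est: "bigO_p M (\<lambda>n \<omega>. frob_sq (restrict_blocks (Bhat n \<omega>) (S n \<omega>) - Sig n) / real (p n)) (\<lambda>n. 1 / real n)"
    if "(\<forall>\<^sub>F n in sequentially. AE \<omega> in M n. is_B_tot (\<kappa> n) (S n \<omega>) (Bhat n \<omega>)) \<or>
        (\<forall>\<^sub>F n in sequentially. AE \<omega> in M n. is_B_corr (\<kappa> n) (S n \<omega>) (Bhat n \<omega>)) \<or>
        (\<forall>\<^sub>F n in sequentially. AE \<omega> in M n. Bhat n \<omega> = B_thr (S n \<omega>) (real n powr (- 1 / 3))) \<or>
        (\<forall>\<^sub>F n in sequentially. AE \<omega> in M n. is_B_s m (\<kappa> n) (S n \<omega>) (Bhat n \<omega>))" for Bhat
  proof (rule bigO_estimator)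
    show "\<forall>\<^sub>F n in sequentially. AE \<omega> in M n.
      is_B_tot (\<kappa> n) (S n \<omega>) (Bhat n \<omega>) \<or> is_B_corr (\<kappa> n) (S n \<omega>) (Bhat n \<omega>) \<or>
      Bhat n \<omega> = B_thr (S n \<omega>) (real n powr (- 1 / 3)) \<or> is_B_s m (\<kappa> n) (S n \<omega>) (Bhat n \<omega>)"
      using that by (elim disjE) (erule AE_mono, blast)+
  qed
  show ?thesis using bigO_Bstar est not_smallo_Bstar by blast
qed

end
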